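(* Let $p\ge 2$ be an integer such that $F_v(2,2,p;p+1)\le 2p+5$. Then $r'(p)=2$ and $$F_v(\underbrace{2,\dots,2}_{r},p;r+p-1)=F_v(2,2,p;p+1)+r-2\quad\text{for all } r\ge 2.$$
   Context: All graphs are finite, simple and undirected; $\omega(G)$ denotes the clique number. Write $G \overset{v}{\rightarrow} (a_1,\dots,a_s)$ if for every coloring of the vertices of $G$ with $s$ colors there exists $i$ such that $G$ contains a clique on $a_i$ vertices all of whose vertices have color $i$. $F_v(a_1,\dots,a_s;q)$ is the minimum number of vertices of a graph $G$ with $G \overset{v}{\rightarrow} (a_1,\dots,a_s)$ and $\omega(G)<q$. For fixed $p$, $r'(p)$ denotes the smallest integer $r_0\ge 2$ such that $\min_{r\ge 2}\{F_v(2_r,p;r+p-1)-r\}=F_v(2_{r_0},p;r_0+p-1)-r_0$, where $2_r$ denotes $r$ copies of $2$. *)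

theory Defs
  imports Main
begin

definition simple_graph :: "nat \<Rightarrow> (nat \<Rightarrow> nat \<Rightarrow> bool) \<Rightarrow> bool" where
  "simple_graph n E \<longleftrightarrow>
     (\<forall>x y. E x y \<longrightarrow> E y x) \<and> (\<forall>x. \<not> E x x) \<and> (\<forall>x y. E x y \<longrightarrow> x < n \<and> y < n)"

definition is_clique :: "(nat \<Rightarrow> nat \<Rightarrow> bool) \<Rightarrow> nat set \<Rightarrow> bool" where
  "is_clique E K \<longleftrightarrow> (\<forall>x\<in>K. \<forall>y\<in>K. x \<noteq> y \<longrightarrow> E x y)"

definition clique_number_less :: "nat \<Rightarrow> (nat \<Rightarrow> nat \<Rightarrow> bool) \<Rightarrow> nat \<Rightarrow> bool" where
  "clique_number_less n E q \<longleftrightarrow> \<not> (\<exists>K \<subseteq> {0..<n}. card K = q \<and> is_clique E K)"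

definition vertex_arrows :: "nat \<Rightarrow> (nat \<Rightarrow> nat \<Rightarrow> bool) \<Rightarrow> nat list \<Rightarrow> bool" where
  "vertex_arrows n E as \<longleftrightarrow>
     (\<forall>c :: nat \<Rightarrow> nat. (\<forall>v<n. c v < length as) \<longrightarrow>
        (\<exists>i<length as. \<exists>K \<subseteq> {0..<n}. card K = as ! i \<and> is_clique E K \<and> (\<forall>v\<in>K. c v = i)))"

definition Fv :: "nat list \<Rightarrow> nat \<Rightarrow> nat" where
  "Fv as q = (LEAST n. \<exists>E. simple_graph n E \<and> vertex_arrows n E as \<and> clique_number_less n E q)"

definition Fshift :: "nat \<Rightarrow> nat \<Rightarrow> int" where
  "Fshift p r = int (Fv (replicate r 2 @ [p]) (r + p - 1)) - int r"

definition r_prime :: "nat \<Rightarrow> nat" where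
  "r_prime p = (LEAST r0. 2 \<le> r0 \<and> (\<forall>r\<ge>2. Fshift p r0 \<le> Fshift p r))"

end

theory Submission
  imports Defs
begin

text \<open>
  Write \<open>E\<close> for the complement of a graph \<open>G\<close>. Then \<open>G\<close> arrows \<open>(2\<^sub>r, p)\<close> iff deleting any \<open>r\<close> cliques
  of \<open>E\<close> leaves an independent \<open>p\<close>-set of \<open>E\<close>, and the clique number of \<open>G\<close> is the independence
  number of \<open>E\<close>. Adding isolated vertices to \<open>E\<close> gives \<open>F(r + 1) \<le> F(r) + 1\<close>. If the equality fails for
  a smallest \<open>r \<ge> 3\<close>, the extremal graph has at most \<open>r + 2p + 2\<close> vertices, and deleting one clique of
  \<open>E\<close> keeps the independence number \<open>w = r + p - 2\<close>.

  Criticality of this kind forces \<open>|N(Y)| > |Y|\<close> for every nonempty independent \<open>Y\<close>, hence at least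
  \<open>2w + 1\<close> vertices, and with exactly \<open>2w + 1\<close> vertices \<open>E\<close> is an odd cycle. This leaves
  \<open>r \<le> 5\<close>. For \<open>r = 5\<close> there is a cover by \<open>w + 1\<close> cliques. For \<open>r = 4\<close> the graph \<open>E\<close> consists of a
  pentagon and a part that behaves like an odd cycle, with edges in between, and four
  cliques of that part can be deleted. For \<open>r = 3\<close> it is an odd cycle of length \<open>2p + 1\<close> plus two
  edges; comparing which maximum independent sets of the cycle are avoided by the four extra vertices
  gives the contradiction. The cases \<open>r = 3, 4\<close> need \<open>p \<ge> 3\<close>; for \<open>p = 2\<close> the hypothesis fails,
  because triangle-free graphs on at most 9 vertices are 3-colourable.
\<close>

section \<open>Independent sets and cliques\<close>

text \<open>With \<open>w = r + p - 2\<close>, the bounds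
  \<open>2 * w + 1 = 2 * r + 2 * p - 3\<close> and \<open>r + 2 * p + 2\<close> on the number of
  vertices differ by \<open>5 - r\<close>. So 2, 1 and 0 spare vertices remain for r = 3, 4, 5; this
  is where the 5 in \<open>2 * p + 5\<close> is spent. Without spare vertices the strictness of the
  bound on \<open>N(Y)\<close> matters: whichever vertex is left out, the rest is perfectly matched
  by \<open>w\<close> edges of \<open>E\<close>. Most contradictions then have one source:
  \<open>V\<close> has no cover by \<open>r + p - 1\<close> cliques of \<open>E\<close>, since
  deleting \<open>r\<close> of them leaves \<open>p - 1\<close>, which contain no independent
  \<open>p\<close>-set. With spare vertices, two edges (and for r = 4 one vertex) are split off so
  that the rest is critical without slack. The obstacle is the unknown adjacency between the
  split-off part and the cycle. For r = 3 it is controlled by asking which maximum independent sets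
  of the cycle each outer vertex can extend. There \<open>p \<ge> 3\<close> gives a cycle of length
  at least 7, long enough for an edge to be recognised from its two outer neighbours.\<close>

lemma hall:
  assumes "finite S" and "\<And>y. y \<in> S \<Longrightarrow> finite (N y)"
    and "\<And>Y. Y \<subseteq> S \<Longrightarrow> card Y \<le> card (\<Union>(N ` Y))"
  shows "\<exists>\<sigma>. inj_on \<sigma> S \<and> (\<forall>y\<in>S. \<sigma> y \<in> N y)"
  using assms
proof (induction "card S" arbitrary: S N rule: less_induct)
  case less
  note fin = less.prems(1,2) and H = less.prems(3)
  show ?case
  proof (cases "S = {}")
    case False
    show ?thesis
    \<comment> \<open>A proper nonempty \<open>Y\<close> without surplus is matched into its own
      neighbourhood, and the rest keeps Hall's condition outside that neighbourhood. If no such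
      \<open>Y\<close> exists, one arbitrary choice costs every smaller set at most one neighbour,
      which it can afford.\<close>
    proof (cases "\<exists>Y. Y \<noteq> {} \<and> Y \<subset> S \<and> card (\<Union>(N ` Y)) = card Y")
      case True
      then obtain Y where Y: "Y \<noteq> {}" "Y \<subset> S" "card (\<Union>(N ` Y)) = card Y" by blast
      let ?U = "\<Union>(N ` Y)"
      have finY: "finite Y" using Y fin finite_subset by blast
      have finU: "finite ?U" using finY Y(2) fin(2) by blast
      have "card Y < card S" using Y fin psubset_card_mono by blast
      then have "\<exists>\<sigma>. inj_on \<sigma> Y \<and> (\<forall>y\<in>Y. \<sigma> y \<in> N y)"
        by (rule less.hyps) (use finY fin(2) H Y(2) in auto)
      then obtain \<sigma> where s: "inj_on \<sigma> Y" "\<forall>y\<in>Y. \<sigma> y \<in> N y" by blast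
      have "\<exists>\<tau>. inj_on \<tau> (S - Y) \<and> (\<forall>y\<in>S - Y. \<tau> y \<in> N y - ?U)"
      proof (rule less.hyps)
        show "card (S - Y) < card S" using Y fin(1) by (intro psubset_card_mono) auto
        show "finite (S - Y)" using fin by simp
        show "finite (N y - ?U)" if "y \<in> S - Y" for y using that fin by simp
        fix Z assume Z: "Z \<subseteq> S - Y"
        then have finZ: "finite Z" using fin(1) by (meson finite_Diff finite_subset)
        have "card (Z \<union> Y) \<le> card (\<Union>(N ` (Z \<union> Y)))" using H[of "Z \<union> Y"] Z Y(2) by blast
        moreover have "card (Z \<union> Y) = card Z + card Y" using Z finZ finY by (intro card_Un_disjoint) auto
        moreover have "\<Union>(N ` (Z \<union> Y)) = (\<Union>z\<in>Z. N z - ?U) \<union> ?U" by blast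
        moreover have "card ((\<Union>z\<in>Z. N z - ?U) \<union> ?U) = card (\<Union>z\<in>Z. N z - ?U) + card ?U"
          using finZ finU Z fin(2) by (intro card_Un_disjoint) auto
        ultimately show "card Z \<le> card (\<Union>z\<in>Z. N z - ?U)" using Y(3)
          by (metis add_le_cancel_right)
      qed
      then obtain \<tau> where t: "inj_on \<tau> (S - Y)" "\<forall>y\<in>S - Y. \<tau> y \<in> N y - ?U" by blast
      let ?r = "\<lambda>y. if y \<in> Y then \<sigma> y else \<tau> y"
      have "inj_on ?r S"
      proof (rule inj_onI)
        fix x y assume xy: "x \<in> S" "y \<in> S" "?r x = ?r y"
        show "x = y"
        proof (cases "x \<in> Y"; cases "y \<in> Y")
          assume "x \<in> Y" "y \<in> Y" then show ?thesis using inj_onD[OF s(1), of x y] xy by simp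
        next
          assume "x \<notin> Y" "y \<notin> Y" then show ?thesis using inj_onD[OF t(1), of x y] xy by simp
        next
          assume *: "x \<in> Y" "y \<notin> Y"
          have "\<sigma> x \<in> N x" using s(2) *(1) by (rule bspec)
          moreover have "\<tau> y \<in> N y - ?U" using t(2) by (rule bspec) (use * xy in simp)
          moreover have "\<sigma> x = \<tau> y" using xy(3) * by simp
          ultimately show ?thesis using *(1) by (metis DiffD2 UN_I)
        next
          assume *: "x \<notin> Y" "y \<in> Y"
          have "\<sigma> y \<in> N y" using s(2) *(2) by (rule bspec)
          moreover have "\<tau> x \<in> N x - ?U" using t(2) by (rule bspec) (use * xy in simp)
          moreover have "\<sigma> y = \<tau> x" using xy(3) * by simp
          ultimately show ?thesis using *(2) by (metis DiffD2 UN_I)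
        qed
      qed
      moreover have "\<forall>y\<in>S. ?r y \<in> N y" using s t by auto
      ultimately show ?thesis by blast
    next
      case False
      then have strict: "card Y < card (\<Union>(N ` Y))" if "Y \<noteq> {}" "Y \<subset> S" for Y
        using H that by (metis le_neq_implies_less psubset_imp_subset)
      obtain x where x: "x \<in> S" using \<open>S \<noteq> {}\<close> by blast
      have "card {x} \<le> card (\<Union>(N ` {x}))" using H[of "{x}"] x by blast
      then have "N x \<noteq> {}" by auto
      then obtain t where t: "t \<in> N x" by blast
      have "\<exists>\<tau>. inj_on \<tau> (S - {x}) \<and> (\<forall>y\<in>S - {x}. \<tau> y \<in> N y - {t})"
      proof (rule less.hyps)
        show "card (S - {x}) < card S" using x fin(1) by (intro psubset_card_mono) auto
        show "finite (S - {x})" using fin by simp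
        show "finite (N y - {t})" if "y \<in> S - {x}" for y using that fin by simp
        fix Z assume Z: "Z \<subseteq> S - {x}"
        have eq: "(\<Union>z\<in>Z. N z - {t}) = \<Union>(N ` Z) - {t}" by blast
        show "card Z \<le> card (\<Union>z\<in>Z. N z - {t})"
        proof (cases "Z = {}")
          case False
          then have "card Z < card (\<Union>(N ` Z))" using strict Z x by blast
          then show ?thesis unfolding eq
            using diff_card_le_card_Diff[of "{t}" "\<Union>(N ` Z)"] by simp
        qed simp
      qed
      then obtain \<tau> where t': "inj_on \<tau> (S - {x})" "\<forall>y\<in>S - {x}. \<tau> y \<in> N y - {t}" by blast
      have "inj_on (\<tau>(x := t)) (insert x (S - {x}))"
        unfolding inj_on_insert
      proof (intro conjI)
        show "inj_on (\<tau>(x := t)) (S - {x})"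
          using t'(1) by (subst inj_on_cong[where g = \<tau>]) auto
        show "(\<tau>(x := t)) x \<notin> (\<tau>(x := t)) ` (S - {x} - {x})" using t'(2) by auto
      qed
      then have "inj_on (\<tau>(x := t)) S" using x by (simp add: insert_absorb)
      moreover have "\<forall>y\<in>S. (\<tau>(x := t)) y \<in> N y"
      proof
        fix y assume "y \<in> S" then show "(\<tau>(x := t)) y \<in> N y"
          using bspec[OF t'(2), of y] t by (cases "y = x") simp_all
      qed
      ultimately show ?thesis by blast
    qed
  qed auto
qed

definition graph_rel :: "('a \<Rightarrow> 'a \<Rightarrow> bool) \<Rightarrow> bool" where
  "graph_rel E \<longleftrightarrow> (\<forall>x y. E x y \<longrightarrow> E y x) \<and> (\<forall>x. \<not> E x x)"

definition indep :: "('a \<Rightarrow> 'a \<Rightarrow> bool) \<Rightarrow> 'a set \<Rightarrow> bool" where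
  "indep E I \<longleftrightarrow> (\<forall>x\<in>I. \<forall>y\<in>I. \<not> E x y)"

definition clq :: "('a \<Rightarrow> 'a \<Rightarrow> bool) \<Rightarrow> 'a set \<Rightarrow> bool" where
  "clq E C \<longleftrightarrow> (\<forall>x\<in>C. \<forall>y\<in>C. x \<noteq> y \<longrightarrow> E x y)"

definition nbs :: "('a \<Rightarrow> 'a \<Rightarrow> bool) \<Rightarrow> 'a set \<Rightarrow> 'a set \<Rightarrow> 'a set" where
  "nbs E X Y = {x \<in> X. \<exists>y\<in>Y. E y x}"

definition alpha_le :: "('a \<Rightarrow> 'a \<Rightarrow> bool) \<Rightarrow> 'a set \<Rightarrow> nat \<Rightarrow> bool" where
  "alpha_le E X k \<longleftrightarrow> (\<forall>I\<subseteq>X. indep E I \<longrightarrow> card I \<le> k)"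

definition has_ind :: "('a \<Rightarrow> 'a \<Rightarrow> bool) \<Rightarrow> 'a set \<Rightarrow> nat \<Rightarrow> bool" where
  "has_ind E X k \<longleftrightarrow> (\<exists>I\<subseteq>X. indep E I \<and> card I = k)"

text \<open>The case \<open>x = y\<close> is the deletion of a single vertex. Nonemptiness excludes
  the empty graph, which would satisfy the other clauses for every \<open>k\<close> and break the
  bound \<open>2 * k + 1 \<le> card X\<close>.\<close>

definition crit :: "('a \<Rightarrow> 'a \<Rightarrow> bool) \<Rightarrow> 'a set \<Rightarrow> nat \<Rightarrow> bool" where
  "crit E X k \<longleftrightarrow> graph_rel E \<and> finite X \<and> X \<noteq> {} \<and> alpha_le E X k \<and>
     (\<forall>x\<in>X. \<forall>y\<in>X. x = y \<or> E x y \<longrightarrow> has_ind E (X - {x, y}) k)"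

definition clq_cover :: "('a \<Rightarrow> 'a \<Rightarrow> bool) \<Rightarrow> 'a set \<Rightarrow> nat \<Rightarrow> bool" where
  "clq_cover E X k \<longleftrightarrow> (\<exists>\<C>. finite \<C> \<and> card \<C> \<le> k \<and> (\<forall>C\<in>\<C>. clq E C) \<and> X \<subseteq> \<Union>\<C>)"

lemma not_alpha_le: "finite X \<Longrightarrow> \<not> alpha_le E X k \<longleftrightarrow> has_ind E X (Suc k)"
proof
  assume "finite X" "\<not> alpha_le E X k"
  then obtain I where I: "I \<subseteq> X" "indep E I" "Suc k \<le> card I"
    unfolding alpha_le_def not_less_eq_eq[symmetric] by blast
  obtain J where J: "J \<subseteq> I" "card J = Suc k" using obtain_subset_with_card_n[OF I(3)] by blast
  have "indep E J" using I(2) J(1) unfolding indep_def by blast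
  then show "has_ind E X (Suc k)" using I(1) J unfolding has_ind_def by blast
next
  assume "has_ind E X (Suc k)"
  then obtain I where "I \<subseteq> X" "indep E I" "card I = Suc k" unfolding has_ind_def by blast
  then have "\<exists>I\<subseteq>X. indep E I \<and> \<not> card I \<le> k" by (intro exI[of _ I]) simp
  then show "\<not> alpha_le E X k" unfolding alpha_le_def by blast
qed

lemma has_ind_mono: "has_ind E X k \<Longrightarrow> X \<subseteq> Y \<Longrightarrow> has_ind E Y k"
  unfolding has_ind_def by blast

lemma alpha_le_mono: "alpha_le E X k \<Longrightarrow> Y \<subseteq> X \<Longrightarrow> alpha_le E Y k"
  unfolding alpha_le_def by blast

lemma has_indE:
  assumes "has_ind E X k" obtains I where "I \<subseteq> X" "indep E I" "card I = k"
  using assms unfolding has_ind_def by blast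

lemma graph_rel_sym: "graph_rel E \<Longrightarrow> E x y \<Longrightarrow> E y x"
  and graph_rel_irrefl: "graph_rel E \<Longrightarrow> \<not> E x x"
  unfolding graph_rel_def by blast+

lemma indep_Un:
  assumes "graph_rel E" "indep E I" "indep E J" "\<And>x y. x \<in> I \<Longrightarrow> y \<in> J \<Longrightarrow> \<not> E x y"
  shows "indep E (I \<union> J)"
  using assms unfolding indep_def graph_rel_def by blast

lemma indep_insert:
  assumes "graph_rel E" "indep E I" "\<And>y. y \<in> I \<Longrightarrow> \<not> E x y"
  shows "indep E (insert x I)"
  using assms unfolding indep_def graph_rel_def by blast

lemma indep_subset: "indep E I \<Longrightarrow> J \<subseteq> I \<Longrightarrow> indep E J"
  unfolding indep_def by blast

text \<open>Pigeonhole: two vertices of an independent set never share a clique.\<close>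

lemma clq_cover_alpha:
  assumes "clq_cover E X k" shows "alpha_le E X k"
  unfolding alpha_le_def
proof (intro allI impI)
  fix I assume I: "I \<subseteq> X" "indep E I"
  obtain \<C> where C: "finite \<C>" "card \<C> \<le> k" "\<forall>C\<in>\<C>. clq E C" "X \<subseteq> \<Union>\<C>"
    using assms unfolding clq_cover_def by blast
  have "\<forall>x\<in>I. \<exists>C\<in>\<C>. x \<in> C" using I C by blast
  then obtain f where f: "\<And>x. x \<in> I \<Longrightarrow> f x \<in> \<C> \<and> x \<in> f x" by metis
  have "inj_on f I"
    using f I(2) C(3) unfolding inj_on_def indep_def clq_def by blast
  then have "card I \<le> card \<C>" using f C(1) by (intro card_inj_on_le) auto
  then show "card I \<le> k" using C(2) by simp
qed

lemma clq_cover_remove: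
  assumes "clq_cover E X (Suc k)"
  obtains C where "clq E C" "clq_cover E (X - C) k"
proof -
  obtain \<C> where C: "finite \<C>" "card \<C> \<le> Suc k" "\<forall>C\<in>\<C>. clq E C" "X \<subseteq> \<Union>\<C>"
    using assms unfolding clq_cover_def by blast
  show ?thesis
  proof (cases "\<C> = {}")
    case True
    then have "clq_cover E (X - {}) k" unfolding clq_cover_def using C by (intro exI[of _ "{}"]) auto
    then show ?thesis using that[of "{}"] unfolding clq_def by blast
  next
    case False
    then obtain D where D: "D \<in> \<C>" by blast
    have "clq_cover E (X - D) k" unfolding clq_cover_def
      by (rule exI[of _ "\<C> - {D}"]) (use C D in auto)
    then show ?thesis using that C D by blast
  qed
qed

lemma clq_cover_insert:
  assumes "clq_cover E (X - C) k" "clq E C"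
  shows "clq_cover E X (Suc k)"
proof -
  obtain \<C> where C: "finite \<C>" "card \<C> \<le> k" "\<forall>C\<in>\<C>. clq E C" "X - C \<subseteq> \<Union>\<C>"
    using assms unfolding clq_cover_def by blast
  show ?thesis unfolding clq_cover_def
    by (rule exI[of _ "insert C \<C>"]) (use C assms(2) in \<open>auto simp: card_insert_if\<close>)
qed

text \<open>Exchange argument. Let \<open>I\<close> be a maximum independent set that misses some
  \<open>y\<close> in \<open>Y\<close> and a neighbour \<open>v\<close> of \<open>y\<close>.
  Replacing \<open>I \<inter> N(Y)\<close> by \<open>Y - I\<close> keeps independence, so
  \<open>Y - I\<close> is at most as large as \<open>I \<inter> N(Y)\<close>. If \<open>Y\<close>
  misses \<open>I\<close>, the vertex \<open>v\<close> of \<open>N(Y)\<close> outside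
  \<open>I\<close> makes \<open>N(Y)\<close> larger than \<open>Y\<close>. Otherwise
  \<open>Y \<inter> I\<close> is smaller than \<open>Y\<close>, so its neighbourhood has a surplus
  by induction, and that neighbourhood is disjoint from \<open>I\<close>.\<close>

lemma crit_nbs:
  assumes "crit E X k" "Y \<subseteq> X" "indep E Y" "Y \<noteq> {}"
  shows "card Y < card (nbs E X Y)"
  using assms(2-4)
proof (induction "card Y" arbitrary: Y rule: less_induct)
  case less
  note Y = less.prems
  have gr: "graph_rel E" and fin: "finite X" and al: "alpha_le E X k"
    using assms(1) unfolding crit_def by auto
  let ?N = "nbs E X"
  have finY: "finite Y" using Y fin finite_subset by blast
  have finN: "finite (?N Z)" for Z using fin unfolding nbs_def by simp
  have YN: "Y \<inter> ?N Y = {}" using Y unfolding nbs_def indep_def by blast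
  show ?case
  proof (rule ccontr)
    assume neg: "\<not> card Y < card (?N Y)"
    \<comment> \<open>If \<open>Y\<close> has no neighbours, \<open>v = y\<close> falls under the
      deletion of a single vertex; the exchange alone then enlarges \<open>I\<close>.\<close>
    obtain y v where yv: "y \<in> Y" "v \<in> X" "v = y \<or> E y v" "?N Y \<noteq> {} \<longrightarrow> v \<in> ?N Y"
    proof (cases "?N Y = {}")
      case True then show ?thesis using that Y by blast
    next
      case False then show ?thesis using that unfolding nbs_def by blast
    qed
    have "has_ind E (X - {y, v}) k"
      using assms(1) yv Y(1) unfolding crit_def by blast
    then obtain I where I: "I \<subseteq> X - {y, v}" "indep E I" "card I = k" by (rule has_indE)
    have finI: "finite I" using I fin by (meson Diff_subset finite_subset)
    have "indep E ((I - ?N Y) \<union> (Y - I))"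
    proof (rule indep_Un[OF gr])
      show "indep E (I - ?N Y)" "indep E (Y - I)" using I(2) Y(2) by (auto intro: indep_subset)
      show "\<not> E a b" if "a \<in> I - ?N Y" "b \<in> Y - I" for a b
        using that I(1) gr unfolding nbs_def graph_rel_def by blast
    qed
    moreover have "(I - ?N Y) \<union> (Y - I) \<subseteq> X" using I Y by blast
    ultimately have "card ((I - ?N Y) \<union> (Y - I)) \<le> k" using al unfolding alpha_le_def by blast
    moreover have "card ((I - ?N Y) \<union> (Y - I)) = card (I - ?N Y) + card (Y - I)"
      using finI finY by (intro card_Un_disjoint) auto
    moreover have "card (I - ?N Y) + card (I \<inter> ?N Y) = card I"
      using card_Int_Diff[OF finI, of "?N Y"] by simp
    ultimately have c1: "card (Y - I) \<le> card (I \<inter> ?N Y)" using I(3) by linarith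
    have c2: "card (Y - I) + card (Y \<inter> I) = card Y"
      using card_Int_Diff[OF finY, of I] by simp
    show False
    proof (cases "Y \<inter> I = {}")
      case True
      then have c3: "card (Y - I) = card Y" using c2 by simp
      show False
      proof (cases "?N Y = {}")
        case True
        then show False using c1 c3 yv(1) finY by auto
      next
        case False
        then have "v \<in> ?N Y" using yv by simp
        then have "I \<inter> ?N Y \<subset> ?N Y" using I by blast
        then have "card (I \<inter> ?N Y) < card (?N Y)" using finN by (intro psubset_card_mono)
          then show False using c1 c3 neg by linarith
      qed
    next
      case False
      have "Y \<inter> I \<subset> Y" using yv(1) I(1) by blast
      then have "card (Y \<inter> I) < card Y" using finY by (intro psubset_card_mono)
      then have ih: "card (Y \<inter> I) < card (?N (Y \<inter> I))"
        using less.hyps[of "Y \<inter> I"] Y False indep_subset by blast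
      have sub: "I \<inter> ?N Y \<subseteq> ?N Y - ?N (Y \<inter> I)" using I(2) unfolding nbs_def indep_def by blast
      have "?N (Y \<inter> I) \<subseteq> ?N Y" unfolding nbs_def by blast
      then have "card (?N Y - ?N (Y \<inter> I)) + card (?N (Y \<inter> I)) = card (?N Y)"
        using card_Int_Diff[OF finN, of Y "?N (Y \<inter> I)"] by (simp add: Int_absorb1)
      moreover have "card (I \<inter> ?N Y) \<le> card (?N Y - ?N (Y \<inter> I))"
        using sub finN by (meson card_mono finite_Diff)
      ultimately show False using c1 c2 ih neg by linarith
    qed
  qed
qed

section \<open>Critical graphs\<close>

lemma nbs_subset: "nbs E X Y \<subseteq> X"
  unfolding nbs_def by blast

lemma finite_nbs: "finite X \<Longrightarrow> finite (nbs E X Y)"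
  unfolding nbs_def by simp

lemma nbs_Un: "nbs E X (Y \<union> Z) = nbs E X Y \<union> nbs E X Z"
  unfolding nbs_def by blast

lemma critD:
  assumes "crit E X k"
  shows "graph_rel E" "finite X" "X \<noteq> {}" "alpha_le E X k"
    and "\<And>x y. x \<in> X \<Longrightarrow> y \<in> X \<Longrightarrow> x = y \<or> E x y \<Longrightarrow> has_ind E (X - {x, y}) k"
  using assms unfolding crit_def by blast+

lemma crit_avoid:
  assumes "crit E X k" "x \<in> X" "y \<in> X" "x = y \<or> E x y"
  obtains I where "I \<subseteq> X" "x \<notin> I" "y \<notin> I" "indep E I" "card I = k"
proof -
  have "has_ind E (X - {x, y}) k" using critD(5)[OF assms] .
  then obtain I where "I \<subseteq> X - {x, y}" "indep E I" "card I = k" by (rule has_indE)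
  then show ?thesis using that by blast
qed

lemma crit_pos:
  assumes "crit E X k" shows "1 \<le> k"
proof -
  obtain x where x: "x \<in> X" using critD(3)[OF assms] by blast
  have "indep E {x}" using critD(1)[OF assms] unfolding indep_def graph_rel_def by blast
  then have "card {x} \<le> k" using critD(4)[OF assms] x unfolding alpha_le_def by blast
  then show ?thesis by simp
qed

lemma crit_card:
  assumes "crit E X k" shows "2 * k + 1 \<le> card X"
proof -
  obtain x where x: "x \<in> X" using critD(3)[OF assms] by blast
  obtain I where I: "I \<subseteq> X" "indep E I" "card I = k" by (rule crit_avoid[OF assms x x disjI1[OF refl]])
  have fin: "finite X" by (rule critD(2)[OF assms])
  have "I \<noteq> {}" using I(3) crit_pos[OF assms] by auto
  then have "card I < card (nbs E X I)" by (rule crit_nbs[OF assms I(1,2)])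
  moreover have "I \<inter> nbs E X I = {}" using I(2) unfolding nbs_def indep_def by blast
  then have "card (I \<union> nbs E X I) = card I + card (nbs E X I)"
    by (intro card_Un_disjoint finite_subset[OF I(1) fin] finite_nbs[OF fin])
  moreover have "card (I \<union> nbs E X I) \<le> card X"
    by (intro card_mono fin Un_least I(1) nbs_subset)
  ultimately show ?thesis using I(3) by linarith
qed

text \<open>The strict surplus pays for the loss of \<open>v\<close>; the count
  \<open>2 * card I + 1\<close> turns the injection into a bijection onto all that is left.\<close>

lemma hall_matching:
  assumes gr: "graph_rel E" and fin: "finite X" and I: "I \<subseteq> X" "indep E I"
    and card: "card X = 2 * card I + 1" and v: "v \<in> X - I"
    and H: "\<And>Y. Y \<subseteq> I \<Longrightarrow> Y \<noteq> {} \<Longrightarrow> card Y < card (nbs E X Y)"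
  obtains \<sigma> where "inj_on \<sigma> I" "\<sigma> ` I = X - I - {v}" "\<And>y. y \<in> I \<Longrightarrow> E y (\<sigma> y)"
proof -
  have finI: "finite I" by (rule finite_subset[OF I(1) fin])
  have "\<exists>\<sigma>. inj_on \<sigma> I \<and> (\<forall>y\<in>I. \<sigma> y \<in> nbs E X {y} - {v})"
  proof (rule hall[OF finI])
    show "finite (nbs E X {y} - {v})" for y using finite_nbs[OF fin] by simp
    fix Y assume Y: "Y \<subseteq> I"
    have eq: "(\<Union>y\<in>Y. nbs E X {y} - {v}) = nbs E X Y - {v}" unfolding nbs_def by blast
    show "card Y \<le> card (\<Union>y\<in>Y. nbs E X {y} - {v})"
    proof (cases "Y = {}")
      case False
      show ?thesis unfolding eq using H[OF Y False] diff_card_le_card_Diff[of "{v}" "nbs E X Y"] by simp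
    qed simp
  qed
  then obtain \<sigma> where s: "inj_on \<sigma> I" "\<And>y. y \<in> I \<Longrightarrow> \<sigma> y \<in> nbs E X {y} - {v}" by blast
  have e: "E y (\<sigma> y)" if "y \<in> I" for y using s(2)[OF that] unfolding nbs_def by blast
  have "\<sigma> y \<in> X - I - {v}" if "y \<in> I" for y
    using s(2)[OF that] e[OF that] I(2) that unfolding nbs_def indep_def by blast
  then have sub: "\<sigma> ` I \<subseteq> X - I - {v}" by blast
  moreover have "card (\<sigma> ` I) = card (X - I - {v})"
    using card_image[OF s(1)] card v I(1) finI fin by (simp add: card_Diff_subset)
  ultimately have "\<sigma> ` I = X - I - {v}" using fin by (intro card_subset_eq) simp_all
  then show ?thesis using that s(1) e by blast
qed

lemma matching_cover:
  assumes gr: "graph_rel E" and fin: "finite I"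
    and s: "\<And>y. y \<in> I \<Longrightarrow> E y (\<sigma> y)" and sub: "Z \<subseteq> I \<union> \<sigma> ` I"
  shows "clq_cover E Z (card I)"
  unfolding clq_cover_def
proof (rule exI[of _ "(\<lambda>y. {y, \<sigma> y}) ` I"], intro conjI)
  show "card ((\<lambda>y. {y, \<sigma> y}) ` I) \<le> card I" using fin by (rule card_image_le)
  show "\<forall>C\<in>(\<lambda>y. {y, \<sigma> y}) ` I. clq E C"
    using s graph_rel_sym[OF gr] unfolding clq_def by blast
qed (use fin sub in auto)

lemma crit_matching:
  assumes "crit E X k" "card X \<le> 2 * k + 1" and v: "v \<in> X"
  obtains I \<sigma> where "I \<subseteq> X" "v \<notin> I" "indep E I" "card I = k"
    "inj_on \<sigma> I" "\<sigma> ` I = X - I - {v}" "\<And>y. y \<in> I \<Longrightarrow> E y (\<sigma> y)"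
proof -
  obtain I where I: "I \<subseteq> X" "v \<notin> I" "indep E I" "card I = k"
    by (rule crit_avoid[OF assms(1) v v disjI1[OF refl]])
  have cX: "card X = 2 * card I + 1" using crit_card[OF assms(1)] assms(2) I(4) by linarith
  have vI: "v \<in> X - I" using v I(2) by blast
  have H: "card Y < card (nbs E X Y)" if "Y \<subseteq> I" "Y \<noteq> {}" for Y
    by (rule crit_nbs[OF assms(1) order_trans[OF that(1) I(1)] indep_subset[OF I(3) that(1)] that(2)])
  show ?thesis
    by (rule hall_matching[OF critD(1,2)[OF assms(1)] I(1,3) cX vI], erule (1) H, rule that[OF I])
qed

lemma crit_cover:
  assumes "crit E X k" "card X \<le> 2 * k + 1" "v \<in> X"
  shows "clq_cover E (X - {v}) k"
proof -
  obtain I \<sigma> where I: "I \<subseteq> X" "v \<notin> I" "card I = k"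
    "\<sigma> ` I = X - I - {v}" "\<And>y. y \<in> I \<Longrightarrow> E y (\<sigma> y)"
    by (rule crit_matching[OF assms]) blast
  have "finite I" by (rule finite_subset[OF I(1) critD(2)[OF assms(1)]])
  then have "clq_cover E (X - {v}) (card I)"
    using I by (intro matching_cover[OF critD(1)[OF assms(1)], where \<sigma> = \<sigma>]) auto
  then show ?thesis using I by simp
qed

text \<open>Without \<open>v\<close>, the set \<open>R\<close> would lie in the remaining
  \<open>card I - 1\<close> matching edges and have at most one vertex in each.\<close>

lemma matched_pair_forces:
  assumes gr: "graph_rel E" and fin: "finite X" and I: "I \<subseteq> X" "v \<notin> I"
    "\<sigma> ` I = X - I - {v}" "\<And>y. y \<in> I \<Longrightarrow> E y (\<sigma> y)"
    and y: "y \<in> I" and R: "R \<subseteq> X - {y, \<sigma> y}" "indep E R" "card R = card I"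
  shows "v \<in> R"
proof (rule ccontr)
  assume "v \<notin> R"
  have finI: "finite I" by (rule finite_subset[OF I(1) fin])
  have "R \<subseteq> (I - {y}) \<union> \<sigma> ` (I - {y})"
  proof
    fix x assume x: "x \<in> R"
    then have "x \<in> X" "x \<noteq> y" "x \<noteq> \<sigma> y" "x \<noteq> v" using R(1) \<open>v \<notin> R\<close> by auto
    then have "x \<in> I \<or> x \<in> \<sigma> ` I" using I(3) by blast
    then show "x \<in> (I - {y}) \<union> \<sigma> ` (I - {y})" using \<open>x \<noteq> y\<close> \<open>x \<noteq> \<sigma> y\<close> by blast
  qed
  then have "clq_cover E R (card (I - {y}))"
    using finI I(4) by (intro matching_cover[OF gr, where \<sigma> = \<sigma>]) auto
  then have "card R \<le> card (I - {y})" using clq_cover_alpha R(2) unfolding alpha_le_def by blast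
  moreover have "card (I - {y}) < card I" using y finI by (intro psubset_card_mono) auto
  ultimately show False using R(3) by linarith
qed

text \<open>Criticality only provides sets that avoid vertices. To contain \<open>v\<close>, a set
  is made to avoid one edge of a matching of all vertices but \<open>v\<close>.\<close>

lemma crit_mem:
  assumes "crit E X k" "card X \<le> 2 * k + 1" "v \<in> X"
  obtains R where "R \<subseteq> X" "v \<in> R" "indep E R" "card R = k"
proof -
  obtain I \<sigma> where I: "I \<subseteq> X" "v \<notin> I" "card I = k"
    "\<sigma> ` I = X - I - {v}" "\<And>y. y \<in> I \<Longrightarrow> E y (\<sigma> y)"
    by (rule crit_matching[OF assms]) blast
  have "I \<noteq> {}" using I(3) crit_pos[OF assms(1)] by auto
  then obtain y where y: "y \<in> I" by blast
  have yX: "y \<in> X" "\<sigma> y \<in> X" using I(1,4) y by blast+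
  obtain R where R: "R \<subseteq> X" "y \<notin> R" "\<sigma> y \<notin> R" "indep E R" "card R = k"
    by (rule crit_avoid[OF assms(1) yX disjI2[OF I(5)[OF y]]])
  have "R \<subseteq> X - {y, \<sigma> y}" using R by blast
  moreover have "card R = card I" using R I by simp
  ultimately have "v \<in> R"
    using matched_pair_forces[OF critD(1,2)[OF assms(1)] I(1,2,4) _ y _ R(4)] I(5) by metis
  then show ?thesis by (rule that[OF R(1) _ R(4,5)])
qed

text \<open>If a vertex had three neighbours, two of its edges could be deleted, one at a time, without
  destroying criticality; by induction both smaller graphs would be 2-regular, which is absurd.\<close>

theorem crit_two_regular:
  assumes "crit E X k" "card X \<le> 2 * k + 1" "x \<in> X"
  shows "card (nbs E X {x}) = 2"
  using assms
proof (induction "card {(a, b). a \<in> X \<and> b \<in> X \<and> E a b}" arbitrary: E x rule: less_induct)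
  case less
  note C = less.prems(1) and cX = less.prems(2) and yX = less.prems(3)
  have gr: "graph_rel E" and fin: "finite X" using critD[OF C] by auto
  have cX': "card X = 2 * k + 1" using crit_card[OF C] cX by linarith
  let ?N = "nbs E X"
  define y where "y = x"
  have yX: "y \<in> X" using yX y_def by simp
  have "indep E {y}" using gr unfolding indep_def graph_rel_def by blast
  then have ge2: "1 < card (?N {y})" using crit_nbs[OF C, of "{y}"] yX by simp
  have "card (?N {y}) \<le> 2"
  proof (rule ccontr)
    assume "\<not> card (?N {y}) \<le> 2"
    then have ge3: "3 \<le> card (?N {y})" by simp
    obtain I where I: "I \<subseteq> X" "y \<in> I" "indep E I" "card I = k"
      by (rule crit_mem[OF C cX yX])
    have finI: "finite I" by (rule finite_subset[OF I(1) fin])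
    have "card (X - I) = k + 1" using I cX' finI by (simp add: card_Diff_subset)
    moreover have "card (X - I) \<le> k" if "indep E (X - I)"
      using critD(4)[OF C] that unfolding alpha_le_def by blast
    ultimately have "\<not> indep E (X - I)" by linarith
    \<comment> \<open>Every edge deleted below has its end \<open>y\<close> in \<open>I\<close>, so
      \<open>uv\<close> survives; it is the reason why the independence number stays
      \<open>k\<close>.\<close>
    then obtain u v where uv: "u \<in> X - I" "v \<in> X - I" "E u v" unfolding indep_def by blast
    define E' where "E' t a b \<longleftrightarrow> E a b \<and> {a, b} \<noteq> {y, t}" for t a b
    have gr': "graph_rel (E' t)" for t using gr unfolding graph_rel_def E'_def doubleton_eq_iff by blast
    have Hall: "card Y < card (?N Y)" if "Y \<subseteq> I" "Y \<noteq> {}" for Y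
      by (rule crit_nbs[OF C order_trans[OF that(1) I(1)] indep_subset[OF I(3) that(1)] that(2)])
    \<comment> \<open>The edge \<open>yt\<close> is essential if its deletion destroys the surplus
      of a subset of \<open>I\<close>. By \<open>essD\<close> that subset contains \<open>y\<close>,
      has surplus exactly one, and sees \<open>t\<close> only through \<open>y\<close>.\<close>
    define ess where "ess t \<longleftrightarrow> (\<exists>Y\<subseteq>I. Y \<noteq> {} \<and> card (nbs (E' t) X Y) \<le> card Y)" for t
    have essD: "\<exists>Y\<subseteq>I. y \<in> Y \<and> card (?N Y) = card Y + 1 \<and> t \<notin> ?N (Y - {y})"
      if t: "ess t" "t \<in> ?N {y}" for t
    proof -
      obtain Y where Y: "Y \<subseteq> I" "Y \<noteq> {}" "card (nbs (E' t) X Y) \<le> card Y" using t(1) unfolding ess_def by blast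
      have sub: "?N Y \<subseteq> insert t (nbs (E' t) X Y)"
      proof
        fix a assume "a \<in> ?N Y"
        then obtain b where b: "a \<in> X" "b \<in> Y" "E b a" unfolding nbs_def by blast
        have "a \<notin> I" using b Y(1) I(3) unfolding indep_def by blast
        then have "{b, a} = {y, t} \<Longrightarrow> a = t" using I(2) unfolding doubleton_eq_iff by blast
        then show "a \<in> insert t (nbs (E' t) X Y)" using b unfolding nbs_def E'_def by blast
      qed
      have fn: "finite (nbs (E' t) X Y)" by (rule finite_nbs[OF fin])
      have lt: "card Y < card (?N Y)" using Hall Y by blast
      have le: "card (?N Y) \<le> card (insert t (nbs (E' t) X Y))" using sub fn by (intro card_mono) auto
      have tn: "t \<notin> nbs (E' t) X Y"
      proof
        assume "t \<in> nbs (E' t) X Y"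
        then show False using le lt Y(3) by (simp add: insert_absorb)
      qed
      then have eq: "card (?N Y) = card Y + 1" using le lt Y(3) fn by simp
      have tX: "t \<in> X" using t(2) unfolding nbs_def by blast
      have yY: "y \<in> Y"
      proof (rule ccontr)
        assume "y \<notin> Y"
        have "?N Y = nbs (E' t) X Y"
        proof -
          have "{b, a} \<noteq> {y, t}" if "b \<in> Y" "E b a" "a \<in> X" for a b
          proof
            assume "{b, a} = {y, t}"
            then have "a = y" using that \<open>y \<notin> Y\<close> unfolding doubleton_eq_iff by blast
            then show False using that I Y(1) unfolding indep_def by blast
          qed
          then show ?thesis unfolding nbs_def E'_def by blast
        qed
        then show False using lt Y(3) by simp
      qed
      have "t \<notin> ?N (Y - {y})"
      proof
        assume "t \<in> ?N (Y - {y})"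
        then obtain b where b: "b \<in> Y" "b \<noteq> y" "E b t" unfolding nbs_def by blast
        then have "{b, t} \<noteq> {y, t}" unfolding doubleton_eq_iff by blast
        then have "t \<in> nbs (E' t) X Y" using b tX unfolding nbs_def E'_def by blast
        then show False using tn by blast
      qed
      then show ?thesis using Y(1) yY eq by blast
    qed
    \<comment> \<open>Neighbourhood size is submodular, so the intersection \<open>?W\<close> of two
      sets of surplus one has surplus at most one. It is not \<open>{y}\<close>, whose surplus is at
      least two. Removing \<open>y\<close> from it costs one element but the two neighbours
      \<open>t1\<close> and \<open>t2\<close>, hence the whole surplus.\<close>
    have two_ess: False if t: "t1 \<in> ?N {y}" "t2 \<in> ?N {y}" "t1 \<noteq> t2" "ess t1" "ess t2" for t1 t2
    proof -
      obtain Y1 where Y1: "Y1 \<subseteq> I" "y \<in> Y1" "card (?N Y1) = card Y1 + 1" "t1 \<notin> ?N (Y1 - {y})"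
        using essD t by blast
      obtain Y2 where Y2: "Y2 \<subseteq> I" "y \<in> Y2" "card (?N Y2) = card Y2 + 1" "t2 \<notin> ?N (Y2 - {y})"
        using essD t by blast
      let ?W = "Y1 \<inter> Y2"
      have finY: "finite Y1" "finite Y2"
        by (rule finite_subset[OF _ finI], fact)+
      have "card (Y1 \<union> Y2) < card (?N (Y1 \<union> Y2))" using Hall[of "Y1 \<union> Y2"] Y1 Y2 by blast
      moreover have "card (?N Y1) + card (?N Y2) = card (?N (Y1 \<union> Y2)) + card (?N Y1 \<inter> ?N Y2)"
        unfolding nbs_Un using card_Un_Int[OF finite_nbs[OF fin] finite_nbs[OF fin]] by blast
      moreover have "card (Y1 \<union> Y2) + card ?W = card Y1 + card Y2" using card_Un_Int[OF finY] by simp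
      ultimately have "card (?N Y1 \<inter> ?N Y2) \<le> card ?W + 1" using Y1(3) Y2(3) by linarith
      moreover have "card (?N ?W) \<le> card (?N Y1 \<inter> ?N Y2)"
        using finite_nbs[OF fin] unfolding nbs_def by (intro card_mono) auto
      ultimately have le: "card (?N ?W) \<le> card ?W + 1" by linarith
      show False
      proof (cases "?W = {y}")
        case True
        then show False using le ge3 by simp
      next
        case False
        then have ne: "?W - {y} \<noteq> {}" using Y1(2) Y2(2) by blast
        have "card (?W - {y}) < card (?N (?W - {y}))" by (rule Hall) (use Y1(1) ne in auto)
        moreover have "card (?W - {y}) + 1 = card ?W" using Y1(2) Y2(2) finY
          card_Suc_Diff1[of ?W y] by simp
        moreover have "?N (?W - {y}) \<subseteq> ?N ?W - {t1, t2}"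
          using Y1(4) Y2(4) unfolding nbs_def by blast
        then have "card (?N (?W - {y})) \<le> card (?N ?W - {t1, t2})"
          using finite_nbs[OF fin] by (intro card_mono) auto
        moreover have "{t1, t2} \<subseteq> ?N ?W" using t(1,2) Y1(2) Y2(2) unfolding nbs_def by blast
        then have "card (?N ?W - {t1, t2}) = card (?N ?W) - 2"
          using t(3) by (subst card_Diff_subset) auto
        ultimately show False using le by linarith
      qed
    qed
    \<comment> \<open>If \<open>yt\<close> is not essential, its deletion keeps criticality: an
      independent \<open>K\<close> misses some \<open>z\<close> outside \<open>I\<close>, because
      \<open>uv\<close> survives, and the matching that leaves out \<open>z\<close> bounds
      \<open>card K\<close> by \<open>k\<close>.\<close>
    have del: "\<And>z. z \<in> X \<Longrightarrow> card (nbs (E' t) X {z}) = 2" if t: "t \<in> ?N {y}" "\<not> ess t" for t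
    proof -
      have "alpha_le (E' t) X k"
        unfolding alpha_le_def
      proof (intro allI impI)
        fix K assume K: "K \<subseteq> X" "indep (E' t) K"
        have "E' t u v" using uv I(2) unfolding E'_def doubleton_eq_iff by blast
        then have "\<not> X - I \<subseteq> K" using K(2) uv unfolding indep_def by blast
        then obtain z where z: "z \<in> X - I" "z \<notin> K" by blast
        have I': "indep (E' t) I" using I(3) unfolding indep_def E'_def by blast
        have cX2: "card X = 2 * card I + 1" using cX' I(4) by simp
        have H: "\<And>Y. Y \<subseteq> I \<Longrightarrow> Y \<noteq> {} \<Longrightarrow> card Y < card (nbs (E' t) X Y)"
          using t(2) unfolding ess_def not_le[symmetric] by blast
        obtain \<sigma> where s: "inj_on \<sigma> I" "\<sigma> ` I = X - I - {z}" "\<And>a. a \<in> I \<Longrightarrow> E' t a (\<sigma> a)"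
          by (rule hall_matching[OF gr' fin I(1) I' cX2 z(1)], erule (1) H, rule that)
        have "clq_cover (E' t) K (card I)"
          using s K(1) z(2) by (intro matching_cover[OF gr' finI, where \<sigma> = \<sigma>]) auto
        then show "card K \<le> k" using clq_cover_alpha K(2) I(4) unfolding alpha_le_def by blast
      qed
      moreover have "has_ind (E' t) (X - {a, b}) k" if "a \<in> X" "b \<in> X" "a = b \<or> E' t a b" for a b
      proof -
        have "a = b \<or> E a b" using that(3) unfolding E'_def by blast
        then have "has_ind E (X - {a, b}) k" using critD(5)[OF C] that by blast
        then show ?thesis unfolding has_ind_def indep_def E'_def by blast
      qed
      ultimately have crit': "crit (E' t) X k" unfolding crit_def using gr' fin yX by blast
      have tX: "t \<in> X" "E y t" using t(1) unfolding nbs_def by auto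
      have "{(a, b). a \<in> X \<and> b \<in> X \<and> E' t a b} \<subset> {(a, b). a \<in> X \<and> b \<in> X \<and> E a b}"
        using tX yX unfolding E'_def by auto
      moreover have "finite {(a, b). a \<in> X \<and> b \<in> X \<and> E a b}"
        by (rule finite_subset[of _ "X \<times> X"]) (use fin in auto)
      ultimately have "card {(a, b). a \<in> X \<and> b \<in> X \<and> E' t a b} < card {(a, b). a \<in> X \<and> b \<in> X \<and> E a b}"
        by (intro psubset_card_mono)
      then show "\<And>z. z \<in> X \<Longrightarrow> card (nbs (E' t) X {z}) = 2"
        using less.hyps[OF _ crit' cX] by blast
    qed
    obtain T where T: "T \<subseteq> ?N {y}" "card T = 3" using obtain_subset_with_card_n[OF ge3] by blast
    then obtain a b c where abc: "T = {a, b, c}" "a \<noteq> b" "b \<noteq> c" "a \<noteq> c"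
      unfolding card_3_iff by blast
    \<comment> \<open>At most one of three edges at \<open>y\<close> is essential. Deleting
      \<open>yt1\<close> leaves degree two at \<open>t1\<close>, so \<open>t1\<close> has degree
      three in \<open>E\<close>; deleting \<open>yt2\<close> does not touch \<open>t1\<close>, yet
      should also leave degree two there.\<close>
    obtain t1 t2 where t: "t1 \<in> ?N {y}" "t2 \<in> ?N {y}" "t1 \<noteq> t2" "\<not> ess t1" "\<not> ess t2"
      using two_ess[of a b] two_ess[of b c] two_ess[of a c] abc T(1) by blast
    have t1: "t1 \<in> X" "E y t1" "t1 \<noteq> y" using t(1) gr unfolding nbs_def graph_rel_def by auto
    have "?N {t1} = insert y (nbs (E' t1) X {t1})"
      using t1 yX gr unfolding nbs_def E'_def graph_rel_def by (auto simp: doubleton_eq_iff)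
    moreover have "y \<notin> nbs (E' t1) X {t1}" unfolding nbs_def E'_def by (auto simp: doubleton_eq_iff)
    ultimately have "card (?N {t1}) = 3"
      using del[OF t(1,4) t1(1)] finite_nbs[OF fin, of "E' t1" "{t1}"] by simp
    moreover have "?N {t1} = nbs (E' t2) X {t1}"
      using t1(3) t(3) unfolding nbs_def E'_def by (auto simp: doubleton_eq_iff)
    ultimately show False using del[OF t(2,5) t1(1)] by simp
  qed
  then show ?case using ge2 y_def by simp
qed

lemma alpha_exists:
  assumes "finite D" obtains k where "alpha_le E D k" "has_ind E D k"
proof -
  have "alpha_le E D (card D)" unfolding alpha_le_def using card_mono[OF assms] by blast
  then have least: "alpha_le E D (LEAST k. alpha_le E D k)" by (rule LeastI)
  show ?thesis
  proof (cases "LEAST k. alpha_le E D k")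
    case 0
    have "has_ind E D 0" unfolding has_ind_def indep_def by (intro exI[of _ "{}"]) simp
    then show ?thesis using that[of 0] least 0 by simp
  next
    case (Suc k)
    have "\<not> alpha_le E D k" by (rule not_less_Least) (simp add: Suc)
    then have "has_ind E D (Suc k)" using not_alpha_le[OF assms] by blast
    then show ?thesis using that[of "Suc k"] least Suc by simp
  qed
qed

text \<open>Maximum independent sets split along a union of components. Both parts would be critical
  with \<open>i + j = k\<close>, and \<open>2 * i + 1\<close> and \<open>2 * j + 1\<close> add up to
  more than \<open>card X\<close>.\<close>

lemma crit_connected:
  assumes C: "crit E X k" and cX: "card X \<le> 2 * k + 1"
    and D: "D \<subseteq> X" "D \<noteq> {}" "\<And>x y. x \<in> D \<Longrightarrow> y \<in> X \<Longrightarrow> E x y \<Longrightarrow> y \<in> D"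
  shows "D = X"
proof (rule ccontr)
  assume "D \<noteq> X"
  define D' where "D' = X - D"
  have gr: "graph_rel E" and fin: "finite X" using critD[OF C] by auto
  have D': "D' \<noteq> {}" "D \<inter> D' = {}" "D \<union> D' = X" using \<open>D \<noteq> X\<close> D(1) D'_def by auto
  have no: "\<not> E x y" if "x \<in> D" "y \<in> D'" for x y using D(3)[OF that(1)] that(2) D'_def by blast
  have finD: "finite D" "finite D'" using D' fin by (metis finite_Un)+
  obtain i where i: "alpha_le E D i" "has_ind E D i" using alpha_exists[OF finD(1)] by blast
  obtain j where j: "alpha_le E D' j" "has_ind E D' j" using alpha_exists[OF finD(2)] by blast
  obtain I where I: "I \<subseteq> D" "indep E I" "card I = i" by (rule has_indE[OF i(2)])
  obtain J where J: "J \<subseteq> D'" "indep E J" "card J = j" by (rule has_indE[OF j(2)])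
  have "indep E (I \<union> J)" using no I(1) J(1) by (intro indep_Un[OF gr I(2) J(2)]) blast
  moreover have "I \<union> J \<subseteq> X" using I(1) J(1) D'(3) by blast
  ultimately have "card (I \<union> J) \<le> k" using critD(4)[OF C] unfolding alpha_le_def by blast
  moreover have "card (I \<union> J) = i + j" unfolding I(3)[symmetric] J(3)[symmetric]
    by (rule card_Un_disjoint[OF finite_subset[OF I(1) finD(1)] finite_subset[OF J(1) finD(2)]])
      (use I(1) J(1) D'(2) in blast)
  ultimately have ij: "i + j \<le> k" by simp
  have split: "card (R \<inter> D) \<le> i \<and> card (R \<inter> D') \<le> j \<and> card R = card (R \<inter> D) + card (R \<inter> D')"
    if "R \<subseteq> X" "indep E R" for R
  proof (intro conjI)
    show "card (R \<inter> D) \<le> i" using i(1) indep_subset[OF that(2), of "R \<inter> D"] unfolding alpha_le_def by blast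
    show "card (R \<inter> D') \<le> j" using j(1) indep_subset[OF that(2), of "R \<inter> D'"] unfolding alpha_le_def by blast
    have "card ((R \<inter> D) \<union> (R \<inter> D')) = card (R \<inter> D) + card (R \<inter> D')"
      using finD D'(2) by (intro card_Un_disjoint) auto
    moreover have "(R \<inter> D) \<union> (R \<inter> D') = R" using that(1) D'(3) by blast
    ultimately show "card R = card (R \<inter> D) + card (R \<inter> D')" by simp
  qed
  have crits: "crit E D i \<and> crit E D' j"
  proof -
    have "has_ind E (D - {x, y}) i \<and> has_ind E (D' - {x, y}) j"
      if xy: "x \<in> X" "y \<in> X" "x = y \<or> E x y" for x y
    proof -
      obtain R where R: "R \<subseteq> X" "x \<notin> R" "y \<notin> R" "indep E R" "card R = k" by (rule crit_avoid[OF C xy])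
      have "card (R \<inter> D) = i" "card (R \<inter> D') = j" using split[OF R(1,4)] R(5) ij by linarith+
      moreover have "R \<inter> D \<subseteq> D - {x, y}" "R \<inter> D' \<subseteq> D' - {x, y}" using R by blast+
      moreover have "indep E (R \<inter> D)" "indep E (R \<inter> D')" using R(4) by (auto intro: indep_subset)
      ultimately show ?thesis unfolding has_ind_def by blast
    qed
    then show ?thesis unfolding crit_def using gr finD D(2) D'(1,3) i(1) j(1) by blast
  qed
  then have "2 * i + 1 \<le> card D" "2 * j + 1 \<le> card D'" using crit_card by blast+
  moreover have "card D + card D' = card X" using card_Un_disjoint[OF finD D'(2)] D'(3) by simp
  moreover have "k \<le> i + j"
  proof -
    obtain x where "x \<in> X" using D(1,2) by blast
    then obtain R where R: "R \<subseteq> X" "indep E R" "card R = k"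
      using crit_avoid[OF C _ _ disjI1[OF refl[of x]]] by metis
    then show ?thesis using split[OF R(1,2)] by linarith
  qed
  ultimately show False using cX by linarith
qed

lemma sum_nbs_swap:
  assumes "graph_rel E" "finite A" "finite B"
  shows "(\<Sum>x\<in>A. card (nbs E B {x})) = (\<Sum>y\<in>B. card (nbs E A {y}))"
proof -
  have count: "card {y \<in> S. P y} = (\<Sum>y\<in>S. if P y then 1 else 0)" if "finite S" for S and P :: "'a \<Rightarrow> bool"
    unfolding card_eq_sum by (rule sum.inter_filter[OF that])
  have eqB: "nbs E B {x} = {y \<in> B. E x y}" and eqA: "nbs E A {x} = {y \<in> A. E y x}" for x
    using assms(1) unfolding nbs_def graph_rel_def by blast+
  have "(\<Sum>x\<in>A. card (nbs E B {x})) = (\<Sum>x\<in>A. \<Sum>y\<in>B. if E x y then 1 else 0)"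
    unfolding eqB count[OF assms(3)] ..
  also have "\<dots> = (\<Sum>y\<in>B. \<Sum>x\<in>A. if E x y then 1 else 0)" by (rule sum.swap)
  also have "\<dots> = (\<Sum>y\<in>B. card (nbs E A {y}))"
    unfolding eqA count[OF assms(2)] ..
  finally show ?thesis .
qed

definition edges :: "('a \<Rightarrow> 'a \<Rightarrow> bool) \<Rightarrow> 'a set \<Rightarrow> 'a set set" where
  "edges E X = {{x, y} | x y. x \<in> X \<and> y \<in> X \<and> E x y}"

lemma finite_edges: "finite X \<Longrightarrow> finite (edges E X)"
  by (rule finite_subset[of _ "Pow X"]) (auto simp: edges_def)

lemma handshake:
  assumes gr: "graph_rel E" and fin: "finite X"
  shows "(\<Sum>x\<in>X. card (nbs E X {x})) = 2 * card (edges E X)"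
proof -
  have "card (nbs E X {x}) = card {e \<in> edges E X. x \<in> e}" if x: "x \<in> X" for x
  proof -
    have "bij_betw (\<lambda>y. {x, y}) (nbs E X {x}) {e \<in> edges E X. x \<in> e}"
      unfolding bij_betw_def
    proof
      show "inj_on (\<lambda>y. {x, y}) (nbs E X {x})" by (auto simp: inj_on_def doubleton_eq_iff)
      show "(\<lambda>y. {x, y}) ` nbs E X {x} = {e \<in> edges E X. x \<in> e}"
        using x gr unfolding nbs_def edges_def graph_rel_def by fastforce
    qed
    then show ?thesis by (rule bij_betw_same_card)
  qed
  then have "(\<Sum>x\<in>X. card (nbs E X {x})) = (\<Sum>x\<in>X. card {e \<in> edges E X. x \<in> e})" by simp
  also have "\<dots> = 2 * card (edges E X)"
  proof (rule sum_multicount[OF fin finite_edges[OF fin]], intro ballI)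
    fix e assume "e \<in> edges E X"
    then obtain x y where e: "e = {x, y}" "x \<in> X" "y \<in> X" "E x y" unfolding edges_def by blast
    then have "{i \<in> X. i \<in> e} = {x, y}" "x \<noteq> y" using gr unfolding graph_rel_def by auto
    then show "card {i \<in> X. i \<in> e} = 2" by simp
  qed
  finally show ?thesis .
qed

lemma crit_card_edges:
  assumes "crit E X k" "card X \<le> 2 * k + 1"
  shows "card (edges E X) = card X"
proof -
  have "2 * card (edges E X) = (\<Sum>x\<in>X. card (nbs E X {x}))"
    using handshake critD[OF assms(1)] by metis
  also have "\<dots> = (\<Sum>x\<in>X. 2)" using crit_two_regular[OF assms] by (intro sum.cong refl)
  finally show ?thesis by simp
qed

text \<open>By 2-regularity the \<open>k + 1\<close> vertices outside \<open>R\<close> have degree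
  sum \<open>2 * (k + 1)\<close>, of which \<open>2 * k\<close> is used by edges to
  \<open>R\<close>. The remaining 2 allows one edge; two different edges have at least three
  ends.\<close>

lemma crit_unique_edge:
  assumes C: "crit E X k" and cX: "card X \<le> 2 * k + 1"
    and R: "R \<subseteq> X" "indep E R" "card R = k"
    and cd: "c \<in> X - R" "d \<in> X - R" "E c d" and xz: "x \<in> X - R" "z \<in> X - R" "E x z"
  shows "{x, z} = {c, d}"
proof (rule ccontr)
  assume ne: "{x, z} \<noteq> {c, d}"
  have gr: "graph_rel E" and fin: "finite X" using critD[OF C] by auto
  have cX': "card X = 2 * k + 1" using crit_card[OF C] cX by linarith
  let ?J = "X - R"
  have finR: "finite R" and finJ: "finite ?J" using finite_subset[OF R(1) fin] fin by auto
  have cJ: "card ?J = k + 1" using R cX' finR by (simp add: card_Diff_subset)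
  have reg: "card (nbs E X {v}) = 2" if "v \<in> X" for v by (rule crit_two_regular[OF C cX that])
  have "card (nbs E X {v}) = card (nbs E R {v}) + card (nbs E ?J {v})" for v
  proof -
    have "nbs E X {v} = nbs E R {v} \<union> nbs E ?J {v}" using R(1) unfolding nbs_def by blast
    then show ?thesis using finR finJ by (simp, intro card_Un_disjoint finite_nbs) (auto simp: nbs_def)
  qed
  then have "(\<Sum>v\<in>?J. card (nbs E X {v})) = (\<Sum>v\<in>?J. card (nbs E R {v})) + (\<Sum>v\<in>?J. card (nbs E ?J {v}))"
    by (simp add: sum.distrib)
  moreover have "(\<Sum>v\<in>?J. card (nbs E X {v})) = 2 * (k + 1)"
    using reg cJ by simp
  moreover have "(\<Sum>v\<in>?J. card (nbs E R {v})) = (\<Sum>v\<in>R. card (nbs E ?J {v}))"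
    by (rule sum_nbs_swap[OF gr finJ finR])
  moreover have "nbs E ?J {v} = nbs E X {v}" if "v \<in> R" for v
    using that R(2) unfolding nbs_def indep_def by blast
  then have "(\<Sum>v\<in>R. card (nbs E ?J {v})) = (\<Sum>v\<in>R. 2)"
    using reg R(1) by (intro sum.cong refl) auto
  ultimately have two: "(\<Sum>v\<in>?J. card (nbs E ?J {v})) = 2" using R(3) by simp
  have "\<not> E c c" "\<not> E x x" "E d c" "E z x" using gr cd(3) xz(3) unfolding graph_rel_def by blast+
  then have neq: "c \<noteq> d" "x \<noteq> z" using cd(3) xz(3) by auto
  let ?S = "{c, d, x, z}"
  have "3 \<le> card ?S"
  proof -
    have "\<exists>w\<in>{x, z}. w \<notin> {c, d}" using ne neq by (auto simp: doubleton_eq_iff)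
    then obtain w where w: "w \<in> {x, z}" "w \<notin> {c, d}" by blast
    have "card {c, d, w} = 3" using w(2) neq by auto
    moreover have "card {c, d, w} \<le> card ?S" using w(1) by (intro card_mono) auto
    ultimately show ?thesis by simp
  qed
  also have "card ?S = (\<Sum>v\<in>?S. 1)" by simp
  also have "\<dots> \<le> (\<Sum>v\<in>?S. card (nbs E ?J {v}))"
  proof (rule sum_mono)
    fix v assume "v \<in> ?S"
    then have "nbs E ?J {v} \<noteq> {}" using cd xz \<open>E d c\<close> \<open>E z x\<close> unfolding nbs_def by blast
    then show "1 \<le> card (nbs E ?J {v})" using finite_nbs[OF finJ, of E "{v}"]
      by (simp add: Suc_le_eq card_gt_0_iff)
  qed
  also have "\<dots> \<le> (\<Sum>v\<in>?J. card (nbs E ?J {v}))" using cd xz finJ by (intro sum_mono2) auto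
  finally show False using two by simp
qed

text \<open>In an odd cycle the maximum independent sets correspond to the edges they avoid.\<close>

lemma crit_unique_ind:
  assumes C: "crit E X k" and cX: "card X \<le> 2 * k + 1"
    and cd: "c \<in> X" "d \<in> X" "E c d"
    and R: "R \<subseteq> X - {c, d}" "indep E R" "card R = k"
    and R': "R' \<subseteq> X - {c, d}" "indep E R'" "card R' = k"
  shows "R = R'"
proof -
  \<comment> \<open>If \<open>y\<close> were in neither set, \<open>xy\<close> would be a second
    edge outside \<open>T\<close> besides \<open>cd\<close>. So the symmetric difference is closed
    under adjacency, while it misses \<open>c\<close>.\<close>
  have closed: "y \<in> T - S"
    if S: "S \<subseteq> X - {c, d}" "indep E S" "card S = k" and T: "T \<subseteq> X - {c, d}" "indep E T" "card T = k"
      and xy: "x \<in> S - T" "y \<in> X" "E x y" for S T x y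
  proof -
    have "y \<notin> S" using S(2) xy unfolding indep_def by blast
    moreover have "y \<in> T"
    proof (rule ccontr)
      assume "y \<notin> T"
      have "{x, y} = {c, d}"
        by (rule crit_unique_edge[OF C cX _ T(2,3) _ _ cd(3) _ _ xy(3)])
          (use T(1) S(1) cd xy \<open>y \<notin> T\<close> in auto)
      then show False using xy(1) S(1) by blast
    qed
    ultimately show ?thesis by blast
  qed
  define D where "D = (R - R') \<union> (R' - R)"
  have "D = {}"
  proof (rule ccontr)
    assume "D \<noteq> {}"
    then have "D = X"
    proof (intro crit_connected[OF C cX])
      show "D \<subseteq> X" using R(1) R'(1) D_def by blast
      fix x y assume "x \<in> D" "y \<in> X" "E x y"
      then show "y \<in> D" using closed[OF R R', of x y] closed[OF R' R, of x y] D_def by blast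
    qed
    then show False using cd(1) R(1) R'(1) D_def by blast
  qed
  then show ?thesis using D_def by blast
qed

text \<open>The complement of \<open>R\<close> has \<open>k + 1\<close> vertices, too many to be
  independent.\<close>

lemma crit_missed_edge:
  assumes C: "crit E X k" and cX: "card X \<le> 2 * k + 1" and R: "R \<subseteq> X" "indep E R" "card R = k"
  obtains c d where "c \<in> X" "d \<in> X" "E c d" "R \<subseteq> X - {c, d}"
proof -
  have fin: "finite X" by (rule critD(2)[OF C])
  have "card (X - R) = k + 1"
    using R crit_card[OF C] cX finite_subset[OF R(1) fin] by (simp add: card_Diff_subset)
  moreover have "card (X - R) \<le> k" if "indep E (X - R)"
    using critD(4)[OF C] that unfolding alpha_le_def by blast
  ultimately have "\<not> indep E (X - R)" by linarith
  then obtain c d where "c \<in> X - R" "d \<in> X - R" "E c d" unfolding indep_def by blast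
  then show ?thesis using that R(1) by blast
qed

section \<open>Deleting three cliques\<close>

lemma card_two_cases:
  assumes "card S = 2" "a \<in> S" "b \<in> S" "a \<noteq> b" "y \<in> S"
  shows "y = a \<or> y = b"
  using assms unfolding card_2_iff by blast

lemma crit_nbs_two:
  assumes "crit E X k" "card X \<le> 2 * k + 1" "x \<in> X" "a \<in> X" "b \<in> X" "E x a" "E x b" "a \<noteq> b"
    and "y \<in> X" "E x y"
  shows "y = a \<or> y = b"
  using card_two_cases[OF crit_two_regular[OF assms(1-3)], of a b y] assms(4-) unfolding nbs_def by blast

text \<open>For an edge \<open>ef\<close> of an odd cycle of length at least 7, the two further neighbours of \<open>e\<close> and
  \<open>f\<close> determine the edge, even up to changes on the edge itself.\<close>

lemma edge_boundary_unique:
  assumes C: "crit E Q k" and cQ: "card Q \<le> 2 * k + 1" and k: "3 \<le> k"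
    and ef: "e \<in> Q" "f \<in> Q" "E e f" and ef': "e' \<in> Q" "f' \<in> Q" "E e' f'"
    and N: "\<And>z. z \<in> Q - {e, f} \<Longrightarrow> z \<in> N \<longleftrightarrow> E z e \<or> E z f"
    and N': "\<And>z. z \<in> Q - {e', f'} \<Longrightarrow> z \<in> N \<longleftrightarrow> E z e' \<or> E z f'"
  shows "{e, f} = {e', f'}"
proof (rule ccontr)
  assume ne: "{e, f} \<noteq> {e', f'}"
  have gr: "graph_rel E" and fin: "finite Q" using critD[OF C] by auto
  note sym = graph_rel_sym[OF gr] and irr = graph_rel_irrefl[OF gr]
  define B where "B = {z \<in> Q - {e, f}. E z e \<or> E z f}"
  \<comment> \<open>\<open>B\<close> is the outer boundary of \<open>ef\<close>. Through
    \<open>N\<close> it is also that of \<open>e'f'\<close>, up to the two edges themselves, so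
    \<open>D\<close> is closed under adjacency. But \<open>D\<close> has at most 6 of the at least 7
    vertices.\<close>
  define D where "D = {e, f} \<union> {e', f'} \<union> B"
  have "D = Q"
  proof (rule crit_connected[OF C cQ])
    show "D \<subseteq> Q" using ef ef' unfolding D_def B_def by blast
    show "D \<noteq> {}" unfolding D_def by blast
    fix x y assume x: "x \<in> D" and y: "y \<in> Q" "E x y"
    show "y \<in> D"
    proof (cases "x \<in> {e, f}")
      case True
      then have "E y e \<or> E y f" using sym y(2) by blast
      then show ?thesis using y(1) unfolding D_def B_def by blast
    next
      case xe: False
      show ?thesis
      proof (cases "x \<in> {e', f'}")
        case True
        then have "E y e' \<or> E y f'" using sym y(2) by blast
        then have "y \<in> {e', f'} \<or> y \<in> N" using N'[of y] y(1) by blast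
        then have "y \<in> {e', f'} \<or> y \<in> {e, f} \<or> y \<in> B" using N[of y] y(1) unfolding B_def by blast
        then show ?thesis unfolding D_def by blast
      next
        case xe': False
        have xB: "x \<in> Q" "E x e \<or> E x f" using x xe xe' unfolding D_def B_def by blast+
        then have "x \<in> N" using N[of x] xe by blast
        then have "E x e' \<or> E x f'" using N'[of x] xe' xB(1) by blast
        then obtain u' where u': "u' \<in> {e', f'}" "E x u'" by blast
        obtain u where u: "u \<in> {e, f}" "E x u" using xB by blast
        have uQ: "u \<in> Q" "u' \<in> Q" using u u' ef ef' by blast+
        \<comment> \<open>A common end \<open>u\<close> would have three neighbours:
          \<open>x\<close> and the two different opposite ends \<open>d\<close> and
          \<open>d'\<close>.\<close>
        have "u \<noteq> u'"
        proof
          assume "u = u'"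
          obtain d where d: "{e, f} = {u, d}" "d \<in> Q" "E u d" using u(1) ef sym by blast
          obtain d' where d': "{e', f'} = {u, d'}" "d' \<in> Q" "E u d'"
            using u'(1) ef' sym \<open>u = u'\<close> by blast
          have "d \<noteq> d'" using ne d(1) d'(1) by auto
          then have "x = d \<or> x = d'"
            using crit_nbs_two[OF C cQ uQ(1) d(2) d'(2) d(3) d'(3) _ xB(1)] sym[OF u(2)] by blast
          then show False using d(1) d'(1) xe xe' by blast
        qed
        then have "y = u \<or> y = u'"
          using crit_nbs_two[OF C cQ xB(1) uQ u(2) u'(2) _ y] by blast
        then show ?thesis using u(1) u'(1) unfolding D_def by blast
      qed
    qed
  qed
  moreover have "card D \<le> 6"
  proof -
    have "card (nbs E Q {e} - {f}) = 1" "card (nbs E Q {f} - {e}) = 1"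
      using crit_two_regular[OF C cQ ef(1)] crit_two_regular[OF C cQ ef(2)] ef sym
      unfolding nbs_def by auto
    moreover have "B \<subseteq> (nbs E Q {e} - {f}) \<union> (nbs E Q {f} - {e})"
      using sym unfolding B_def nbs_def by blast
    then have "card B \<le> card ((nbs E Q {e} - {f}) \<union> (nbs E Q {f} - {e}))"
      using finite_nbs[OF fin] by (intro card_mono) auto
    ultimately have "card B \<le> 2"
      using card_Un_le[of "nbs E Q {e} - {f}" "nbs E Q {f} - {e}"] by linarith
    moreover have "card D \<le> card ({e, f} \<union> {e', f'}) + card B" unfolding D_def by (rule card_Un_le)
    moreover have "card ({e, f} \<union> {e', f'}) \<le> card {e, f} + card {e', f'}" by (rule card_Un_le)
    moreover have "card {e, f} \<le> 2" "card {e', f'} \<le> 2" by (simp_all add: card_insert_le_m1)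
    ultimately show ?thesis by linarith
  qed
  ultimately have "card Q \<le> 6" by simp
  then show False using crit_card[OF C] k by linarith
qed

text \<open>What a smallest counterexample satisfies for every \<open>r\<close>, with
  \<open>w = r + p - 2\<close>; the extensions for r = 3 and r = 4 add the deletion of
  \<open>r\<close> cliques.\<close>

locale clique_deletion =
  fixes E :: "'a \<Rightarrow> 'a \<Rightarrow> bool" and V :: "'a set" and w :: nat
  assumes gr: "graph_rel E" and fin: "finite V" and w_pos: "1 \<le> w" and al: "alpha_le E V w"
    and remove_one: "clq E C \<Longrightarrow> has_ind E (V - C) w"
begin

lemma sym: "E x y \<Longrightarrow> E y x" and irr: "\<not> E x x"
  using graph_rel_sym[OF gr] graph_rel_irrefl[OF gr] by blast+

lemma clq1: "clq E {x}"
  unfolding clq_def by blast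

lemma clq2: "E x y \<Longrightarrow> clq E {x, y}"
  using sym unfolding clq_def by blast

lemma clq3: "E x y \<Longrightarrow> E y z \<Longrightarrow> E x z \<Longrightarrow> clq E {x, y, z}"
  using sym unfolding clq_def by blast

lemma V_ne: "V \<noteq> {}"
proof
  assume "V = {}"
  then have "has_ind E {} w" using remove_one[of "{}"] unfolding clq_def by simp
  then show False using w_pos unfolding has_ind_def by simp
qed

lemma crit_V: "crit E V w"
  unfolding crit_def using gr fin V_ne al remove_one[OF clq1] remove_one[OF clq2] by (metis insert_absorb2)

lemma min_deg: "x \<in> V \<Longrightarrow> 1 < card (nbs E V {x})"
  using crit_nbs[OF crit_V, of "{x}"] irr unfolding indep_def by simp

lemma ex_edge: obtains a b where "a \<in> V" "b \<in> V" "E a b"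
proof -
  have "2 * w + 1 \<le> card V" by (rule crit_card[OF crit_V])
  moreover have "card V \<le> w" if "indep E V" using al that unfolding alpha_le_def by blast
  ultimately have "\<not> indep E V" by linarith
  then show ?thesis using that unfolding indep_def by blast
qed

text \<open>An isolated vertex of \<open>V - {a, b}\<close> would form a triangle with \<open>a\<close> and \<open>b\<close>, so single vertices
  can be avoided as soon as edges can.\<close>

lemma crit_minus_edge:
  assumes ab: "a \<in> V" "b \<in> V" "E a b"
    and edge: "\<And>x y. x \<in> V - {a, b} \<Longrightarrow> y \<in> V - {a, b} \<Longrightarrow> E x y \<Longrightarrow> has_ind E (V - {a, b} - {x, y}) w"
  shows "crit E (V - {a, b}) w"
proof -
  let ?X = "V - {a, b}"
  have "a \<noteq> b" using ab(3) irr by blast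
  have vert: "has_ind E (?X - {x}) w" if x: "x \<in> ?X" for x
  proof (cases "\<exists>y\<in>?X. E x y")
    case True
    then obtain y where "y \<in> ?X" "E x y" by blast
    then have "has_ind E (?X - {x, y}) w" using edge[OF x] by blast
    then show ?thesis by (rule has_ind_mono) blast
  next
    case False
    have "nbs E V {x} \<subseteq> {a, b}" using False unfolding nbs_def by blast
    moreover have "card {a, b} = 2" "1 < card (nbs E V {x})" using min_deg[of x] x \<open>a \<noteq> b\<close> by auto
    moreover have "card (nbs E V {x}) \<le> card {a, b}" using calculation(1) by (intro card_mono) simp_all
    ultimately have "nbs E V {x} = {a, b}" by (intro card_subset_eq) simp_all
    then have "E x a" "E x b" unfolding nbs_def by blast+
    then have "clq E {x, a, b}" using ab by (intro clq3)
    then have "has_ind E (V - {x, a, b}) w" by (rule remove_one)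
    moreover have "V - {x, a, b} = ?X - {x}" by blast
    ultimately show ?thesis by simp
  qed
  have "has_ind E (?X - {x, y}) w" if "x \<in> ?X" "y \<in> ?X" "x = y \<or> E x y" for x y
    using that edge vert by auto
  moreover have "2 * w + 1 \<le> card V" by (rule crit_card[OF crit_V])
  then have "?X \<noteq> {}"
    using card_mono[of "{a, b}" V] w_pos \<open>a \<noteq> b\<close> by auto
  ultimately show ?thesis unfolding crit_def using gr fin alpha_le_mono[OF al, of ?X] by blast
qed

end

text \<open>The case r = 3: \<open>p + 1\<close> is \<open>r + p - 2\<close>, and
  \<open>2 * p + 5\<close> is \<open>r + 2 * p + 2\<close>.\<close>

locale three_twos = clique_deletion E V "p + 1" for E :: "'a \<Rightarrow> 'a \<Rightarrow> bool" and V p +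
  assumes p: "3 \<le> p" and cV: "card V \<le> 2 * p + 5"
    and remove_three: "clq E C \<Longrightarrow> clq E D \<Longrightarrow> clq E F \<Longrightarrow> has_ind E (V - C - D - F) p"
begin

text \<open>One clique of the cover is spent as the third deletion; the other \<open>p - 1\<close>
  cannot contain an independent \<open>p\<close>-set.\<close>

lemma no_cover:
  assumes "clq E C" "clq E D" shows "\<not> clq_cover E (V - C - D) p"
proof
  obtain q where q: "p = Suc q" using p by (cases p) auto
  assume "clq_cover E (V - C - D) p"
  then obtain F where F: "clq E F" "clq_cover E (V - C - D - F) q"
    unfolding q by (rule clq_cover_remove)
  obtain I where I: "I \<subseteq> V - C - D - F" "indep E I" "card I = p"
    by (rule has_indE[OF remove_three[OF assms F(1)]])
  then have "card I \<le> q" using clq_cover_alpha[OF F(2)] unfolding alpha_le_def by blast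
  then show False using I q by simp
qed

lemma ind_bound: "I \<subseteq> V \<Longrightarrow> indep E I \<Longrightarrow> card I \<le> p + 1"
  using al unfolding alpha_le_def by blast

text \<open>The independence number has dropped from \<open>p + 1\<close> to \<open>p\<close>, so
  the third deletion makes \<open>Q\<close> critical without spare vertices: in effect an odd cycle
  of length \<open>2 * p + 1\<close>.\<close>

definition edge_pair :: "'a set \<Rightarrow> 'a \<Rightarrow> 'a \<Rightarrow> 'a \<Rightarrow> 'a \<Rightarrow> bool" where
  "edge_pair Q a b c d \<longleftrightarrow> distinct [a, b, c, d] \<and> {a, b, c, d} \<subseteq> V \<and> E a b \<and> E c d \<and>
     Q = V - {a, b, c, d} \<and> alpha_le E Q p"

lemma edge_pair_sym:
  assumes "edge_pair Q a b c d"
  shows "edge_pair Q b a c d" "edge_pair Q a b d c" "edge_pair Q c d a b"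
  using assms sym unfolding edge_pair_def by (auto simp: insert_commute)

lemma edge_pair_cross:
  assumes "edge_pair Q a b c d" "E a c" "E b d" shows "edge_pair Q a c b d"
  using assms sym unfolding edge_pair_def by (auto simp: insert_commute)

lemma edge_pairD:
  assumes "edge_pair Q a b c d"
  shows "crit E Q p" "card Q = 2 * p + 1"
proof -
  have d: "distinct [a, b, c, d]" "{a, b, c, d} \<subseteq> V" "E a b" "E c d" "Q = V - {a, b, c, d}" "alpha_le E Q p"
    using assms unfolding edge_pair_def by blast+
  have "card {a, b, c, d} = 4" using d(1) by simp
  then have cQ: "card Q = card V - 4" using d(2,5) fin by (simp add: card_Diff_subset)
  have lV: "2 * (p + 1) + 1 \<le> card V" by (rule crit_card[OF crit_V])
  then have "Q \<noteq> {}" using cQ p by auto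
  have "has_ind E (Q - {x, y}) p" if "x = y \<or> E x y" for x y
  proof -
    have "clq E {x, y}" using that clq1 clq2 by auto
    then have "has_ind E (V - {a, b} - {c, d} - {x, y}) p"
      by (intro remove_three clq2[OF d(3)] clq2[OF d(4)])
    moreover have "V - {a, b} - {c, d} - {x, y} = Q - {x, y}" using d(5) by blast
    ultimately show ?thesis by simp
  qed
  then show crit: "crit E Q p" unfolding crit_def using gr fin d(5,6) \<open>Q \<noteq> {}\<close> by blast
  show "card Q = 2 * p + 1" using crit_card[OF crit] cQ cV by linarith
qed

lemma edge_pair_reg:
  assumes "edge_pair Q a b c d" "x \<in> Q" shows "card (nbs E Q {x}) = 2"
  using crit_two_regular[OF edge_pairD(1)[OF assms(1)] _ assms(2)] edge_pairD(2)[OF assms(1)] by simp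

text \<open>If no two edges could be removed to lower the independence number, then removing any edge
  would leave a 2-regular graph, which bounds all degrees and makes the graph too dense.\<close>

lemma ex_edge_pair: "\<exists>Q a b c d. edge_pair Q a b c d"
proof (rule ccontr)
  assume no: "\<nexists>Q a b c d. edge_pair Q a b c d"
  have critX: "crit E (V - {a, b}) (p + 1)" if ab: "a \<in> V" "b \<in> V" "E a b" for a b
  proof -
    have "a \<noteq> b" using ab(3) irr by blast
    show ?thesis
    proof (rule crit_minus_edge[OF ab])
      fix x y assume xy: "x \<in> V - {a, b}" "y \<in> V - {a, b}" "E x y"
      have "x \<noteq> y" using xy(3) irr by blast
      then have "distinct [a, b, x, y]" "{a, b, x, y} \<subseteq> V" using xy ab \<open>a \<noteq> b\<close> by auto
      then have "\<not> alpha_le E (V - {a, b, x, y}) p"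
        using no xy(3) ab(3) unfolding edge_pair_def by blast
      then have "has_ind E (V - {a, b, x, y}) (Suc p)"
        using not_alpha_le[of "V - {a, b, x, y}" E p] fin by simp
      moreover have "V - {a, b, x, y} = V - {a, b} - {x, y}" by blast
      ultimately show "has_ind E (V - {a, b} - {x, y}) (p + 1)" by simp
    qed
  qed
  have sizeX: "card (V - {a, b}) = 2 * (p + 1) + 1 \<and> card V = 2 * p + 5"
    if ab: "a \<in> V" "b \<in> V" "E a b" for a b
  proof -
    have "a \<noteq> b" using ab(3) irr by blast
    define X where "X = V - {a, b}"
    have "card X = card V - 2" unfolding X_def using ab \<open>a \<noteq> b\<close> by (simp add: card_Diff_subset fin)
    moreover have "2 * (p + 1) + 1 \<le> card X" unfolding X_def by (rule crit_card[OF critX[OF ab]])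
    ultimately have "card X = 2 * (p + 1) + 1 \<and> card V = 2 * p + 5" using cV by arith
    then show ?thesis unfolding X_def .
  qed
  have reg: "card (nbs E (V - {a, b}) {x}) = 2" if "a \<in> V" "b \<in> V" "E a b" "x \<in> V - {a, b}" for a b x
    using crit_two_regular[OF critX[OF that(1-3)] _ that(4)] sizeX[OF that(1-3)] by simp
  obtain u v where uv: "u \<in> V" "v \<in> V" "E u v" by (rule ex_edge)
  have "\<not> nbs E V {u} \<subseteq> {v}" using min_deg[OF uv(1)] card_mono[of "{v}" "nbs E V {u}"] by auto
  then obtain x where x: "x \<in> V" "E u x" "x \<noteq> v" unfolding nbs_def by blast
  have xX: "x \<in> V - {u, v}" using x irr by blast
  have nX: "nbs E V {x} - {u, v} = nbs E (V - {u, v}) {x}" unfolding nbs_def by blast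
  have uN: "u \<in> nbs E V {x}" using uv x sym unfolding nbs_def by blast
  have fN: "finite (nbs E V {x})" by (rule finite_nbs[OF fin])
  have "nbs E (V - {u, v}) {x} \<union> {u} \<subseteq> nbs E V {x}" using uN unfolding nbs_def by blast
  then have "card (nbs E (V - {u, v}) {x} \<union> {u}) \<le> card (nbs E V {x})" using fN by (intro card_mono)
  moreover have "card (nbs E (V - {u, v}) {x} \<union> {u}) = 3"
    using reg[OF uv xX] fin by (subst card_Un_disjoint) (auto simp: nbs_def)
  ultimately have ge3: "3 \<le> card (nbs E V {x})" by simp
  have "card (nbs E V {x}) - card {u, v} \<le> 2"
    using diff_card_le_card_Diff[of "{u, v}" "nbs E V {x}"] reg[OF uv xX] nX by simp
  moreover have "card {u, v} \<le> 2" by (simp add: card_insert_if)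
  ultimately have le4: "card (nbs E V {x}) \<le> 4" by linarith
  \<comment> \<open>An edge inside \<open>J\<close> touches neither \<open>x\<close> nor its
    neighbours, so after its deletion \<open>x\<close> would keep degree at least 3 in a 2-regular
    graph. Hence \<open>J\<close> is independent, and \<open>2 * p + 5 \<le> 5 + (p + 1)\<close> is
    impossible.\<close>
  define J where "J = V - insert x (nbs E V {x})"
  have "indep E J"
    unfolding indep_def
  proof (intro ballI notI)
    fix y z assume "y \<in> J" "z \<in> J" and Eyz: "E y z"
    then have yz: "y \<in> V - insert x (nbs E V {x})" "z \<in> V - insert x (nbs E V {x})" "E y z"
      unfolding J_def by blast+
    have "nbs E (V - {y, z}) {x} = nbs E V {x}" using yz unfolding nbs_def by blast
    moreover have "card (nbs E (V - {y, z}) {x}) = 2" using yz x by (intro reg) auto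
    ultimately show False using ge3 by simp
  qed
  then have "card J \<le> p + 1" by (intro ind_bound) (auto simp: J_def)
  moreover have "card V - card (insert x (nbs E V {x})) \<le> card J"
    unfolding J_def using fN by (intro diff_card_le_card_Diff) simp
  moreover have "card (insert x (nbs E V {x})) \<le> 5" using le4 fN by (simp add: card_insert_if)
  ultimately show False using sizeX[OF uv] p by linarith
qed

section \<open>Extending maximum independent sets of the cycle by the four outer vertices\<close>

definition avoids :: "'a \<Rightarrow> 'a set \<Rightarrow> bool" where
  "avoids x R \<longleftrightarrow> (\<forall>y\<in>R. \<not> E x y)"

definition max_ind :: "'a set \<Rightarrow> 'a set \<Rightarrow> bool" where
  "max_ind Q R \<longleftrightarrow> R \<subseteq> Q \<and> indep E R \<and> card R = p"

definition free :: "'a set \<Rightarrow> 'a \<Rightarrow> bool" where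
  "free Q x \<longleftrightarrow> (\<exists>R. max_ind Q R \<and> avoids x R)"

lemma edge_pair_outside:
  assumes "edge_pair Q a b c d"
  shows "Q \<subseteq> V" "V - Q = {a, b, c, d}" "finite Q"
  using assms fin unfolding edge_pair_def by auto

lemma edge_pair_cover:
  assumes "edge_pair Q a b c d" "q \<in> Q" shows "clq_cover E (Q - {q}) p"
  using crit_cover[OF edge_pairD(1)[OF assms(1)] _ assms(2)] edge_pairD(2)[OF assms(1)] by simp

lemma max_ind_finite: "max_ind Q R \<Longrightarrow> finite R"
  using p unfolding max_ind_def by (metis card.infinite not_numeral_le_zero)

text \<open>Otherwise \<open>R\<close> together with \<open>x\<close> and \<open>y\<close> is an
  independent set of size \<open>p + 2\<close>.\<close>

lemma outside_adj:
  assumes Q: "Q \<subseteq> V" and R: "max_ind Q R"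
    and xy: "x \<in> V - Q" "y \<in> V - Q" "x \<noteq> y" "avoids x R" "avoids y R"
  shows "E x y"
proof (rule ccontr)
  assume no: "\<not> E x y"
  have R': "R \<subseteq> Q" "indep E R" "card R = p" using R unfolding max_ind_def by auto
  have "indep E (insert y R)"
    by (rule indep_insert[OF gr R'(2)]) (use xy(5) in \<open>auto simp: avoids_def\<close>)
  then have "indep E (insert x (insert y R))"
    by (rule indep_insert[OF gr]) (use xy(4) no in \<open>auto simp: avoids_def\<close>)
  moreover have "insert x (insert y R) \<subseteq> V" using R'(1) Q xy(1,2) by blast
  ultimately have "card (insert x (insert y R)) \<le> p + 1" by (rule ind_bound[rotated])
  moreover have "x \<notin> insert y R" "y \<notin> R" using xy(1-3) R'(1) by auto
  then have "card (insert x (insert y R)) = p + 2" using max_ind_finite[OF R] R'(3) by simp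
  ultimately show False by simp
qed

lemma ex_max_ind:
  assumes "edge_pair Q a b c d" obtains R where "max_ind Q R"
proof -
  obtain q where q: "q \<in> Q" using critD(3)[OF edge_pairD(1)[OF assms]] by blast
  obtain I where "I \<subseteq> Q" "indep E I" "card I = p"
    by (rule crit_avoid[OF edge_pairD(1)[OF assms] q q disjI1[OF refl]])
  then show ?thesis using that unfolding max_ind_def by blast
qed

text \<open>\<open>S\<close> has no independent set of size \<open>p + 1\<close>, so
  \<open>I\<close> uses an end of the edge, and it cannot use both.\<close>

lemma ind_plus_edge:
  assumes al: "alpha_le E S p" and "E x y" and I: "I \<subseteq> S \<union> {x, y}" "indep E I" "card I = p + 1"
  shows "\<exists>z\<in>{x, y}. \<exists>R\<subseteq>S. indep E R \<and> card R = p \<and> avoids z R \<and> R \<subseteq> I"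
proof -
  have fI: "finite I" using I(3) by (intro card_ge_0_finite) simp
  have "card I \<le> p" if "I \<subseteq> S" using al I(2) that unfolding alpha_le_def by blast
  then have "\<not> I \<subseteq> S" using I(3) by auto
  then obtain z where z: "z \<in> I" "z \<in> {x, y}" using I(1) by blast
  have "I - {z} \<subseteq> S" using I(1,2) z assms(2) sym unfolding indep_def by blast
  moreover have "indep E (I - {z})" using I(2) by (rule indep_subset) blast
  moreover have "card (I - {z}) = p" using z(1) I(3) fI by simp
  moreover have "avoids z (I - {z})" using I(2) z(1) unfolding avoids_def indep_def by blast
  ultimately show ?thesis using z(2) by blast
qed

lemma free_one:
  assumes D: "edge_pair Q a b c d" shows "free Q a \<or> free Q b"
proof -
  have d: "E a b" "E c d" "Q = V - {a, b, c, d}" "alpha_le E Q p" using D unfolding edge_pair_def by blast+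
  obtain I where I: "I \<subseteq> V - {c, d}" "indep E I" "card I = p + 1"
    by (rule has_indE[OF remove_one[OF clq2[OF d(2)]]])
  have "I \<subseteq> Q \<union> {a, b}" using I(1) d(3) by blast
  from ind_plus_edge[OF d(4,1) this I(2,3)] show ?thesis
    unfolding free_def max_ind_def by blast
qed

text \<open>No maximum independent set of \<open>Q\<close> extends by \<open>b\<close>, so
  \<open>q\<close> can be exchanged with \<open>b\<close>, and \<open>uq\<close>, \<open>cd\<close>
  is again an edge pair. The old and the new cycle are both 2-regular, so \<open>b\<close> and
  \<open>q\<close> have the same neighbours in the rest of \<open>Q\<close>. Also \<open>b\<close>
  is adjacent to \<open>q\<close>, since otherwise a maximum independent set through
  \<open>q\<close> would extend by \<open>b\<close>. The vertices \<open>u\<close> and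
  \<open>b\<close> may be non-adjacent, as happens in \<open>free_aux\<close>.\<close>

lemma blocked_swap:
  assumes cr: "crit E Q p" and cQ: "card Q = 2 * p + 1"
    and d: "distinct [u, b, c, d]" "{u, b, c, d} \<subseteq> V" "Q = V - {u, b, c, d}" "E c d"
    and q: "q \<in> Q" "E u q" and nf: "\<not> free Q b" and z: "z \<in> Q"
  shows "E b z \<longleftrightarrow> z = q \<or> E q z"
proof -
  have alQ: "alpha_le E Q p" and finQ: "finite Q" using critD[OF cr] by auto
  define Q' where "Q' = insert b (Q - {q})"
  have "alpha_le E Q' p"
    unfolding alpha_le_def
  proof (intro allI impI, rule ccontr)
    fix I assume I: "I \<subseteq> Q'" "indep E I" "\<not> card I \<le> p"
    then have "p + 1 \<le> card I" by simp
    then obtain J where J: "J \<subseteq> I" "card J = p + 1" by (rule obtain_subset_with_card_n)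
    have iJ: "indep E J" using I(2) J(1) by (rule indep_subset)
    have fJ: "finite J" using J(2) by (intro card_ge_0_finite) simp
    have "card J \<le> p" if "J \<subseteq> Q" using alQ iJ that unfolding alpha_le_def by blast
    then have "\<not> J \<subseteq> Q" using J(2) by auto
    then have bJ: "b \<in> J" using J(1) I(1) unfolding Q'_def by blast
    have "J - {b} \<subseteq> Q" using J(1) I(1) unfolding Q'_def by blast
    moreover have "indep E (J - {b})" using iJ by (rule indep_subset) blast
    moreover have "card (J - {b}) = p" using bJ J(2) fJ by simp
    moreover have "avoids b (J - {b})" using iJ bJ unfolding avoids_def indep_def by blast
    ultimately show False using nf unfolding free_def max_ind_def by blast
  qed
  moreover have "Q' = V - {u, q, c, d}" using d(1-3) q(1) unfolding Q'_def by auto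
  moreover have "distinct [u, q, c, d]" "{u, q, c, d} \<subseteq> V" using d(1-3) q(1) by auto
  ultimately have dec': "edge_pair Q' u q c d" unfolding edge_pair_def using q(2) d(4) by blast
  have reg: "card (nbs E Q {v}) = 2" if "v \<in> Q" for v
    using crit_two_regular[OF cr _ that] cQ by simp
  have fn: "finite (nbs E Q {v})" for v by (rule finite_nbs[OF finQ])
  have bQ: "b \<notin> Q" using d(3) by blast
  have off: "E b v \<longleftrightarrow> E q v" if v: "v \<in> Q" "v \<noteq> q" for v
  proof -
    have "v \<in> Q'" using v unfolding Q'_def by blast
    then have "card (nbs E Q' {v}) = 2" by (rule edge_pair_reg[OF dec'])
    moreover have "nbs E Q' {v} = (nbs E Q {v} - {q}) \<union> (if E b v then {b} else {})"
      using sym unfolding Q'_def nbs_def by auto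
    moreover have "b \<notin> nbs E Q {v}" using bQ unfolding nbs_def by blast
    ultimately have "card (nbs E Q {v} - {q}) + (if E b v then 1 else 0) = 2"
      using fn[of v] by (auto split: if_splits)
    moreover have "card (nbs E Q {v} - {q}) + (if E q v then 1 else 0) = 2"
    proof -
      have "q \<in> nbs E Q {v} \<longleftrightarrow> E q v" using q(1) sym unfolding nbs_def by blast
      then show ?thesis using reg[OF v(1)] fn[of v] by (simp add: card_Diff_singleton_if)
    qed
    ultimately have "(if E b v then 1 else 0 :: nat) = (if E q v then 1 else 0)"
      by (metis add_left_cancel)
    then show ?thesis by (cases "E b v"; cases "E q v") simp_all
  qed
  have "E b q"
  proof (rule ccontr)
    assume nbq: "\<not> E b q"
    obtain R where R: "R \<subseteq> Q" "q \<in> R" "indep E R" "card R = p"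
      by (rule crit_mem[OF cr eq_refl[OF cQ] q(1)])
    have "avoids b R"
      unfolding avoids_def
    proof
      fix y assume y: "y \<in> R"
      have "\<not> E q y" using R(2,3) y unfolding indep_def by blast
      then show "\<not> E b y" using off[of y] nbq y R(1) by blast
    qed
    then show False using nf R unfolding free_def max_ind_def by blast
  qed
  then show ?thesis using off[OF z] irr by blast
qed

text \<open>By the exchange, \<open>a\<close>, \<open>b\<close>, \<open>q\<close> would form a
  triangle. Deleting it and \<open>cd\<close> leaves \<open>Q - {q}\<close>, which \<open>p\<close>
  edges cover.\<close>

lemma blocked_no_nbs:
  assumes D: "edge_pair Q a b c d" and nf: "\<not> free Q b" and q: "q \<in> Q" shows "\<not> E a q"
proof
  assume aq: "E a q"
  have d: "distinct [a, b, c, d]" "{a, b, c, d} \<subseteq> V" "E a b" "E c d" "Q = V - {a, b, c, d}"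
    using D unfolding edge_pair_def by blast+
  have "E b q" using blocked_swap[OF edge_pairD[OF D] d(1,2,5,4) q aq nf q] by simp
  then have "clq E {a, b, q}" using d(3) aq by (intro clq3)
  moreover have "V - {a, b, q} - {c, d} = Q - {q}" using d(5) by blast
  ultimately show False using no_cover[OF _ clq2[OF d(4)]] edge_pair_cover[OF D q] by metis
qed

text \<open>Deleting the triangle \<open>acd\<close> and an edge \<open>bq\<close> would leave
  \<open>Q - {q}\<close>, which \<open>p\<close> edges cover.\<close>

lemma triangle_no_nbs:
  assumes D: "edge_pair Q a b c d" and "E a c" "E a d" and q: "q \<in> Q" shows "\<not> E b q"
proof
  assume bq: "E b q"
  have d: "E c d" "Q = V - {a, b, c, d}" using D unfolding edge_pair_def by blast+
  have "clq E {a, c, d}" using assms(2,3) d(1) by (intro clq3)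
  moreover have "V - {a, c, d} - {b, q} = Q - {q}" using d(2) by blast
  ultimately show False using no_cover[OF _ clq2[OF bq]] edge_pair_cover[OF D q] by metis
qed

lemma no_nbs_avoids: "max_ind Q R \<Longrightarrow> (\<And>q. q \<in> Q \<Longrightarrow> \<not> E x q) \<Longrightarrow> avoids x R"
  unfolding max_ind_def avoids_def by blast

text \<open>If \<open>b\<close> is blocked, \<open>a\<close> has no neighbours in \<open>Q\<close>.
  As \<open>a\<close> is not adjacent to \<open>d\<close>, the vertex \<open>d\<close> is blocked
  too, so \<open>c\<close> has no neighbours in \<open>Q\<close> either, and \<open>a\<close>,
  \<open>c\<close> must be adjacent. If \<open>bd\<close> is an edge, the pair \<open>bd\<close>,
  \<open>ac\<close> has two blocked ends on one edge, against \<open>free_one\<close>.\<close>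

lemma free_aux:
  assumes D: "edge_pair Q a b c d" and nf: "\<not> free Q b" and ad: "\<not> E a d"
  shows False
proof -
  have d: "distinct [a, b, c, d]" "{a, b, c, d} \<subseteq> V" "E a b" "E c d" "Q = V - {a, b, c, d}"
    using D unfolding edge_pair_def by blast+
  note sub = edge_pair_outside(1)[OF D]
  have out: "a \<in> V - Q" "b \<in> V - Q" "c \<in> V - Q" "d \<in> V - Q" using edge_pair_outside(2)[OF D] by blast+
  have neq: "a \<noteq> d" "a \<noteq> c" using d(1) by auto
  have an: "\<not> E a q" if "q \<in> Q" for q by (rule blocked_no_nbs[OF D nf that])
  have nfd: "\<not> free Q d"
    using outside_adj[OF sub _ out(1,4) neq(1)] no_nbs_avoids[OF _ an] ad unfolding free_def by blast
  have cn: "\<not> E c q" if "q \<in> Q" for q by (rule blocked_no_nbs[OF edge_pair_sym(3)[OF D] nfd that])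
  obtain R where R: "max_ind Q R" by (rule ex_max_ind[OF D])
  have ac: "E a c"
    by (rule outside_adj[OF sub R out(1,3) neq(2) no_nbs_avoids[OF R an] no_nbs_avoids[OF R cn]])
  show False
  proof (cases "E b d")
    case True
    have "edge_pair Q b d a c" by (rule edge_pair_sym(3)[OF edge_pair_cross[OF D ac True]])
    then show False using free_one nf nfd by blast
  next
    case False
    have db: "distinct [b, d, a, c]" "{b, d, a, c} \<subseteq> V" "Q = V - {b, d, a, c}"
      and dd: "distinct [d, b, a, c]" "{d, b, a, c} \<subseteq> V" "Q = V - {d, b, a, c}"
      using d by auto
    \<comment> \<open>Without the edge \<open>bd\<close> the exchange applies to \<open>b\<close>
      and \<open>d\<close> in both directions: if \<open>b\<close> is adjacent to \<open>q\<close>,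
      then the neighbours of \<open>d\<close> in \<open>Q\<close> are \<open>q\<close> and its
      neighbours, and conversely. So \<open>W\<close> is the closed neighbourhood of each of its
      elements, hence all of \<open>Q\<close>, yet it has at most three vertices.\<close>
    have bd: "E d z \<longleftrightarrow> z = q \<or> E q z" if "q \<in> Q" "E b q" "z \<in> Q" for q z
      by (rule blocked_swap[OF edge_pairD[OF D] db ac that(1,2) nfd that(3)])
    have dbz: "E b z \<longleftrightarrow> z = q \<or> E q z" if "q \<in> Q" "E d q" "z \<in> Q" for q z
      by (rule blocked_swap[OF edge_pairD[OF D] dd ac that(1,2) nf that(3)])
    obtain q0 where q0: "q0 \<in> Q" "E b q0"
      using nf R no_nbs_avoids[OF R, of b] unfolding free_def by blast
    define W where "W = {z \<in> Q. E d z}"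
    have Wq0: "W = insert q0 (nbs E Q {q0})" using bd[OF q0] q0(1) unfolding W_def nbs_def by blast
    have "E d q0" using bd[OF q0 q0(1)] by simp
    then have bW: "z \<in> Q \<Longrightarrow> E b z \<longleftrightarrow> z \<in> W" for z
      using dbz[OF q0(1)] unfolding Wq0 nbs_def by blast
    have "W = Q"
    proof (rule crit_connected[OF edge_pairD(1)[OF D]])
      show "card Q \<le> 2 * p + 1" using edge_pairD(2)[OF D] by simp
      show "W \<subseteq> Q" "W \<noteq> {}" using q0(1) unfolding Wq0 nbs_def by blast+
      fix x y assume x: "x \<in> W" and y: "y \<in> Q" "E x y"
      have xQ: "x \<in> Q" using x unfolding W_def by blast
      then have "E b x" using bW x by blast
      then show "y \<in> W" using bd[OF xQ _ y(1)] y unfolding W_def by blast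
    qed
    moreover have "card W \<le> 3" using edge_pair_reg[OF D q0(1)] finite_nbs[OF edge_pair_outside(3)[OF D], of E "{q0}"]
      unfolding Wq0 by (simp add: card_insert_if)
    ultimately have "card Q \<le> 3" by simp
    then show False using edge_pairD(2)[OF D] p by linarith
  qed
qed

text \<open>By \<open>free_aux\<close> a blocked \<open>b\<close> makes \<open>acd\<close> a
  triangle; then \<open>b\<close> has no neighbours in \<open>Q\<close> and extends every maximum
  independent set. By symmetry all four outer vertices are free.\<close>

lemma free_b: assumes D: "edge_pair Q a b c d" shows "free Q b"
proof (rule ccontr)
  assume nf: "\<not> free Q b"
  have ad: "E a d" using free_aux[OF D nf] by blast
  have ac: "E a c" using free_aux[OF edge_pair_sym(2)[OF D] nf] by blast
  obtain R where R: "max_ind Q R" by (rule ex_max_ind[OF D])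
  have "avoids b R" using triangle_no_nbs[OF D ac ad] by (rule no_nbs_avoids[OF R])
  then show False using nf R unfolding free_def by blast
qed

text \<open>A triangle \<open>acd\<close> leaves \<open>b\<close> without neighbours in
  \<open>Q\<close>, so \<open>b\<close> must be adjacent to the free vertices \<open>c\<close> and
  \<open>d\<close>. The four vertices then form a single clique, which leaves the second deletion
  for a vertex of \<open>Q\<close>.\<close>

lemma no_triangle: assumes D: "edge_pair Q a b c d" shows "\<not> (E a c \<and> E a d)"
proof
  assume ac: "E a c \<and> E a d"
  have d: "distinct [a, b, c, d]" "{a, b, c, d} \<subseteq> V" "E a b" "E c d" "Q = V - {a, b, c, d}"
    using D unfolding edge_pair_def by blast+
  note sub = edge_pair_outside(1)[OF D]
  have out: "b \<in> V - Q" "c \<in> V - Q" "d \<in> V - Q" using edge_pair_outside(2)[OF D] by blast+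
  have bn: "\<not> E b q" if "q \<in> Q" for q using triangle_no_nbs[OF D _ _ that] ac by blast
  have "free Q c" "free Q d" using free_b edge_pair_sym[OF D] edge_pair_sym(1)[OF edge_pair_sym(3)[OF D]] by blast+
  moreover have "E b x" if "x \<in> {c, d}" "free Q x" for x
  proof -
    obtain R where R: "max_ind Q R" "avoids x R" using \<open>free Q x\<close> unfolding free_def by blast
    show ?thesis
      by (rule outside_adj[OF sub R(1) out(1) _ _ no_nbs_avoids[OF R(1) bn] R(2)])
        (use that(1) out d(1) in auto)
  qed
  ultimately have "E b c" "E b d" by blast+
  then have "clq E {a, b, c, d}" using ac d(3,4) sym unfolding clq_def by blast
  moreover obtain q where q: "q \<in> Q" using critD(3)[OF edge_pairD(1)[OF D]] by blast
  moreover have "V - {a, b, c, d} - {q} = Q - {q}" using d(5) by blast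
  ultimately show False using no_cover[OF _ clq1[of q]] edge_pair_cover[OF D q] by metis
qed

text \<open>The edge \<open>xy\<close> is tight at the edge \<open>C\<close> of the odd cycle \<open>Q\<close> if replacing \<open>C\<close> by \<open>xy\<close> gives an odd
  cycle again.\<close>

definition tight :: "'a set \<Rightarrow> 'a \<Rightarrow> 'a \<Rightarrow> 'a set \<Rightarrow> bool" where
  "tight Q x y C \<longleftrightarrow> alpha_le E (Q - C \<union> {x, y}) p"

text \<open>Failure of tightness yields an independent set of size \<open>p + 1\<close>. It contains
  one end of \<open>cd\<close>, and the rest is a maximum independent set of \<open>Q\<close> that
  misses \<open>C\<close>.\<close>

lemma not_tight_avoids:
  assumes D: "edge_pair Q a b c d" and C: "C \<subseteq> Q" "\<not> tight Q c d C"
  shows "\<exists>x\<in>{c, d}. \<exists>R. max_ind Q R \<and> R \<subseteq> Q - C \<and> avoids x R"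
proof -
  have d: "E c d" "alpha_le E Q p" using D unfolding edge_pair_def by blast+
  have "finite (Q - C \<union> {c, d})" using edge_pair_outside(3)[OF D] by simp
  then have "has_ind E (Q - C \<union> {c, d}) (Suc p)" using C(2) not_alpha_le unfolding tight_def by blast
  then obtain I where I: "I \<subseteq> Q - C \<union> {c, d}" "indep E I" "card I = p + 1"
    using has_indE[of E _ "Suc p"] by (metis Suc_eq_plus1)
  from ind_plus_edge[OF alpha_le_mono[OF d(2)] d(1) I] show ?thesis
    unfolding max_ind_def by blast
qed

text \<open>Exchanging \<open>ef\<close> with \<open>cd\<close> gives another edge pair, whose cycle
  is again 2-regular. So a vertex \<open>z\<close> common to both cycles has as many neighbours in
  \<open>{c, d}\<close> as in \<open>{e, f}\<close>, and \<open>c\<close> has a cycle neighbour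
  besides \<open>d\<close>.\<close>

lemma tight_boundary:
  assumes D: "edge_pair Q a b c d" and ef: "e \<in> Q" "f \<in> Q" "E e f" and t: "tight Q c d {e, f}"
  shows "\<And>z. z \<in> Q - {e, f} \<Longrightarrow> E c z \<or> E d z \<longleftrightarrow> E z e \<or> E z f"
    and "\<exists>z\<in>Q. E c z"
proof -
  have d: "distinct [a, b, c, d]" "{a, b, c, d} \<subseteq> V" "E a b" "E c d" "Q = V - {a, b, c, d}"
    using D unfolding edge_pair_def by blast+
  define Q' where "Q' = Q - {e, f} \<union> {c, d}"
  have "e \<noteq> f" using ef(3) irr by blast
  then have "distinct [a, b, e, f]" "{a, b, e, f} \<subseteq> V" "Q' = V - {a, b, e, f}"
    using d ef(1,2) unfolding Q'_def by auto
  then have D': "edge_pair Q' a b e f"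
    using t d(3) ef(3) unfolding edge_pair_def tight_def Q'_def by blast
  have fQ: "finite Q" by (rule edge_pair_outside(3)[OF D])
  show "E c z \<or> E d z \<longleftrightarrow> E z e \<or> E z f" if z: "z \<in> Q - {e, f}" for z
  proof -
    have n1: "card (nbs E Q' {z}) = 2" using edge_pair_reg[OF D'] z unfolding Q'_def by blast
    have n2: "nbs E Q' {z} = (nbs E Q {z} - {e, f}) \<union> nbs E {c, d} {z}"
      unfolding Q'_def nbs_def by blast
    have n3: "card ((nbs E Q {z} - {e, f}) \<union> nbs E {c, d} {z}) =
        card (nbs E Q {z} - {e, f}) + card (nbs E {c, d} {z})"
      using fQ d(5) by (intro card_Un_disjoint finite_Diff finite_nbs) (auto simp: nbs_def)
    have n4: "card (nbs E Q {z} - {e, f}) + card (nbs E Q {z} \<inter> {e, f}) = 2"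
      using card_Int_Diff[OF finite_nbs[OF fQ], of E "{z}" "{e, f}"] edge_pair_reg[OF D, of z] z by simp
    have "card (nbs E Q {z} - {e, f}) + card (nbs E {c, d} {z}) = 2" using n1 unfolding n2 n3 .
    then have "card (nbs E {c, d} {z}) = card (nbs E Q {z} \<inter> {e, f})" using n4 by (metis add_left_cancel)
    moreover have "finite (nbs E {c, d} {z})" "finite (nbs E Q {z} \<inter> {e, f})"
      by (simp_all add: finite_nbs)
    ultimately have "nbs E {c, d} {z} = {} \<longleftrightarrow> nbs E Q {z} \<inter> {e, f} = {}" by (metis card_0_eq)
    moreover have "nbs E {c, d} {z} \<noteq> {} \<longleftrightarrow> E c z \<or> E d z" using sym unfolding nbs_def by blast
    moreover have "nbs E Q {z} \<inter> {e, f} \<noteq> {} \<longleftrightarrow> E z e \<or> E z f"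
      using ef(1,2) unfolding nbs_def by blast
    ultimately show ?thesis by blast
  qed
  have "card (nbs E Q' {c}) = 2" using edge_pair_reg[OF D', of c] unfolding Q'_def by blast
  then have "\<not> nbs E Q' {c} \<subseteq> {d}" using card_mono[of "{d}" "nbs E Q' {c}"] by auto
  then obtain z where "z \<in> Q'" "E c z" "z \<noteq> d" unfolding nbs_def by blast
  then show "\<exists>z\<in>Q. E c z" using irr unfolding Q'_def by blast
qed

text \<open>Two tight edges would share their outer boundary, given by the neighbours of
  \<open>c\<close> and \<open>d\<close>.\<close>

lemma tight_unique:
  assumes D: "edge_pair Q a b c d" and C: "C \<in> edges E Q" "tight Q c d C" "C' \<in> edges E Q" "tight Q c d C'"
  shows "C = C'"
proof -
  obtain e f where ef: "C = {e, f}" "e \<in> Q" "f \<in> Q" "E e f" using C(1) unfolding edges_def by blast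
  obtain e' f' where ef': "C' = {e', f'}" "e' \<in> Q" "f' \<in> Q" "E e' f'"
    using C(3) unfolding edges_def by blast
  have "{e, f} = {e', f'}"
  proof (rule edge_boundary_unique[OF edge_pairD(1)[OF D] _ p ef(2-4) ef'(2-4), where N = "{z. E c z \<or> E d z}"])
    show "card Q \<le> 2 * p + 1" using edge_pairD(2)[OF D] by simp
    show "z \<in> {z. E c z \<or> E d z} \<longleftrightarrow> E z e \<or> E z f" if "z \<in> Q - {e, f}" for z
      using tight_boundary(1)[OF D ef(2-4) _ that] C(2) ef(1) by simp
    show "z \<in> {z. E c z \<or> E d z} \<longleftrightarrow> E z e' \<or> E z f'" if "z \<in> Q - {e', f'}" for z
      using tight_boundary(1)[OF D ef'(2-4) _ that] C(4) ef'(1) by simp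
  qed
  then show ?thesis using ef(1) ef'(1) by simp
qed

lemma tight_card: assumes D: "edge_pair Q a b c d" shows "card {C \<in> edges E Q. tight Q c d C} \<le> 1"
proof -
  have "finite {C \<in> edges E Q. tight Q c d C}" using finite_edges[OF edge_pair_outside(3)[OF D]] by simp
  then show ?thesis unfolding One_nat_def
    by (subst card_le_Suc0_iff_eq) (use tight_unique[OF D] in blast)+
qed

lemma edge_avoid_unique:
  assumes D: "edge_pair Q a b c d" and C: "C \<in> edges E Q"
    and R: "max_ind Q R" "R \<subseteq> Q - C" and R': "max_ind Q R'" "R' \<subseteq> Q - C"
  shows "R = R'"
proof -
  obtain e f where ef: "C = {e, f}" "e \<in> Q" "f \<in> Q" "E e f" using C unfolding edges_def by blast
  show ?thesis
    using crit_unique_ind[OF edge_pairD(1)[OF D] _ ef(2-4), of R R'] edge_pairD(2)[OF D] R R' ef(1)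
    unfolding max_ind_def by simp
qed

text \<open>\<open>C\<close> determines the maximum independent set that misses it, so the witnesses
  for both pairs are the same \<open>R\<close>.\<close>

lemma not_tight_avoids_both:
  assumes D: "edge_pair Q a b c d" and C: "C \<in> edges E Q" "\<not> tight Q a b C" "\<not> tight Q c d C"
    and R: "max_ind Q R" "R \<subseteq> Q - C"
  shows "avoids a R \<or> avoids b R" "avoids c R \<or> avoids d R"
proof -
  have sub: "C \<subseteq> Q" using C(1) unfolding edges_def by blast
  show "avoids a R \<or> avoids b R"
    using not_tight_avoids[OF edge_pair_sym(3)[OF D] sub C(2)] edge_avoid_unique[OF D C(1) R] by blast
  show "avoids c R \<or> avoids d R"
    using not_tight_avoids[OF D sub C(3)] edge_avoid_unique[OF D C(1) R] by blast
qed

lemma edge_avoid: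
  assumes D: "edge_pair Q a b c d" and C: "C \<in> edges E Q"
  obtains R where "max_ind Q R" "R \<subseteq> Q - C"
proof -
  obtain e f where ef: "C = {e, f}" "e \<in> Q" "f \<in> Q" "E e f" using C unfolding edges_def by blast
  obtain I where "I \<subseteq> Q" "e \<notin> I" "f \<notin> I" "indep E I" "card I = p"
    by (rule crit_avoid[OF edge_pairD(1)[OF D] ef(2,3) disjI2[OF ef(4)]])
  then show ?thesis using that ef(1) unfolding max_ind_def by blast
qed

text \<open>\<open>ab\<close>, \<open>bd\<close>, \<open>dc\<close>, \<open>ca\<close> form a
  4-cycle, and both pairs of opposite edges are edge pairs with the same \<open>Q\<close>. Each of
  the four is tight at no more than one edge of \<open>Q\<close>, which has at least 7, so some
  \<open>C\<close> is tight for none. The vertices avoiding the corresponding \<open>R\<close> hit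
  all four sides, hence contain a diagonal \<open>ad\<close> or \<open>bc\<close>; diagonals are not
  edges, against \<open>outside_adj\<close>.\<close>

lemma two_cross_edges:
  assumes D: "edge_pair Q a b c d" and "E a c" "E b d" shows False
proof -
  have D': "edge_pair Q a c b d" by (rule edge_pair_cross[OF assms])
  let ?T = "\<lambda>x y. {C \<in> edges E Q. tight Q x y C}"
  have le1: "card (?T a b) \<le> 1" "card (?T c d) \<le> 1" "card (?T a c) \<le> 1" "card (?T b d) \<le> 1"
    using tight_card[OF D] tight_card[OF edge_pair_sym(3)[OF D]] tight_card[OF D'] tight_card[OF edge_pair_sym(3)[OF D']]
    by auto
  have fe: "finite (edges E Q)" by (rule finite_edges[OF edge_pair_outside(3)[OF D]])
  have "card (?T a b \<union> ?T c d \<union> ?T a c \<union> ?T b d) \<le> 4"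
    using le1 card_Un_le[of "?T a b \<union> ?T c d \<union> ?T a c" "?T b d"] card_Un_le[of "?T a b \<union> ?T c d" "?T a c"]
      card_Un_le[of "?T a b" "?T c d"] by linarith
  moreover have "card (edges E Q) = 2 * p + 1"
    using crit_card_edges[OF edge_pairD(1)[OF D]] edge_pairD(2)[OF D] by simp
  ultimately have "\<not> edges E Q \<subseteq> ?T a b \<union> ?T c d \<union> ?T a c \<union> ?T b d"
    using card_mono[of "?T a b \<union> ?T c d \<union> ?T a c \<union> ?T b d" "edges E Q"] fe p by auto
  then obtain C where C: "C \<in> edges E Q" "\<not> tight Q a b C" "\<not> tight Q c d C"
    "\<not> tight Q a c C" "\<not> tight Q b d C" by blast
  obtain R where R: "max_ind Q R" "R \<subseteq> Q - C" by (rule edge_avoid[OF D C(1)])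
  note av = not_tight_avoids_both[OF D C(1-3) R] not_tight_avoids_both[OF D' C(1,4,5) R]
  note sub = edge_pair_outside(1)[OF D]
  have out: "a \<in> V - Q" "b \<in> V - Q" "c \<in> V - Q" "d \<in> V - Q" using edge_pair_outside(2)[OF D] by blast+
  have neq: "a \<noteq> d" "b \<noteq> c" using D unfolding edge_pair_def by auto
  have "\<not> E a d" using no_triangle[OF D] assms(2) by blast
  then have "\<not> (avoids a R \<and> avoids d R)" using outside_adj[OF sub R(1) out(1,4) neq(1)] by blast
  moreover have "\<not> E b c" using no_triangle[OF edge_pair_sym(1)[OF D]] assms(3) by blast
  then have "\<not> (avoids b R \<and> avoids c R)" using outside_adj[OF sub R(1) out(2,3) neq(2)] by blast
  ultimately show False using av by blast
qed

text \<open>Only \<open>ac\<close> may join the two edges, so if \<open>C\<close> is tight for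
  neither, the set missing \<open>C\<close> is avoided by \<open>a\<close> and \<open>c\<close> but
  not by \<open>b\<close> (\<open>key\<close>). This forces \<open>a\<close> and \<open>c\<close> to
  have no neighbours in \<open>Q\<close>; then no edge is tight at all, and no maximum independent
  set is avoided by \<open>b\<close>, against \<open>free_b\<close>.\<close>

lemma one_cross_edge:
  assumes D: "edge_pair Q a b c d" and no: "\<not> E a d" "\<not> E b c" "\<not> E b d" shows False
proof -
  note sub = edge_pair_outside(1)[OF D]
  have out: "a \<in> V - Q" "b \<in> V - Q" "c \<in> V - Q" "d \<in> V - Q" using edge_pair_outside(2)[OF D] by blast+
  have neq: "a \<noteq> d" "b \<noteq> c" "b \<noteq> d" using D unfolding edge_pair_def by auto
  have key: "avoids a R \<and> avoids c R \<and> \<not> avoids b R"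
    if C: "C \<in> edges E Q" "\<not> tight Q a b C" "\<not> tight Q c d C" and R: "max_ind Q R" "R \<subseteq> Q - C" for C R
    using not_tight_avoids_both[OF D C R] outside_adj[OF sub R(1) out(1,4) neq(1)]
      outside_adj[OF sub R(1) out(2,3) neq(2)] outside_adj[OF sub R(1) out(2,4) neq(3)] no by blast
  have cr: "crit E Q p" and cQ: "card Q \<le> 2 * p + 1" using edge_pairD[OF D] by auto
  \<comment> \<open>A matching that leaves out \<open>q\<close> has \<open>p \<ge> 3\<close> edges,
    while at most two edges of \<open>Q\<close> are tight. For a remaining matching edge the set
    \<open>R\<close> that misses it contains \<open>q\<close>.\<close>
  have no_nbs: "\<not> E a q \<and> \<not> E c q" if q: "q \<in> Q" for q
  proof -
    obtain I \<sigma> where I: "I \<subseteq> Q" "q \<notin> I" "card I = p"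
      "inj_on \<sigma> I" "\<sigma> ` I = Q - I - {q}" "\<And>y. y \<in> I \<Longrightarrow> E y (\<sigma> y)"
      by (rule crit_matching[OF cr cQ q]) blast
    have fI: "finite I" by (rule finite_subset[OF I(1) edge_pair_outside(3)[OF D]])
    define F where "F y = {y, \<sigma> y}" for y
    have Fe: "F y \<in> edges E Q" if "y \<in> I" for y
      using I(1,5) I(6)[OF that] that unfolding F_def edges_def by blast
    have "inj_on F I"
    proof (rule inj_onI)
      fix x y assume xy: "x \<in> I" "y \<in> I" "F x = F y"
      have "\<sigma> y \<notin> I" using xy(2) I(5) by blast
      then show "x = y" using xy unfolding F_def by (auto simp: doubleton_eq_iff)
    qed
    then have cF: "card (F ` I) = p" using card_image I(3) by blast
    let ?T = "\<lambda>x y. {C \<in> edges E Q. tight Q x y C}"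
    have fT: "finite (?T a b \<union> ?T c d)" using finite_edges[OF edge_pair_outside(3)[OF D]] by simp
    have "card (?T a b \<union> ?T c d) \<le> 2"
      using tight_card[OF D] tight_card[OF edge_pair_sym(3)[OF D]] card_Un_le[of "?T a b" "?T c d"] by linarith
    then have "\<not> F ` I \<subseteq> ?T a b \<union> ?T c d" using card_mono[OF fT, of "F ` I"] cF p by linarith
    then obtain y where y: "y \<in> I" "\<not> tight Q a b (F y)" "\<not> tight Q c d (F y)" using Fe by blast
    obtain R where R: "max_ind Q R" "R \<subseteq> Q - F y" by (rule edge_avoid[OF D Fe[OF y(1)]])
    have "q \<in> R"
      by (rule matched_pair_forces[OF gr edge_pair_outside(3)[OF D] I(1,2,5,6) y(1)])
        (use R I(3) in \<open>auto simp: F_def max_ind_def\<close>)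
    then show ?thesis using key[OF Fe[OF y(1)] y(2,3) R] unfolding avoids_def by blast
  qed
  have not_tight: "\<not> tight Q a b C" "\<not> tight Q c d C" if CE: "C \<in> edges E Q" for C
  proof -
    obtain e f where ef: "C = {e, f}" "e \<in> Q" "f \<in> Q" "E e f" using CE unfolding edges_def by blast
    show "\<not> tight Q a b C" using tight_boundary(2)[OF edge_pair_sym(3)[OF D] ef(2-4)] no_nbs ef(1) by blast
    show "\<not> tight Q c d C" using tight_boundary(2)[OF D ef(2-4)] no_nbs ef(1) by blast
  qed
  obtain R where R: "max_ind Q R" "avoids b R" using free_b[OF D] unfolding free_def by blast
  obtain e f where ef: "e \<in> Q" "f \<in> Q" "E e f" "R \<subseteq> Q - {e, f}"
    by (rule crit_missed_edge[OF cr cQ, of R]) (use R(1) in \<open>auto simp: max_ind_def\<close>)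
  have "{e, f} \<in> edges E Q" using ef unfolding edges_def by blast
  then show False using key[OF _ not_tight R(1) ef(4)] R(2) by blast
qed

text \<open>By \<open>no_triangle\<close> the edges between \<open>{a, b}\<close> and
  \<open>{c, d}\<close> form a matching, and \<open>two_cross_edges\<close> excludes two of them.
  Relabelling turns the only possible one into \<open>ac\<close>.\<close>

theorem contradiction: False
proof -
  obtain Q a b c d where D: "edge_pair Q a b c d" using ex_edge_pair by blast
  note D1 = edge_pair_sym(1)[OF D] and D2 = edge_pair_sym(2)[OF D] and D3 = edge_pair_sym(3)[OF D]
  note D12 = edge_pair_sym(2)[OF D1]
  have tri: "\<not> (E a c \<and> E a d)" "\<not> (E b c \<and> E b d)" "\<not> (E c a \<and> E c b)" "\<not> (E d a \<and> E d b)"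
    using no_triangle[OF D] no_triangle[OF D1] no_triangle[OF D3] no_triangle[OF edge_pair_sym(1)[OF D3]] by blast+
  have "\<not> (E a c \<and> E b d)" "\<not> (E a d \<and> E b c)"
    using two_cross_edges[OF D] two_cross_edges[OF D2] by blast+
  then show False
    using one_cross_edge[OF D] one_cross_edge[OF D1] one_cross_edge[OF D2] one_cross_edge[OF D12] tri sym
    by blast
qed

end

section \<open>Deleting four cliques\<close>

text \<open>The case r = 4: \<open>p + 2\<close> is \<open>r + p - 2\<close>, and
  \<open>2 * p + 6\<close> is \<open>r + 2 * p + 2\<close>, one more than criticality
  demands.\<close>

locale four_twos = clique_deletion E V "p + 2" for E :: "'a \<Rightarrow> 'a \<Rightarrow> bool" and V p +
  assumes p: "3 \<le> p" and cV: "card V \<le> 2 * p + 6"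
    and remove_four: "clq E C \<Longrightarrow> clq E D \<Longrightarrow> clq E F \<Longrightarrow> clq E G \<Longrightarrow> has_ind E (V - C - D - F - G) p"
begin

text \<open>Two cliques of the cover are spent as the third and fourth deletion;
  \<open>p - 1\<close> remain.\<close>

lemma no_cover:
  assumes "clq E C" "clq E D" shows "\<not> clq_cover E (V - C - D) (p + 1)"
proof
  obtain q where q: "p = Suc q" using p by (cases p) auto
  assume "clq_cover E (V - C - D) (p + 1)"
  then have "clq_cover E (V - C - D) (Suc (Suc q))" using q by simp
  then obtain F where F: "clq E F" "clq_cover E (V - C - D - F) (Suc q)" by (rule clq_cover_remove)
  obtain G where G: "clq E G" "clq_cover E (V - C - D - F - G) q" by (rule clq_cover_remove[OF F(2)])
  obtain I where I: "I \<subseteq> V - C - D - F - G" "indep E I" "card I = p"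
    by (rule has_indE[OF remove_four[OF assms F(1) G(1)]])
  then have "card I \<le> q" using clq_cover_alpha[OF G(2)] unfolding alpha_le_def by blast
  then show False using I q by simp
qed

lemma card_V: "2 * p + 5 \<le> card V"
  using crit_card[OF crit_V] by simp

definition edge_pair :: "'a set \<Rightarrow> 'a \<Rightarrow> 'a \<Rightarrow> 'a \<Rightarrow> 'a \<Rightarrow> bool" where
  "edge_pair Y a b c d \<longleftrightarrow> distinct [a, b, c, d] \<and> {a, b, c, d} \<subseteq> V \<and> E a b \<and> E c d \<and>
     Y = V - {a, b, c, d} \<and> alpha_le E Y (p + 1)"

text \<open>With one spare vertex, deleting any edge \<open>ab\<close> leaves too few vertices for
  criticality with \<open>p + 2\<close>; so some second edge lowers the independence number.\<close>

lemma ex_edge_pair: "\<exists>Y a b c d. edge_pair Y a b c d"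
proof -
  obtain a b where ab: "a \<in> V" "b \<in> V" "E a b" by (rule ex_edge)
  have "a \<noteq> b" using ab(3) irr by blast
  define X where "X = V - {a, b}"
  have cX: "card X = card V - 2" unfolding X_def using ab \<open>a \<noteq> b\<close> by (simp add: card_Diff_subset fin)
  have "\<not> crit E X (p + 2)"
  proof
    assume "crit E X (p + 2)"
    then have "2 * (p + 2) + 1 \<le> card X" by (rule crit_card)
    then show False using cX cV by arith
  qed
  then obtain c d where cd: "c \<in> X" "d \<in> X" "E c d" "\<not> has_ind E (X - {c, d}) (p + 2)"
    using crit_minus_edge[OF ab] unfolding X_def by blast
  have "X - {c, d} = V - {a, b, c, d}" unfolding X_def by blast
  then have "\<not> has_ind E (V - {a, b, c, d}) (Suc (p + 1))" using cd(4) by simp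
  then have "alpha_le E (V - {a, b, c, d}) (p + 1)"
    using not_alpha_le[of "V - {a, b, c, d}" E "p + 1"] fin by blast
  moreover have "c \<noteq> d" using cd(3) irr by blast
  then have "distinct [a, b, c, d]" "{a, b, c, d} \<subseteq> V"
    using cd(1,2) ab \<open>a \<noteq> b\<close> unfolding X_def by auto
  ultimately show ?thesis unfolding edge_pair_def using ab(3) cd(3) by blast
qed

text \<open>\<open>Y\<close> has at most \<open>2 * p + 2\<close> vertices, too few to be critical
  with \<open>p + 1\<close>, so some vertex or edge lowers the independence number to
  \<open>p\<close>. The last two deletions make the rest critical, with at least
  \<open>2 * p + 1\<close> vertices, so no edge can do this. Hence a single vertex \<open>v\<close>
  does, and a neighbour of \<open>v\<close> in \<open>Y\<close> would give such an edge.\<close>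

lemma edge_pair_isolated:
  assumes D: "edge_pair Y a b c d"
  obtains v where "v \<in> Y" "\<And>z. z \<in> Y \<Longrightarrow> \<not> E v z" "crit E (Y - {v}) p" "card (Y - {v}) = 2 * p + 1"
proof -
  have d: "distinct [a, b, c, d]" "{a, b, c, d} \<subseteq> V" "E a b" "E c d" "Y = V - {a, b, c, d}"
    "alpha_le E Y (p + 1)"
    using D unfolding edge_pair_def by blast+
  have fY: "finite Y" using d(5) fin by simp
  have "card {a, b, c, d} = 4" using d(1) by simp
  then have cY: "card Y = card V - 4" using d(2,5) fin by (simp add: card_Diff_subset)
  then have "Y \<noteq> {}" using card_V p by auto
  have crit': "crit E (Y - {x, y}) p" if xy: "x = y \<or> E x y" "alpha_le E (Y - {x, y}) p" for x y
  proof -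
    have "clq E {x, y}" using xy(1) clq1 clq2 by auto
    have "has_ind E (Y - {x, y} - {u, w}) p" if "u = w \<or> E u w" for u w
    proof -
      have "clq E {u, w}" using that clq1 clq2 by auto
      then have "has_ind E (V - {a, b} - {c, d} - {x, y} - {u, w}) p"
        by (intro remove_four clq2[OF d(3)] clq2[OF d(4)] \<open>clq E {x, y}\<close>)
      moreover have "V - {a, b} - {c, d} - {x, y} - {u, w} = Y - {x, y} - {u, w}" using d(5) by blast
      ultimately show ?thesis by simp
    qed
    moreover from this[of a a] have "Y - {x, y} \<noteq> {}" using p unfolding has_ind_def by force
    ultimately show ?thesis unfolding crit_def using gr fY xy(2) by blast
  qed
  have edge: "\<not> alpha_le E (Y - {x, y}) p" if "x \<in> Y" "y \<in> Y" "E x y" for x y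
  proof
    assume "alpha_le E (Y - {x, y}) p"
    then have "2 * p + 1 \<le> card (Y - {x, y})" using crit' that(3) crit_card by blast
    moreover have "x \<noteq> y" using that(3) irr by blast
    then have "card (Y - {x, y}) = card Y - 2" using that fY by (simp add: card_Diff_subset)
    ultimately have "2 * p + 1 \<le> card Y - 2" by simp
    then show False using cY cV by arith
  qed
  have "\<not> crit E Y (p + 1)"
  proof
    assume "crit E Y (p + 1)"
    then have "2 * (p + 1) + 1 \<le> card Y" by (rule crit_card)
    then show False using cY cV by arith
  qed
  then obtain x y where xy: "x \<in> Y" "y \<in> Y" "x = y \<or> E x y" "\<not> has_ind E (Y - {x, y}) (p + 1)"
    unfolding crit_def using gr fY \<open>Y \<noteq> {}\<close> d(6) by blast
  then have al': "alpha_le E (Y - {x, y}) p" using not_alpha_le[of "Y - {x, y}" E p] fY by simp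
  then have "x = y" using edge xy by blast
  then have al'': "alpha_le E (Y - {x}) p" using al' by simp
  have c: "crit E (Y - {x}) p" using crit'[OF xy(3) al'] \<open>x = y\<close> by simp
  show ?thesis
  proof (rule that[OF xy(1)])
    show "crit E (Y - {x}) p" by (rule c)
    have "card (Y - {x}) = card Y - 1" using xy(1) by simp
    then show "card (Y - {x}) = 2 * p + 1" using crit_card[OF c] cY cV by arith
    show "\<not> E x z" if "z \<in> Y" for z
    proof
      assume "E x z"
      moreover have "alpha_le E (Y - {x, z}) p" by (rule alpha_le_mono[OF al'']) blast
      ultimately show False using edge[OF xy(1) that] by blast
    qed
  qed
qed

text \<open>The two edges and the isolated vertex form a pentagon.\<close>

lemma pentagon_contradiction:
  assumes D: "edge_pair Y a b c d" and v: "v \<in> Y" "\<And>z. z \<in> Y \<Longrightarrow> \<not> E v z"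
    and cr: "crit E (Y - {v}) p" and cQ: "card (Y - {v}) = 2 * p + 1"
    and va: "E v a" and vc: "E v c"
  shows False
proof -
  define Q where "Q = Y - {v}"
  have d: "distinct [a, b, c, d]" "{a, b, c, d} \<subseteq> V" "E a b" "E c d" "Y = V - {a, b, c, d}"
    using D unfolding edge_pair_def by blast+
  have crQ: "crit E Q p" and cQ: "card Q \<le> 2 * p + 1" using cr cQ unfolding Q_def by simp_all
  obtain q where q: "q \<in> Q" using critD(3)[OF crQ] by blast
  have covQ: "clq_cover E Q (p + 1)"
    using clq_cover_insert[OF crit_cover[OF crQ cQ q] clq1] by simp
  have nvb: "\<not> E v b"
  proof
    assume "E v b"
    then have "clq E {v, a, b}" using va d(3) by (intro clq3)
    moreover have "V - {v, a, b} - {c, d} = Q" using d(5) unfolding Q_def by blast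
    ultimately show False using no_cover[OF _ clq2[OF d(4)]] covQ by metis
  qed
  have nvd: "\<not> E v d"
  proof
    assume "E v d"
    then have "clq E {v, c, d}" using vc d(4) by (intro clq3)
    moreover have "V - {v, c, d} - {a, b} = Q" using d(5) unfolding Q_def by blast
    ultimately show False using no_cover[OF _ clq2[OF d(3)]] covQ by metis
  qed
  have vV: "v \<in> V" "v \<notin> {a, b, c, d}" using v(1) d(5) by blast+
  \<comment> \<open>Otherwise \<open>va\<close>, \<open>cd\<close> is an edge pair as well, with
    \<open>b\<close> in the place of \<open>v\<close>. Its isolated vertex can only be
    \<open>b\<close>, since vertices of \<open>Q\<close> have neighbours in \<open>Q\<close>. Then
    the independent set \<open>{v, b}\<close> has no neighbours besides \<open>a\<close> and
    \<open>c\<close>, against \<open>crit_nbs\<close>.\<close>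
  have bd: "E b d"
  proof (rule ccontr)
    assume nbd: "\<not> E b d"
    define Y' where "Y' = insert b Q"
    have "alpha_le E Y' (p + 1)"
      unfolding alpha_le_def
    proof (intro allI impI)
      fix I assume I: "I \<subseteq> Y'" "indep E I"
      have "card (I - {b}) \<le> p"
        using critD(4)[OF crQ] I(1) indep_subset[OF I(2), of "I - {b}"] unfolding alpha_le_def Y'_def by blast
      then show "card I \<le> p + 1" by (simp add: card_Diff_singleton_if split: if_splits)
    qed
    moreover have "Y' = V - {v, a, c, d}" using d(1,2,5) vV unfolding Y'_def Q_def by auto
    moreover have "distinct [v, a, c, d]" "{v, a, c, d} \<subseteq> V" using d(1,2) vV by auto
    ultimately have "edge_pair Y' v a c d" unfolding edge_pair_def using va d(4) by blast
    then obtain u where u: "u \<in> Y'" "\<And>z. z \<in> Y' \<Longrightarrow> \<not> E u z" by (rule edge_pair_isolated) blast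
    have "u \<notin> Q"
    proof
      assume uQ: "u \<in> Q"
      have "nbs E Q {u} = {}" using u(2) unfolding nbs_def Y'_def by blast
      moreover have "card {u} < card (nbs E Q {u})"
        using uQ irr by (intro crit_nbs[OF crQ]) (auto simp: indep_def)
      ultimately show False by simp
    qed
    then have "u = b" using u(1) unfolding Y'_def by blast
    then have bQ: "\<not> E b z" if "z \<in> Q" for z using u(2) that unfolding Y'_def by blast
    have "V \<subseteq> Q \<union> {v, a, b, c, d}" using d(5) unfolding Q_def by blast
    moreover have "\<not> E v z" if "z \<in> Q" for z using v(2) that unfolding Q_def by blast
    ultimately have "nbs E V {v, b} \<subseteq> {a, c}"
      using bQ nvb nvd nbd sym irr unfolding nbs_def by blast
    then have "card (nbs E V {v, b}) \<le> card {a, c}" by (intro card_mono) simp_all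
    also have "\<dots> = 2" using d(1) by simp
    finally have "card (nbs E V {v, b}) \<le> 2" .
    moreover have "card {v, b} < card (nbs E V {v, b})"
      using nvb sym irr vV d(2) by (intro crit_nbs[OF crit_V]) (auto simp: indep_def)
    moreover have "card {v, b} = 2" using vV by auto
    ultimately show False by simp
  qed
  \<comment> \<open>\<open>Q\<close> is covered by \<open>p + 1 = m + 4\<close> cliques. Deleting
    four of them leaves at most \<open>m\<close> independent vertices in \<open>Q\<close>, and the
    pentagon \<open>v\<close>, \<open>a\<close>, \<open>b\<close>, \<open>d\<close>,
    \<open>c\<close> adds at most two: fewer than \<open>p = m + 3\<close>.\<close>
  obtain m where m: "p = m + 3" using p by (metis add.commute le_Suc_ex)
  have "clq_cover E Q (Suc (Suc (Suc (Suc m))))" using covQ m by (simp add: numeral_3_eq_3)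
  then obtain C1 where C1: "clq E C1" "clq_cover E (Q - C1) (Suc (Suc (Suc m)))" by (rule clq_cover_remove)
  obtain C2 where C2: "clq E C2" "clq_cover E (Q - C1 - C2) (Suc (Suc m))" by (rule clq_cover_remove[OF C1(2)])
  obtain C3 where C3: "clq E C3" "clq_cover E (Q - C1 - C2 - C3) (Suc m)" by (rule clq_cover_remove[OF C2(2)])
  obtain C4 where C4: "clq E C4" "clq_cover E (Q - C1 - C2 - C3 - C4) m" by (rule clq_cover_remove[OF C3(2)])
  obtain I where I: "I \<subseteq> V - C1 - C2 - C3 - C4" "indep E I" "card I = p"
    by (rule has_indE[OF remove_four[OF C1(1) C2(1) C3(1) C4(1)]])
  have subQ: "I \<inter> Q \<subseteq> Q - C1 - C2 - C3 - C4" using I(1) by blast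
  have "indep E (I \<inter> Q)" by (rule indep_subset[OF I(2)]) blast
  then have "card (I \<inter> Q) \<le> m"
    using clq_cover_alpha[OF C4(2)] subQ unfolding alpha_le_def by blast
  moreover have "card (I - Q) \<le> 2"
  proof -
    have sub: "I - Q \<subseteq> {v, a, b, c, d}" using I(1) d(5) unfolding Q_def by blast
    show ?thesis
    proof (cases "v \<in> I")
      case True
      then have "a \<notin> I" "c \<notin> I" "\<not> (b \<in> I \<and> d \<in> I)" using va vc bd I(2) unfolding indep_def by blast+
      then obtain w where "I - Q \<subseteq> {v, w}" using sub by blast
      then have "card (I - Q) \<le> card {v, w}" by (intro card_mono) simp_all
      also have "\<dots> \<le> 2" by (simp add: card_insert_if)
      finally show ?thesis .
    next
      case False
      have "\<not> (a \<in> I \<and> b \<in> I)" "\<not> (c \<in> I \<and> d \<in> I)" using d(3,4) I(2) unfolding indep_def by blast+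
      then obtain w w' where "I - Q \<subseteq> {w, w'}" using sub False by blast
      then have "card (I - Q) \<le> card {w, w'}" by (intro card_mono) simp_all
      also have "\<dots> \<le> 2" by (simp add: card_insert_if)
      finally show ?thesis .
    qed
  qed
  moreover have "card I = card (I \<inter> Q) + card (I - Q)"
    using I(3) p by (intro card_Int_Diff card_ge_0_finite) simp
  ultimately show False using I(3) m by linarith
qed

text \<open>All neighbours of \<open>v\<close> lie in \<open>{a, b, c, d}\<close>, and there are at
  least two. A triangle on \<open>v\<close> and one of the edges would leave, after deleting the
  other edge, a set covered by \<open>p + 1\<close> cliques. So \<open>v\<close> sees exactly one
  end of each edge, up to relabelling \<open>a\<close> and \<open>c\<close>.\<close>

theorem contradiction: False
proof -
  obtain Y a b c d where D: "edge_pair Y a b c d" using ex_edge_pair by blast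
  obtain v where v: "v \<in> Y" "\<And>z. z \<in> Y \<Longrightarrow> \<not> E v z" "crit E (Y - {v}) p" "card (Y - {v}) = 2 * p + 1"
    by (rule edge_pair_isolated[OF D]) blast
  have d: "distinct [a, b, c, d]" "{a, b, c, d} \<subseteq> V" "E a b" "E c d" "Y = V - {a, b, c, d}"
    using D unfolding edge_pair_def by blast+
  have D': "edge_pair Y b a c d" "edge_pair Y a b d c" "edge_pair Y b a d c"
    using D sym unfolding edge_pair_def by (auto simp: insert_commute)
  obtain q where q: "q \<in> Y - {v}" using critD(3)[OF v(3)] by blast
  have "clq_cover E (Y - {v}) (p + 1)"
    using clq_cover_insert[OF crit_cover[OF v(3) eq_refl[OF v(4)] q] clq1] by simp
  moreover have "V - {v, a, b} - {c, d} = Y - {v}" "V - {v, c, d} - {a, b} = Y - {v}" using d(5) by blast+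
  ultimately have "\<not> clq E {v, a, b}" "\<not> clq E {v, c, d}"
    using no_cover[OF _ clq2[OF d(4)]] no_cover[OF _ clq2[OF d(3)]] by metis+
  then have tri: "\<not> (E v a \<and> E v b)" "\<not> (E v c \<and> E v d)" using clq3 d(3,4) by blast+
  have vV: "v \<in> V" using v(1) d(5) by blast
  have sub: "nbs E V {v} \<subseteq> {a, b, c, d}" using v(2) d(5) unfolding nbs_def by blast
  have "\<not> (\<exists>w. nbs E V {v} \<subseteq> {w})"
  proof
    assume "\<exists>w. nbs E V {v} \<subseteq> {w}"
    then obtain w where "nbs E V {v} \<subseteq> {w}" by blast
    then have "card (nbs E V {v}) \<le> card {w}" by (intro card_mono) simp_all
    then show False using min_deg[OF vV] by simp
  qed
  then have "(E v a \<or> E v b) \<and> (E v c \<or> E v d)" using sub tri unfolding nbs_def by blast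
  then show False
    using pentagon_contradiction[OF D v] pentagon_contradiction[OF D'(1) v]
      pentagon_contradiction[OF D'(2) v] pentagon_contradiction[OF D'(3) v] by blast
qed

end

section \<open>Arrowing in terms of the complement\<close>

text \<open>Removing \<open>r\<close> cliques of the complement \<open>E\<close> of a graph leaves an independent set of
  size \<open>p\<close>: this says that the graph arrows \<open>(2\<^sub>r, p)\<close>.\<close>

definition arr :: "('a \<Rightarrow> 'a \<Rightarrow> bool) \<Rightarrow> 'a set \<Rightarrow> nat \<Rightarrow> nat \<Rightarrow> bool" where
  "arr E V r p \<longleftrightarrow> (\<forall>C :: nat \<Rightarrow> 'a set. (\<forall>i<r. clq E (C i)) \<longrightarrow> has_ind E (V - (\<Union>i<r. C i)) p)"

text \<open>\<open>E\<close> is again the complement, so \<open>\<omega> < r + p - 1\<close> becomes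
  the bound \<open>r + p - 2\<close> on independent sets. The type of vertices is fixed only for the
  quantifier; \<open>folk_intro\<close> accepts finite graphs over any type.\<close>

definition folk :: "nat \<Rightarrow> nat \<Rightarrow> nat \<Rightarrow> bool" where
  "folk n r p \<longleftrightarrow> (\<exists>(E :: nat \<Rightarrow> nat \<Rightarrow> bool) V. graph_rel E \<and> finite V \<and> card V = n \<and>
     arr E V r p \<and> alpha_le E V (r + p - 2))"

lemma clq_subset: "clq E C \<Longrightarrow> D \<subseteq> C \<Longrightarrow> clq E D"
  unfolding clq_def by blast

lemma folk_intro:
  fixes E :: "'a \<Rightarrow> 'a \<Rightarrow> bool"
  assumes gr: "graph_rel E" and fin: "finite V" and ar: "arr E V r p" and al: "alpha_le E V (r + p - 2)"
  shows "folk (card V) r p"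
proof -
  obtain h where h: "bij_betw h {0..<card V} V" using ex_bij_betw_nat_finite[OF fin] by blast
  define W where "W = {0..<card V}"
  define F where "F x y \<longleftrightarrow> E (h x) (h y)" for x y
  have inj: "inj_on h W" and im: "h ` W = V"
    unfolding W_def using bij_betw_imp_inj_on[OF h] bij_betw_imp_surj_on[OF h] by blast+
  have "graph_rel F"
    unfolding graph_rel_def F_def
    by (intro conjI allI impI) (erule graph_rel_sym[OF gr], rule graph_rel_irrefl[OF gr])
  moreover have "arr F W r p"
    unfolding arr_def
  proof (intro allI impI)
    fix C :: "nat \<Rightarrow> nat set" assume C: "\<forall>i<r. clq F (C i)"
    define D where "D i = h ` (C i \<inter> W)" for i
    have "clq E (D i)" if "i < r" for i
      unfolding clq_def
    proof (intro ballI impI)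
      fix x y assume xy: "x \<in> D i" "y \<in> D i" "x \<noteq> y"
      then obtain a b where ab: "x = h a" "y = h b" "a \<in> C i" "b \<in> C i" unfolding D_def by blast
      have "clq F (C i)" using C \<open>i < r\<close> by blast
      moreover have "a \<noteq> b" using ab(1,2) xy(3) by auto
      ultimately have "F a b" using ab(3,4) unfolding clq_def by blast
      then show "E x y" using ab(1,2) unfolding F_def by simp
    qed
    then have "has_ind E (V - (\<Union>i<r. D i)) p" using ar unfolding arr_def by blast
    then obtain I where I: "I \<subseteq> V - (\<Union>i<r. D i)" "indep E I" "card I = p" by (rule has_indE)
    let ?J = "{x \<in> W. h x \<in> I}"
    have "h ` ?J = I" using I(1) im by auto
    moreover have "inj_on h ?J" by (rule inj_on_subset[OF inj]) blast
    ultimately have "card ?J = p" using I(3) card_image by metis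
    moreover have "?J \<subseteq> W - (\<Union>i<r. C i)" using I(1) unfolding D_def by blast
    moreover have "indep F ?J" using I(2) unfolding indep_def F_def by simp
    ultimately show "has_ind F (W - (\<Union>i<r. C i)) p" unfolding has_ind_def by blast
  qed
  moreover have "alpha_le F W (r + p - 2)"
    unfolding alpha_le_def
  proof (intro allI impI)
    fix I assume I: "I \<subseteq> W" "indep F I"
    have "indep E (h ` I)" using I(2) unfolding indep_def F_def by simp
    moreover have "h ` I \<subseteq> V" using I(1) im by blast
    ultimately have "card (h ` I) \<le> r + p - 2" using al unfolding alpha_le_def by blast
    then show "card I \<le> r + p - 2" using card_image[OF inj_on_subset[OF inj I(1)]] by simp
  qed
  moreover have "finite W" "card W = card V" unfolding W_def by simp_all
  ultimately show ?thesis unfolding folk_def by blast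
qed

lemma arr_remove:
  assumes "arr E V (Suc r) p" "clq E D" shows "arr E (V - D) r p"
  unfolding arr_def
proof (intro allI impI)
  fix C :: "nat \<Rightarrow> 'a set" assume C: "\<forall>i<r. clq E (C i)"
  define C' where "C' = C(r := D)"
  have "\<forall>i<Suc r. clq E (C' i)" using C assms(2) unfolding C'_def by (simp add: less_Suc_eq)
  then have "has_ind E (V - (\<Union>i<Suc r. C' i)) p" using assms(1) unfolding arr_def by blast
  moreover have "(\<Union>i<Suc r. C' i) = D \<union> (\<Union>i<r. C i)" unfolding C'_def by (auto simp: less_Suc_eq)
  ultimately show "has_ind E (V - D - (\<Union>i<r. C i)) p" by (simp add: Diff_eq Int_assoc)
qed

lemma arr_0: "arr E V 0 p \<longleftrightarrow> has_ind E V p"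
  unfolding arr_def by simp

text \<open>Each deletion removes one clique of the cover; the \<open>q\<close> cliques left at the
  end hold no independent set of size \<open>p\<close>.\<close>

lemma arr_no_cover:
  assumes "arr E V r p" "q < p" shows "\<not> clq_cover E V (r + q)"
  using assms(1)
proof (induction r arbitrary: V)
  case 0
  then obtain I where I: "I \<subseteq> V" "indep E I" "card I = p" unfolding arr_0 by (rule has_indE)
  show ?case
  proof
    assume "clq_cover E V (0 + q)"
    then have "clq_cover E V q" by simp
    from clq_cover_alpha[OF this] have "card I \<le> q" using I(1,2) unfolding alpha_le_def by blast
    then show False using I(3) assms(2) by simp
  qed
next
  case (Suc r)
  show ?case
  proof
    assume "clq_cover E V (Suc r + q)"
    then have "clq_cover E V (Suc (r + q))" by simp
    then obtain C where "clq E C" "clq_cover E (V - C) (r + q)" by (rule clq_cover_remove)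
    then show False using Suc.IH[OF arr_remove[OF Suc.prems]] by blast
  qed
qed

lemma arr_has_ind: "arr E V r p \<Longrightarrow> has_ind E V p"
proof (induction r arbitrary: V)
  case (Suc r)
  have "has_ind E (V - {}) p" by (rule Suc.IH[OF arr_remove[OF Suc.prems]]) (simp add: clq_def)
  then show ?case by simp
qed (simp add: arr_0)

text \<open>\<open>None\<close> is the new isolated vertex of the complement. A clique containing it
  is \<open>{None}\<close>, which leaves \<open>r\<close> cliques for the old graph. If no clique
  contains it, an independent \<open>p\<close>-set that survives the first \<open>r\<close> cliques
  loses at most one vertex to the last, and \<open>None\<close> replaces that vertex.\<close>

lemma folk_Suc:
  assumes "folk n r p" "2 \<le> r + p" shows "folk (Suc n) (Suc r) p"
proof -
  obtain E :: "nat \<Rightarrow> nat \<Rightarrow> bool" and V where E: "graph_rel E" "finite V" "card V = n" "arr E V r p"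
    "alpha_le E V (r + p - 2)"
    using assms(1) unfolding folk_def by blast
  define F where "F x y \<longleftrightarrow> (\<exists>a b. x = Some a \<and> y = Some b \<and> E a b)" for x y
  define W where "W = insert None (Some ` V)"
  have grF: "graph_rel F" unfolding graph_rel_def F_def using graph_rel_sym[OF E(1)] graph_rel_irrefl[OF E(1)] by blast
  have finW: "finite W" unfolding W_def using E(2) by simp
  have cW: "card W = Suc n" unfolding W_def using E(2,3) by (simp add: card_image)
  have ind: "indep F (Some ` I)" if "indep E I" for I
    using that unfolding indep_def F_def by blast
  have indN: "indep F (insert None J)" if "indep F J" for J
    using that unfolding indep_def F_def by blast
  have clqE: "clq E {x. Some x \<in> C}" if "clq F C" for C
    using that unfolding clq_def F_def by blast
  have "arr F W (Suc r) p"
    unfolding arr_def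
  proof (intro allI impI)
    fix C :: "nat \<Rightarrow> nat option set" assume C: "\<forall>i<Suc r. clq F (C i)"
    show "has_ind F (W - (\<Union>i<Suc r. C i)) p"
    proof (cases "\<exists>i<Suc r. None \<in> C i")
      case True
      then obtain i where i: "i < Suc r" "None \<in> C i" by blast
      have Ci: "C i = {None}" using C i unfolding clq_def F_def by blast
      \<comment> \<open>Reindexing that skips the clique \<open>{None}\<close> at position
        \<open>i\<close>.\<close>
      define D where "D j = {x. Some x \<in> C (if j < i then j else Suc j)}" for j
      have "\<forall>j<r. clq E (D j)" unfolding D_def using C i(1) by (auto intro!: clqE)
      then have "has_ind E (V - (\<Union>j<r. D j)) p" using E(4) unfolding arr_def by blast
      then obtain I where I: "I \<subseteq> V - (\<Union>j<r. D j)" "indep E I" "card I = p" by (rule has_indE)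
      have "x \<notin> I" if "k < Suc r" "Some x \<in> C k" for k x
      proof
        assume x: "x \<in> I"
        have "k \<noteq> i" using Ci that(2) by blast
        then obtain j where "j < r" "k = (if j < i then j else Suc j)"
        proof (cases "k < i")
          case True then show ?thesis using that[of k] i(1) by simp
        next
          case False
          then have "k = Suc (k - 1)" "k - 1 < r" "\<not> k - 1 < i" using \<open>k \<noteq> i\<close> \<open>k < Suc r\<close> by auto
          then show ?thesis using that[of "k - 1"] by simp
        qed
        then have "x \<in> D j" using \<open>Some x \<in> C k\<close> unfolding D_def by simp
        then show False using I(1) x \<open>j < r\<close> by blast
      qed
      then have "Some ` I \<subseteq> W - (\<Union>i<Suc r. C i)" using I(1) unfolding W_def by blast
      moreover have "card (Some ` I) = p" using I(3) by (simp add: card_image)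
      ultimately show ?thesis using ind[OF I(2)] unfolding has_ind_def by blast
    next
      case False
      define D where "D j = {x. Some x \<in> C j}" for j
      have "\<forall>j<r. clq E (D j)" unfolding D_def using C by (auto intro!: clqE)
      then have "has_ind E (V - (\<Union>j<r. D j)) p" using E(4) unfolding arr_def by blast
      then obtain I where I: "I \<subseteq> V - (\<Union>j<r. D j)" "indep E I" "card I = p" by (rule has_indE)
      have cl: "clq E (D r)" unfolding D_def using C by (auto intro!: clqE)
      have finI: "finite I" by (rule finite_subset[OF _ E(2)]) (use I(1) in blast)
      obtain w where w: "I \<inter> D r \<subseteq> {w}" using cl I(2) unfolding clq_def indep_def by blast
      have "card (I \<inter> D r) \<le> card {w}" using w by (intro card_mono) simp_all
      then have "p \<le> Suc (card (I - D r))" using card_Int_Diff[OF finI, of "D r"] I(3) by simp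
      also have "\<dots> = card (insert None (Some ` (I - D r)))" using finI by (simp add: card_image image_iff)
      finally obtain J where J: "J \<subseteq> insert None (Some ` (I - D r))" "card J = p"
        by (rule obtain_subset_with_card_n)
      have "indep F (insert None (Some ` (I - D r)))"
        by (intro indN ind indep_subset[OF I(2)]) blast
      then have "indep F J" by (rule indep_subset) (rule J(1))
      moreover have "insert None (Some ` (I - D r)) \<subseteq> W - (\<Union>i<Suc r. C i)"
      proof
        fix y assume y: "y \<in> insert None (Some ` (I - D r))"
        have "y \<notin> C i" if i: "i < Suc r" for i
        proof (cases y)
          case None then show ?thesis using False i by blast
        next
          case (Some x)
          then have x: "x \<in> I" "x \<notin> D r" using y by auto
          show ?thesis
          proof (cases "i = r")
            case True then show ?thesis using x(2) Some unfolding D_def by simp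
          next
            case False
            then have "x \<notin> D i" using i x(1) I(1) by auto
            then show ?thesis using Some unfolding D_def by simp
          qed
        qed
        moreover have "y \<in> W" using y I(1) unfolding W_def by blast
        ultimately show "y \<in> W - (\<Union>i<Suc r. C i)" by blast
      qed
      ultimately show ?thesis unfolding has_ind_def using J by (intro exI[of _ J]) (metis order_trans)
    qed
  qed
  moreover have "alpha_le F W (Suc r + p - 2)"
    unfolding alpha_le_def
  proof (intro allI impI)
    fix I assume I: "I \<subseteq> W" "indep F I"
    define J where "J = {x. Some x \<in> I}"
    have IJ: "I - {None} = Some ` J" unfolding J_def by (auto simp: image_iff) (metis option.exhaust)
    have "indep E J" using I(2) unfolding indep_def F_def J_def by blast
    moreover have "J \<subseteq> V" using I(1) unfolding J_def W_def by blast
    ultimately have "card J \<le> r + p - 2" using E(5) unfolding alpha_le_def by blast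
    moreover have "card (I - {None}) = card J" unfolding IJ by (simp add: card_image)
    moreover have "card I - card {None :: nat option} \<le> card (I - {None})"
      by (rule diff_card_le_card_Diff) simp
    then have "card I \<le> Suc (card (I - {None}))" by simp
    ultimately show "card I \<le> Suc r + p - 2" using assms(2) by simp
  qed
  ultimately show ?thesis using folk_intro[OF grF finW] cW by metis
qed

text \<open>Disjoint union of the complements, that is, the join of the graphs. For r = 2 the bound
  \<open>r + p - 2\<close> is \<open>p\<close> itself, hence additive, and every clique of the union
  restricts to a clique on each side.\<close>

lemma folk_join:
  assumes "folk n 2 p" "folk m 2 q" shows "folk (n + m) 2 (p + q)"
proof -
  obtain E :: "nat \<Rightarrow> nat \<Rightarrow> bool" and V where E: "graph_rel E" "finite V" "card V = n" "arr E V 2 p"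
    "alpha_le E V (2 + p - 2)"
    using assms(1) unfolding folk_def by blast
  obtain E' :: "nat \<Rightarrow> nat \<Rightarrow> bool" and V' where E': "graph_rel E'" "finite V'" "card V' = m" "arr E' V' 2 q"
    "alpha_le E' V' (2 + q - 2)"
    using assms(2) unfolding folk_def by blast
  define F where "F x y \<longleftrightarrow> (\<exists>a b. x = Inl a \<and> y = Inl b \<and> E a b) \<or> (\<exists>a b. x = Inr a \<and> y = Inr b \<and> E' a b)"
    for x y
  define W where "W = Inl ` V \<union> Inr ` V'"
  have grF: "graph_rel F"
    unfolding graph_rel_def F_def
    using graph_rel_sym[OF E(1)] graph_rel_irrefl[OF E(1)] graph_rel_sym[OF E'(1)] graph_rel_irrefl[OF E'(1)]
    by blast
  have finW: "finite W" unfolding W_def using E(2) E'(2) by simp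
  have card_sum: "card (Inl ` A \<union> Inr ` B :: (nat + nat) set) = card A + card B"
    if "finite A" "finite B" for A B
    using that by (subst card_Un_disjoint) (auto simp: card_image)
  have cW: "card W = n + m" unfolding W_def using E(2,3) E'(2,3) card_sum by simp
  have "arr F W 2 (p + q)"
    unfolding arr_def
  proof (intro allI impI)
    fix C :: "nat \<Rightarrow> (nat + nat) set" assume C: "\<forall>i<2. clq F (C i)"
    define D where "D i = {x. Inl x \<in> C i}" for i
    define D' where "D' i = {x. Inr x \<in> C i}" for i
    have "\<forall>i<2. clq E (D i)" "\<forall>i<2. clq E' (D' i)"
      using C unfolding clq_def F_def D_def D'_def by blast+
    then have "has_ind E (V - (\<Union>i<2. D i)) p" "has_ind E' (V' - (\<Union>i<2. D' i)) q"
      using E(4) E'(4) unfolding arr_def by blast+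
    then obtain I J where I: "I \<subseteq> V - (\<Union>i<2. D i)" "indep E I" "card I = p"
      and J: "J \<subseteq> V' - (\<Union>i<2. D' i)" "indep E' J" "card J = q"
      using has_indE by metis
    have "finite I" by (rule finite_subset[OF _ E(2)]) (use I(1) in blast)
    moreover have "finite J" by (rule finite_subset[OF _ E'(2)]) (use J(1) in blast)
    ultimately have "card (Inl ` I \<union> Inr ` J) = p + q" using card_sum I(3) J(3) by simp
    moreover have "indep F (Inl ` I \<union> Inr ` J)" using I(2) J(2) unfolding indep_def F_def by blast
    moreover have "Inl ` I \<union> Inr ` J \<subseteq> W - (\<Union>i<2. C i)"
      using I(1) J(1) unfolding W_def D_def D'_def by blast
    ultimately show "has_ind F (W - (\<Union>i<2. C i)) (p + q)" unfolding has_ind_def by blast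
  qed
  moreover have "alpha_le F W (2 + (p + q) - 2)"
    unfolding alpha_le_def
  proof (intro allI impI)
    fix K assume K: "K \<subseteq> W" "indep F K"
    define I J where "I = {x. Inl x \<in> K}" and "J = {x. Inr x \<in> K}"
    have IJ: "I \<subseteq> V" "J \<subseteq> V'" "K = Inl ` I \<union> Inr ` J" using K(1) unfolding I_def J_def W_def by blast+
    have "indep E I" "indep E' J" using K(2) unfolding I_def J_def indep_def F_def by blast+
    then have "card I \<le> p" "card J \<le> q" using E(5) E'(5) IJ(1,2) unfolding alpha_le_def by simp_all
    moreover have "card K = card I + card J"
      unfolding IJ(3) by (rule card_sum[OF finite_subset[OF IJ(1) E(2)] finite_subset[OF IJ(2) E'(2)]])
    ultimately show "card K \<le> 2 + (p + q) - 2" by simp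
  qed
  ultimately show ?thesis using folk_intro[OF grF finW] cW by metis
qed

section \<open>Triangle-free graphs on nine vertices\<close>

text \<open>Below, \<open>alpha_le E V 2\<close> says that the complement of \<open>E\<close> is
  triangle-free. There \<open>non_nbs\<close> is the neighbourhood of \<open>v\<close>, and a clique
  cover of \<open>E\<close> is a vertex colouring.\<close>

definition non_nbs :: "('a \<Rightarrow> 'a \<Rightarrow> bool) \<Rightarrow> 'a set \<Rightarrow> 'a \<Rightarrow> 'a set" where
  "non_nbs E V v = {u \<in> V. u \<noteq> v \<and> \<not> E v u}"

lemma indep3:
  assumes "graph_rel E" "\<not> E x y" "\<not> E y z" "\<not> E x z" shows "indep E {x, y, z}"
  using assms unfolding indep_def graph_rel_def by blast

lemma clq_non_nbs:
  assumes gr: "graph_rel E" and al: "alpha_le E V 2" and v: "v \<in> V"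
  shows "clq E (non_nbs E V v)"
  unfolding clq_def
proof (intro ballI impI, rule ccontr)
  fix x y assume xy: "x \<in> non_nbs E V v" "y \<in> non_nbs E V v" "x \<noteq> y" "\<not> E x y"
  have x: "x \<in> V" "x \<noteq> v" "\<not> E v x" and y: "y \<in> V" "y \<noteq> v" "\<not> E v y"
    using xy(1,2) unfolding non_nbs_def by simp_all
  have "indep E {v, x, y}" by (rule indep3[OF gr x(3) xy(4) y(3)])
  moreover have "{v, x, y} \<subseteq> V" using v x(1) y(1) by blast
  ultimately have "card {v, x, y} \<le> 2" using al unfolding alpha_le_def by blast
  then show False using x(2) y(2) xy(3) by auto
qed

lemma clq_cover_2: "clq E C \<Longrightarrow> clq E D \<Longrightarrow> X \<subseteq> C \<union> D \<Longrightarrow> clq_cover E X 2"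
  unfolding clq_cover_def by (rule exI[of _ "{C, D}"]) (auto simp: card_insert_if)

lemma clq_cover_3:
  "clq E C \<Longrightarrow> clq E D \<Longrightarrow> clq E F \<Longrightarrow> X \<subseteq> C \<union> D \<union> F \<Longrightarrow> clq_cover E X 3"
  unfolding clq_cover_def by (rule exI[of _ "{C, D, F}"]) (auto simp: card_insert_if)

lemma clq_cover_2E:
  assumes "clq_cover E X 2" obtains C D where "clq E C" "clq E D" "X \<subseteq> C \<union> D" "C \<subseteq> X" "D \<subseteq> X"
proof -
  have "clq_cover E X (Suc (Suc 0))" using assms by (simp add: numeral_2_eq_2)
  then obtain C where C: "clq E C" "clq_cover E (X - C) (Suc 0)" by (rule clq_cover_remove)
  obtain D where D: "clq E D" "clq_cover E (X - C - D) 0" by (rule clq_cover_remove[OF C(2)])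
  obtain \<C> where "finite \<C>" "card \<C> = 0" "X - C - D \<subseteq> \<Union>\<C>"
    using D(2) unfolding clq_cover_def by auto
  then have "X - C - D = {}" by simp
  then show ?thesis
    by (intro that[of "C \<inter> X" "D \<inter> X"] clq_subset[OF C(1)] clq_subset[OF D(1)]) auto
qed

lemma clq_insert:
  assumes "graph_rel E" "clq E C" "\<And>y. y \<in> C \<Longrightarrow> y \<noteq> x \<Longrightarrow> E x y" shows "clq E (insert x C)"
  using assms unfolding clq_def graph_rel_def by blast

text \<open>In the triangle-free graph: if some vertex has two neighbours, its neighbourhood is one
  colour class, and that vertex with at most one further vertex is the other. If all degrees are at
  most one, the edges form a matching.\<close>

lemma cover_four:
  assumes gr: "graph_rel E" and fin: "finite W" and al: "alpha_le E W 2" and c4: "card W \<le> 4"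
  shows "clq_cover E W 2"
proof -
  note sym = graph_rel_sym[OF gr]
  have sing: "clq E {u}" for u unfolding clq_def by blast
  have small: "\<exists>u w. S \<subseteq> {u, w}" if "finite S" "card S \<le> 2" for S :: "'a set"
  proof -
    have "card S = 0 \<or> card S = 1 \<or> card S = 2" using that(2) by arith
    then show ?thesis using that(1) by (auto simp: card_2_iff card_1_singleton_iff)
  qed
  show ?thesis
  proof (cases "\<exists>x\<in>W. 2 \<le> card (non_nbs E W x)")
    case True
    then obtain x where x: "x \<in> W" "2 \<le> card (non_nbs E W x)" by blast
    define D where "D = W - non_nbs E W x"
    have M: "clq E (non_nbs E W x)" by (rule clq_non_nbs[OF gr al x(1)])
    have sub: "non_nbs E W x \<subseteq> W" unfolding non_nbs_def by blast
    have "card D = card W - card (non_nbs E W x)"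
      unfolding D_def by (rule card_Diff_subset[OF finite_subset[OF sub fin] sub])
    then have "card D \<le> 2" using x(2) c4 by linarith
    moreover have "x \<in> D" using x(1) unfolding D_def non_nbs_def by blast
    moreover have "finite D" unfolding D_def using fin by simp
    ultimately obtain y where y: "D \<subseteq> {x, y}" using small[of D] by blast
    have "clq E D"
    proof (cases "y \<in> D \<and> y \<noteq> x")
      case True
      then have "E x y" unfolding D_def non_nbs_def by blast
      then have "clq E {x, y}" using sym unfolding clq_def by blast
      then show ?thesis using y by (rule clq_subset)
    next
      case False
      then show ?thesis using y by (intro clq_subset[OF sing[of x]]) blast
    qed
    then show ?thesis using M by (intro clq_cover_2[of E D "non_nbs E W x"]) (auto simp: D_def)
  next
    case False
    then have le1: "card (non_nbs E W x) \<le> 1" if "x \<in> W" for x using that by fastforce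
    have uniq: "z = y" if "x \<in> W" "y \<in> non_nbs E W x" "z \<in> non_nbs E W x" for x y z
    proof -
      have "finite (non_nbs E W x)" unfolding non_nbs_def using fin by simp
      then show ?thesis using le1[OF that(1)] that(2,3) card_le_Suc0_iff_eq by (metis One_nat_def)
    qed
    show ?thesis
    proof (cases "clq E W")
      case True
      then show ?thesis using clq_cover_2[of E W W W] by blast
    next
      case False
      then obtain x y where xy: "x \<in> W" "y \<in> W" "x \<noteq> y" "\<not> E x y" unfolding clq_def by blast
      have "card (W - {x, y}) = card W - card {x, y}" using xy by (intro card_Diff_subset) auto
      then have "card (W - {x, y}) \<le> 2" using xy(3) c4 by simp
      then obtain z t where zt: "W - {x, y} \<subseteq> {z, t}" using small[of "W - {x, y}"] fin by blast
      have nyx: "\<not> E y x" using xy(4) sym by blast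
      have adj: "E x u" "E y u" if u: "u \<in> W - {x, y}" for u
      proof -
        show "E x u"
          using uniq[OF xy(1), of y u] u xy nyx unfolding non_nbs_def by blast
        show "E y u"
          using uniq[OF xy(2), of x u] u xy nyx unfolding non_nbs_def by blast
      qed
      have pair: "clq E (insert v ({u} \<inter> (W - {x, y})))" if "v \<in> {x, y}" for u v
        using adj[of u] that sym unfolding clq_def by blast
      show ?thesis
      proof (cases "clq E (W - {x, y})")
        case True
        have "clq E (insert x (W - {x, y}))" by (rule clq_insert[OF gr True adj(1)])
        then show ?thesis using xy by (intro clq_cover_2[OF _ sing[of y]]) auto
      next
        case False
        show ?thesis
          by (rule clq_cover_2[OF pair[of x z] pair[of y t]]) (use zt in auto)
      qed
    qed
  qed
qed

text \<open>In the triangle-free graph: a vertex of degree at most 2 is removed and coloured last.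
  If the degree of \<open>v\<close> is at least \<open>card V - 5\<close>, its neighbours form one
  class, at most four other vertices are 2-coloured by \<open>cover_four\<close>, and
  \<open>v\<close> joins either of their classes. What remains is 3-regular on 9 vertices, with the
  odd degree sum 27.\<close>

lemma triangle_free_cover:
  assumes gr: "graph_rel E" and "finite V" "alpha_le E V 2" "card V \<le> 9"
  shows "clq_cover E V 3"
  using assms(2-4)
proof (induction "card V" arbitrary: V rule: less_induct)
  case less
  note fin = less.prems(1) and al = less.prems(2) and c9 = less.prems(3)
  note sym = graph_rel_sym[OF gr]
  let ?M = "non_nbs E V"
  have finM: "finite (?M v)" for v unfolding non_nbs_def using fin by simp
  show ?case
  proof (cases "\<exists>v\<in>V. card (?M v) \<le> 2")
    case True
    then obtain v where v: "v \<in> V" "card (?M v) \<le> 2" by blast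
    have "clq_cover E (V - {v}) 3"
    proof (rule less.hyps)
      show "card (V - {v}) < card V" using v(1) fin by (intro psubset_card_mono) auto
      then show "card (V - {v}) \<le> 9" using c9 by linarith
      show "alpha_le E (V - {v}) 2" by (rule alpha_le_mono[OF al]) blast
    qed (use fin in simp)
    then have "clq_cover E (V - {v}) (Suc 2)" by simp
    then obtain C1 where C1: "clq E C1" "clq_cover E (V - {v} - C1) 2" by (rule clq_cover_remove)
    obtain C2 C3 where C: "clq E C2" "clq E C3" "V - {v} - C1 \<subseteq> C2 \<union> C3"
      "C2 \<subseteq> V - {v} - C1" "C3 \<subseteq> V - {v} - C1"
      by (rule clq_cover_2E[OF C1(2)])
    define A where "A = C1 \<inter> (V - {v})"
    define B where "B = C2"
    define D where "D = C3 - C2"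
    have clqs: "clq E A" "clq E B" "clq E D"
      unfolding A_def B_def D_def using C1(1) C(1,2) by (auto intro: clq_subset)
    have un: "V - {v} = A \<union> B \<union> D" unfolding A_def B_def D_def using C by blast
    have dis: "A \<inter> B = {}" "A \<inter> D = {}" "B \<inter> D = {}" unfolding A_def B_def D_def using C(4,5) by blast+
    have "A \<inter> ?M v = {} \<or> B \<inter> ?M v = {} \<or> D \<inter> ?M v = {}"
    proof (rule ccontr)
      assume "\<not> ?thesis"
      then obtain x y z where xyz: "x \<in> A" "y \<in> B" "z \<in> D" "{x, y, z} \<subseteq> ?M v" by blast
      have "x \<noteq> y" "x \<noteq> z" "y \<noteq> z" using xyz(1-3) dis by blast+
      then have "card {x, y, z} = 3" by simp
      moreover have "card {x, y, z} \<le> card (?M v)" by (rule card_mono[OF finM xyz(4)])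
      ultimately show False using v(2) by simp
    qed
    moreover have "clq E (insert v S)" if "S \<inter> ?M v = {}" "clq E S" "S \<subseteq> V - {v}" for S
      using that by (intro clq_insert[OF gr]) (auto simp: non_nbs_def)
    ultimately have "clq E (insert v A) \<or> clq E (insert v B) \<or> clq E (insert v D)"
      using clqs un by blast
    then show ?thesis
    proof (elim disjE)
      assume "clq E (insert v A)"
      then show ?thesis using clqs un by (intro clq_cover_3[of E "insert v A" B D]) auto
    next
      assume "clq E (insert v B)"
      then show ?thesis using clqs un by (intro clq_cover_3[of E A "insert v B" D]) auto
    next
      assume "clq E (insert v D)"
      then show ?thesis using clqs un by (intro clq_cover_3[of E A B "insert v D"]) auto
    qed
  next
    case False
    then have ge3: "3 \<le> card (?M v)" if "v \<in> V" for v using that by fastforce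
    have big: ?thesis if v: "v \<in> V" "card V \<le> 5 + card (?M v)" for v
    proof -
      define W where "W = V - {v} - ?M v"
      have sub: "?M v \<subseteq> V - {v}" unfolding non_nbs_def by blast
      have "card W = card (V - {v}) - card (?M v)"
        unfolding W_def by (rule card_Diff_subset[OF finM sub])
      then have "card W \<le> 4" using v fin by simp
      moreover have "alpha_le E W 2" by (rule alpha_le_mono[OF al]) (auto simp: W_def)
      moreover have "finite W" unfolding W_def using fin by simp
      ultimately have "clq_cover E W 2" by (intro cover_four[OF gr])
      then obtain C D where CD: "clq E C" "clq E D" "W \<subseteq> C \<union> D" "C \<subseteq> W" "D \<subseteq> W" by (rule clq_cover_2E)
      have "clq E (insert v C)"
        using CD(4) by (intro clq_insert[OF gr CD(1)]) (auto simp: W_def non_nbs_def)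
      then show ?thesis
        by (rule clq_cover_3[OF _ CD(2) clq_non_nbs[OF gr al v(1)]]) (use CD(3) in \<open>auto simp: W_def\<close>)
    qed
    show ?thesis
    proof (cases "\<exists>v\<in>V. card V \<le> 5 + card (?M v)")
      case True then show ?thesis using big by blast
    next
      case no: False
      show ?thesis
      proof (cases "V = {}")
        case True then show ?thesis unfolding clq_cover_def by (intro exI[of _ "{}"]) simp
      next
        case False
        then obtain v where "v \<in> V" by blast
        then have "5 + card (?M v) < card V" using no by auto
        then have c: "card V = 9" using ge3[OF \<open>v \<in> V\<close>] c9 by linarith
        have m3: "card (?M u) = 3" if "u \<in> V" for u
        proof -
          have "5 + card (?M u) < card V" using no that by auto
          then show ?thesis using ge3[OF that] c by linarith
        qed
        define G where "G x y \<longleftrightarrow> x \<noteq> y \<and> \<not> E x y" for x y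
        have "graph_rel G" using sym unfolding graph_rel_def G_def by blast
        then have "(\<Sum>x\<in>V. card (nbs G V {x})) = 2 * card (edges G V)" using fin by (rule handshake)
        moreover have "nbs G V {u} = ?M u" for u unfolding nbs_def non_nbs_def G_def by auto
        ultimately have "(\<Sum>x\<in>V. card (?M x)) = 2 * card (edges G V)" by simp
        moreover have "(\<Sum>x\<in>V. card (?M x)) = 27" using m3 c by simp
        ultimately show ?thesis by presburger
      qed
    qed
  qed
qed

text \<open>Executable search for a clique of the given size, branching on whether the first vertex
  belongs to it; used to check the two concrete graphs by evaluation.\<close>

fun no_clique :: "('a \<Rightarrow> 'a \<Rightarrow> bool) \<Rightarrow> nat \<Rightarrow> 'a list \<Rightarrow> bool" where
  "no_clique P 0 xs = False"
| "no_clique P (Suc k) [] = True"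
| "no_clique P (Suc k) (x # xs) = (no_clique P k (filter (P x) xs) \<and> no_clique P (Suc k) xs)"

lemma no_clique_sound:
  assumes "no_clique P k xs" "K \<subseteq> set xs" "clq P K" shows "card K \<noteq> k"
  using assms
proof (induction P k xs arbitrary: K rule: no_clique.induct)
  case (3 P k x xs)
  show ?case
  proof (cases "x \<in> K")
    case True
    have "K - {x} \<subseteq> set (filter (P x) xs)" using 3(4,5) True unfolding clq_def by auto
    moreover have "clq P (K - {x})" using 3(5) by (rule clq_subset) blast
    ultimately have "card (K - {x}) \<noteq> k" using 3(1,3) by simp
    moreover have "finite K" using 3(4) finite_subset by auto
    ultimately show ?thesis using True card_Suc_Diff1[of K x] by auto
  next
    case False
    then show ?thesis using 3 by auto
  qed
qed auto

text \<open>The distance 0 is included so that \<open>ncirc D\<close>, the complement of the circulant graph, is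
  irreflexive.\<close>

definition circ :: "nat list \<Rightarrow> nat \<Rightarrow> nat \<Rightarrow> bool" where
  "circ D x y \<longleftrightarrow> (if x \<le> y then y - x else x - y) \<in> set (0 # D)"

definition ncirc :: "nat list \<Rightarrow> nat \<Rightarrow> nat \<Rightarrow> bool" where
  "ncirc D x y \<longleftrightarrow> \<not> circ D x y"

lemma graph_rel_ncirc: "graph_rel (ncirc D)"
  unfolding graph_rel_def ncirc_def circ_def by (auto split: if_splits)

lemma clq_bound:
  assumes "no_clique P (Suc k) [0..<n]" "K \<subseteq> {0..<n}" "clq P K" shows "card K \<le> k"
proof (rule ccontr)
  assume "\<not> card K \<le> k"
  then have "Suc k \<le> card K" by simp
  then obtain L where L: "L \<subseteq> K" "card L = Suc k" by (rule obtain_subset_with_card_n)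
  have "L \<subseteq> set [0..<n]" using L(1) assms(2) by auto
  then show False using no_clique_sound[OF assms(1) _ clq_subset[OF assms(3) L(1)]] L(2) by blast
qed

section \<open>Existence of Folkman graphs\<close>

text \<open>The circulant graph on 13 vertices with distances \<open>1, 5\<close> is the extremal Ramsey \<open>(3, 5)\<close>-graph:
  two independent sets cover at most 8 vertices.\<close>

lemma folk_2: "\<exists>n. folk n 2 2"
proof -
  \<comment> \<open>\<open>circ\<close> compares plain differences, so the distances 1 and 5 modulo
    13 are listed together with 12 and 8.\<close>
  let ?E = "ncirc [1, 5, 8, 12]" and ?V = "{0..<13::nat}"
  have k5: "no_clique ?E (Suc 4) [0..<13]" by code_simp
  have i3: "no_clique (circ [1, 5, 8, 12]) (Suc 2) [0..<13]" by code_simp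
  have al: "alpha_le ?E ?V 2"
    unfolding alpha_le_def
  proof (intro allI impI)
    fix I assume I: "I \<subseteq> ?V" "indep ?E I"
    have "clq (circ [1, 5, 8, 12]) I" using I(2) unfolding clq_def indep_def ncirc_def by blast
    then show "card I \<le> 2" by (rule clq_bound[OF i3 I(1)])
  qed
  have "arr ?E ?V 2 2"
    unfolding arr_def
  proof (intro allI impI)
    fix C :: "nat \<Rightarrow> nat set" assume C: "\<forall>i<2. clq ?E (C i)"
    let ?R = "?V - (\<Union>i<2. C i)"
    have le4: "card (C i \<inter> ?V) \<le> 4" if "i < 2" for i
      by (rule clq_bound[OF k5]) (use C that in \<open>auto intro: clq_subset\<close>)
    have eq: "(\<Union>i<2. C i) = C 0 \<union> C 1" by (auto simp: less_2_cases_iff)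
    have "?V \<subseteq> (C 0 \<inter> ?V) \<union> (C 1 \<inter> ?V) \<union> ?R" unfolding eq by blast
    then have "card ?V \<le> card ((C 0 \<inter> ?V) \<union> (C 1 \<inter> ?V) \<union> ?R)" by (intro card_mono) auto
    also have "\<dots> \<le> card (C 0 \<inter> ?V) + card (C 1 \<inter> ?V) + card ?R"
      by (meson add_le_mono1 card_Un_le order_trans)
    finally have "5 \<le> card ?R" using le4[of 0] le4[of 1] by simp
    then have "\<not> clq ?E ?R" using clq_bound[OF k5, of ?R] by fastforce
    then obtain x y where xy: "x \<in> ?R" "y \<in> ?R" "x \<noteq> y" "\<not> ?E x y" unfolding clq_def by blast
    have "indep ?E {x, y}" using indep3[OF graph_rel_ncirc xy(4), of y] xy(4) graph_rel_ncirc[of "[1,5,8,12]"]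
      unfolding graph_rel_def by simp
    moreover have "card {x, y} = 2" using xy(3) by simp
    moreover have "{x, y} \<subseteq> ?R" using xy(1,2) by blast
    ultimately show "has_ind ?E ?R 2" unfolding has_ind_def by blast
  qed
  then have "folk (card ?V) 2 2" using al by (intro folk_intro[OF graph_rel_ncirc]) simp_all
  then show ?thesis by blast
qed


text \<open>The upper bound for R(3,3): of at least five other vertices, three are neighbours or
  three are non-neighbours of \<open>x\<close>.\<close>

lemma ramsey33:
  assumes gr: "graph_rel E" and fin: "finite X" and c: "6 \<le> card X"
    and cl: "\<And>K. K \<subseteq> X \<Longrightarrow> clq E K \<Longrightarrow> card K \<le> 2"
  shows "has_ind E X 3"
proof -
  note sym = graph_rel_sym[OF gr] and irr = graph_rel_irrefl[OF gr]
  obtain x where x: "x \<in> X" using c by fastforce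
  define N where "N = {y \<in> X. E x y}"
  define M where "M = non_nbs E X x"
  have finNM: "finite N" "finite M" unfolding N_def M_def non_nbs_def using fin by simp_all
  have "X - {x} = N \<union> M" unfolding N_def M_def non_nbs_def using irr by blast
  then have "card X - 1 = card (N \<union> M)" using x by (metis card_Diff_singleton)
  also have "\<dots> \<le> card N + card M" by (rule card_Un_le)
  finally have "3 \<le> card N \<or> 3 \<le> card M" using c by arith
  then show ?thesis
  proof
    assume "3 \<le> card N"
    then obtain T where T: "T \<subseteq> N" "card T = 3" by (rule obtain_subset_with_card_n)
    have "indep E T"
      unfolding indep_def
    proof (intro ballI notI)
      fix y z assume yz: "y \<in> T" "z \<in> T" "E y z"
      have xyz: "y \<in> X" "z \<in> X" "E x y" "E x z" using yz(1,2) T(1) unfolding N_def by blast+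
      then have "clq E {x, y, z}" using yz(3) sym unfolding clq_def by blast
      then have "card {x, y, z} \<le> 2" using x xyz(1,2) by (intro cl) auto
      moreover have "x \<noteq> y" "x \<noteq> z" "y \<noteq> z" using xyz yz(3) irr by auto
      ultimately show False by simp
    qed
    moreover have "T \<subseteq> X" using T(1) unfolding N_def by blast
    ultimately show ?thesis unfolding has_ind_def using T(2) by blast
  next
    assume "3 \<le> card M"
    then have "\<not> clq E M" using cl[of M] unfolding M_def non_nbs_def by fastforce
    then obtain y z where yz: "y \<in> M" "z \<in> M" "y \<noteq> z" "\<not> E y z" unfolding clq_def by blast
    have m: "y \<in> X" "y \<noteq> x" "\<not> E x y" "z \<in> X" "z \<noteq> x" "\<not> E x z"
      using yz(1,2) unfolding M_def non_nbs_def by simp_all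
    have "indep E {x, y, z}" by (rule indep3[OF gr m(3) yz(4) m(6)])
    moreover have "card {x, y, z} = 3" using m yz(3) by auto
    moreover have "{x, y, z} \<subseteq> X" using x m by blast
    ultimately show ?thesis unfolding has_ind_def by blast
  qed
qed

text \<open>The 10 arises as \<open>1 + 3 + 6\<close>. If the non-neighbours of \<open>v\<close>
  form a clique, there are at most three of them, and at least six neighbours remain, which contain
  no triangle; \<open>ramsey33\<close> applies to them. If not, two non-adjacent ones together with
  \<open>v\<close> are the desired set.\<close>

lemma ramsey34:
  assumes gr: "graph_rel E" and fin: "finite W" and c: "10 \<le> card W"
    and cl: "\<And>K. K \<subseteq> W \<Longrightarrow> clq E K \<Longrightarrow> card K \<le> 3"
  shows "has_ind E W 3"
proof -
  obtain v where v: "v \<in> W" using c by fastforce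
  define M where "M = non_nbs E W v"
  define N where "N = W - {v} - M"
  have M: "M \<subseteq> W - {v}" unfolding M_def non_nbs_def by blast
  show ?thesis
  proof (cases "clq E M")
    case True
    then have "card M \<le> 3" using M by (intro cl) auto
    moreover have "card N = card (W - {v}) - card M"
      unfolding N_def by (rule card_Diff_subset[OF finite_subset[OF M] M]) (use fin in simp)
    ultimately have "6 \<le> card N" using v c by simp
    moreover have "card K \<le> 2" if K: "K \<subseteq> N" "clq E K" for K
    proof -
      have "clq E (insert v K)"
        using K(1) by (intro clq_insert[OF gr K(2)]) (auto simp: N_def M_def non_nbs_def)
      then have "card (insert v K) \<le> 3" using K(1) v by (intro cl) (auto simp: N_def)
      moreover have "finite K" by (rule finite_subset[OF _ fin]) (use K(1) N_def in blast)
      moreover have "v \<notin> K" using K(1) N_def by blast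
      ultimately show ?thesis by simp
    qed
    moreover have "finite N" unfolding N_def using fin by simp
    ultimately have "has_ind E N 3" by (intro ramsey33[OF gr])
    then show ?thesis by (rule has_ind_mono) (auto simp: N_def)
  next
    case False
    then obtain y z where yz: "y \<in> M" "z \<in> M" "y \<noteq> z" "\<not> E y z" unfolding clq_def by blast
    have m: "y \<in> W" "y \<noteq> v" "\<not> E v y" "z \<in> W" "z \<noteq> v" "\<not> E v z"
      using yz(1,2) unfolding M_def non_nbs_def by simp_all
    have "indep E {v, y, z}" by (rule indep3[OF gr m(3) yz(4) m(6)])
    moreover have "card {v, y, z} = 3" using m yz(3) by auto
    moreover have "{v, y, z} \<subseteq> W" using v m by blast
    ultimately show ?thesis unfolding has_ind_def by blast
  qed
qed

text \<open>The Paley graph of order 17 is the extremal Ramsey \<open>(4, 4)\<close>-graph: two independent sets leave at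
  least 11 vertices, more than needed for a triangle.\<close>

lemma folk_3: "\<exists>n. folk n 2 3"
proof -
  \<comment> \<open>The nonzero squares modulo 17. The set is closed under negation, so plain
    differences suffice.\<close>
  let ?D = "[1, 2, 4, 8, 9, 13, 15, 16]"
  let ?E = "ncirc ?D" and ?V = "{0..<17::nat}"
  have k4: "no_clique ?E (Suc 3) [0..<17]" by code_simp
  have i4: "no_clique (circ ?D) (Suc 3) [0..<17]" by code_simp
  have al: "alpha_le ?E ?V 3"
    unfolding alpha_le_def
  proof (intro allI impI)
    fix I assume I: "I \<subseteq> ?V" "indep ?E I"
    have "clq (circ ?D) I" using I(2) unfolding clq_def indep_def ncirc_def by blast
    then show "card I \<le> 3" by (rule clq_bound[OF i4 I(1)])
  qed
  have "arr ?E ?V 2 3"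
    unfolding arr_def
  proof (intro allI impI)
    fix C :: "nat \<Rightarrow> nat set" assume C: "\<forall>i<2. clq ?E (C i)"
    let ?R = "?V - (\<Union>i<2. C i)"
    have le3: "card (C i \<inter> ?V) \<le> 3" if "i < 2" for i
      by (rule clq_bound[OF k4]) (use C that in \<open>auto intro: clq_subset\<close>)
    have eq: "(\<Union>i<2. C i) = C 0 \<union> C 1" by (auto simp: less_2_cases_iff)
    have "?V \<subseteq> (C 0 \<inter> ?V) \<union> (C 1 \<inter> ?V) \<union> ?R" unfolding eq by blast
    then have "card ?V \<le> card ((C 0 \<inter> ?V) \<union> (C 1 \<inter> ?V) \<union> ?R)" by (intro card_mono) auto
    also have "\<dots> \<le> card (C 0 \<inter> ?V) + card (C 1 \<inter> ?V) + card ?R"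
      by (meson add_le_mono1 card_Un_le order_trans)
    finally have "10 \<le> card ?R" using le3[of 0] le3[of 1] by simp
    then show "has_ind ?E ?R 3"
      by (intro ramsey34[OF graph_rel_ncirc] clq_bound[OF k4]) auto
  qed
  then have "folk (card ?V) 2 3" using al by (intro folk_intro[OF graph_rel_ncirc]) simp_all
  then show ?thesis by blast
qed

text \<open>Joining with the graph for \<open>p = 2\<close> raises \<open>p\<close> by two, starting
  from 2 and 3. Existence is what gives the \<open>LEAST\<close> in \<open>Fv\<close> its
  meaning.\<close>

lemma folk_exists: "2 \<le> p \<Longrightarrow> \<exists>n. folk n 2 p"
proof (induction p rule: less_induct)
  case (less p)
  consider "p = 2" | "p = 3" | "4 \<le> p" using less.prems by linarith
  then show ?case
  proof cases
    case 3
    have "p - 2 < p" "2 \<le> p - 2" using 3 by simp_all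
    then obtain n where "folk n 2 (p - 2)" using less.IH by blast
    moreover obtain m where "folk m 2 2" using folk_2 by blast
    ultimately have "folk (n + m) 2 (p - 2 + 2)" by (rule folk_join)
    moreover have "p - 2 + 2 = p" using 3 by simp
    ultimately show ?thesis by auto
  qed (use folk_2 folk_3 in blast)+
qed

section \<open>The Folkman numbers\<close>

lemma is_clique_card2:
  assumes "card K = 2" "is_clique G K" obtains x y where "K = {x, y}" "x \<noteq> y" "G x y"
  using assms unfolding card_2_iff is_clique_def by blast

text \<open>A colour class contains no edge of the graph iff it is a clique of the complement, so
  the first \<open>r\<close> classes are the deleted cliques, and the last colour is what is left.
  The bound on \<open>p\<close> keeps \<open>r + p - 2\<close> and \<open>r + p - 1\<close>
  consecutive in truncated subtraction.\<close>

lemma folk_iff: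
  assumes "2 \<le> p"
  shows "(\<exists>G. simple_graph n G \<and> vertex_arrows n G (replicate r 2 @ [p]) \<and>
    clique_number_less n G (r + p - 1)) \<longleftrightarrow> folk n r p"
proof
  assume "\<exists>G. simple_graph n G \<and> vertex_arrows n G (replicate r 2 @ [p]) \<and> clique_number_less n G (r + p - 1)"
  then obtain G where G: "simple_graph n G" "vertex_arrows n G (replicate r 2 @ [p])"
    "clique_number_less n G (r + p - 1)" by blast
  define E where "E x y \<longleftrightarrow> x \<noteq> y \<and> \<not> G x y" for x y
  let ?V = "{0..<n}"
  have symG: "G x y \<Longrightarrow> G y x" for x y using G(1) unfolding simple_graph_def by blast
  have gr: "graph_rel E" unfolding graph_rel_def E_def using symG by blast
  have ind: "is_clique G K \<longleftrightarrow> indep E K" for K unfolding is_clique_def indep_def E_def by blast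
  have "alpha_le E ?V (r + p - 2)"
  proof (rule ccontr)
    assume "\<not> alpha_le E ?V (r + p - 2)"
    then have "has_ind E ?V (Suc (r + p - 2))" using not_alpha_le[of ?V E] by simp
    then obtain I where "I \<subseteq> ?V" "indep E I" "card I = Suc (r + p - 2)" by (rule has_indE)
    then show False using G(3) assms ind unfolding clique_number_less_def by (simp add: Suc_diff_le)
  qed
  moreover have "arr E ?V r p"
    unfolding arr_def
  proof (intro allI impI)
    fix C :: "nat \<Rightarrow> nat set" assume C: "\<forall>i<r. clq E (C i)"
    \<comment> \<open>The given cliques may overlap, so each vertex chooses one that contains it;
      uncovered vertices get the last colour \<open>r\<close>.\<close>
    define c where "c v = (if \<exists>i<r. v \<in> C i then SOME i. i < r \<and> v \<in> C i else r)" for v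
    have c1: "c v < r \<and> v \<in> C (c v)" if "\<exists>i<r. v \<in> C i" for v
      using someI_ex[OF that] that unfolding c_def by simp
    have c2: "c v = r" if "\<not> (\<exists>i<r. v \<in> C i)" for v unfolding c_def by (rule if_not_P[OF that])
    have "c v < length (replicate r (2::nat) @ [p])" for v using c1[of v] c2[of v] by fastforce
    then obtain i K where i: "i < length (replicate r 2 @ [p])" and K: "K \<subseteq> ?V"
      "card K = (replicate r 2 @ [p]) ! i" "is_clique G K" "\<forall>v\<in>K. c v = i"
      using G(2) unfolding vertex_arrows_def by metis
    show "has_ind E (?V - (\<Union>i<r. C i)) p"
    proof (cases "i < r")
      case True
      then have "card K = 2" using K(2) by (simp add: nth_append)
      then obtain x y where xy: "K = {x, y}" "x \<noteq> y" "G x y" using is_clique_card2 K(3) by blast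
      have "v \<in> C i" if "v \<in> K" for v using c1[of v] c2[of v] K(4) that True by force
      then have "E x y" using C True xy(1,2) unfolding clq_def by blast
      then show ?thesis using xy(3) unfolding E_def by blast
    next
      case False
      then have ir: "i = r" using i by simp
      then have "card K = p" using K(2) by (simp add: nth_append)
      moreover have "K \<subseteq> ?V - (\<Union>i<r. C i)" using K(1,4) c1 ir by fastforce
      ultimately show ?thesis using K(3) ind unfolding has_ind_def by blast
    qed
  qed
  ultimately have "folk (card ?V) r p" by (intro folk_intro[OF gr]) simp_all
  then show "folk n r p" by simp
next
  assume "folk n r p"
  then obtain E :: "nat \<Rightarrow> nat \<Rightarrow> bool" and V where E: "graph_rel E" "finite V" "card V = n"
    "arr E V r p" "alpha_le E V (r + p - 2)"
    unfolding folk_def by blast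
  obtain h where h: "bij_betw h {0..<n} V" using ex_bij_betw_nat_finite[OF E(2)] E(3) by blast
  let ?W = "{0..<n}"
  have inj: "inj_on h ?W" and im: "h ` ?W = V"
    using bij_betw_imp_inj_on[OF h] bij_betw_imp_surj_on[OF h] by blast+
  define G where "G x y \<longleftrightarrow> x < n \<and> y < n \<and> x \<noteq> y \<and> \<not> E (h x) (h y)" for x y
  have "simple_graph n G"
    unfolding simple_graph_def G_def using graph_rel_sym[OF E(1)] by metis
  moreover have "clique_number_less n G (r + p - 1)"
    unfolding clique_number_less_def
  proof
    assume "\<exists>K\<subseteq>?W. card K = r + p - 1 \<and> is_clique G K"
    then obtain K where K: "K \<subseteq> ?W" "card K = r + p - 1" "is_clique G K" by blast
    have "indep E (h ` K)"
      unfolding indep_def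
    proof (intro ballI)
      fix x y assume "x \<in> h ` K" "y \<in> h ` K"
      then obtain a b where ab: "a \<in> K" "b \<in> K" "x = h a" "y = h b" by blast
      then show "\<not> E x y" using K(3) graph_rel_irrefl[OF E(1)] unfolding is_clique_def G_def by metis
    qed
    moreover have "h ` K \<subseteq> V" using K(1) im by blast
    ultimately have "card (h ` K) \<le> r + p - 2" using E(5) unfolding alpha_le_def by blast
    then show False using K(2) card_image[OF inj_on_subset[OF inj K(1)]] assms by simp
  qed
  moreover have "vertex_arrows n G (replicate r 2 @ [p])"
    unfolding vertex_arrows_def
  proof (intro allI impI)
    fix c :: "nat \<Rightarrow> nat" assume c: "\<forall>v<n. c v < length (replicate r 2 @ [p])"
    define D where "D i = h ` {v. v < n \<and> c v = i}" for i
    show "\<exists>i<length (replicate r 2 @ [p]). \<exists>K\<subseteq>?W. card K = (replicate r 2 @ [p]) ! i \<and>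
      is_clique G K \<and> (\<forall>v\<in>K. c v = i)"
    proof (cases "\<forall>i<r. clq E (D i)")
      case True
      then have "has_ind E (V - (\<Union>i<r. D i)) p" using E(4) unfolding arr_def by blast
      then obtain I where I: "I \<subseteq> V - (\<Union>i<r. D i)" "indep E I" "card I = p" by (rule has_indE)
      let ?K = "{x \<in> ?W. h x \<in> I}"
      have "h ` ?K = I" using I(1) im by auto
      moreover have "inj_on h ?K" by (rule inj_on_subset[OF inj]) blast
      ultimately have "card ?K = p" using I(3) card_image by metis
      moreover have "is_clique G ?K" using I(2) unfolding is_clique_def G_def indep_def by simp
      moreover have "c v = r" if v: "v \<in> ?K" for v
      proof -
        have "\<not> c v < r" using v I(1) unfolding D_def by auto
        moreover have "c v < Suc r" using c v by simp
        ultimately show ?thesis by simp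
      qed
      ultimately show ?thesis by (intro exI[of _ r] conjI exI[of _ ?K]) (auto simp: nth_append)
    next
      case False
      then obtain i where i: "i < r" "\<not> clq E (D i)" by blast
      then obtain x y where xy: "x \<in> D i" "y \<in> D i" "x \<noteq> y" "\<not> E x y" unfolding clq_def by blast
      obtain a where a: "a < n" "c a = i" "x = h a" using xy(1) unfolding D_def by blast
      obtain b where b: "b < n" "c b = i" "y = h b" using xy(2) unfolding D_def by blast
      have "a \<noteq> b" using xy(3) a(3) b(3) by auto
      moreover have "\<not> E y x" using xy(4) graph_rel_sym[OF E(1)] by blast
      ultimately have "is_clique G {a, b}" using a b xy(4) unfolding is_clique_def G_def by auto
      then show ?thesis using i(1) a b \<open>a \<noteq> b\<close>
        by (intro exI[of _ i] conjI exI[of _ "{a, b}"]) (auto simp: nth_append)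
    qed
  qed
  ultimately show "\<exists>G. simple_graph n G \<and> vertex_arrows n G (replicate r 2 @ [p]) \<and>
      clique_number_less n G (r + p - 1)" by blast
qed

lemma Fv_folk: "2 \<le> p \<Longrightarrow> Fv (replicate r 2 @ [p]) (r + p - 1) = (LEAST n. folk n r p)"
  unfolding Fv_def folk_iff ..

text \<open>Nine vertices would be covered by three cliques, and deleting two of them leaves one,
  without an independent pair. Since \<open>2 * p + 5\<close> is 9 for \<open>p = 2\<close>, this
  rules out that case.\<close>

lemma folk_2_2_ge: "folk n 2 2 \<Longrightarrow> 10 \<le> n"
proof (rule ccontr)
  assume f: "folk n 2 2" "\<not> 10 \<le> n"
  obtain E :: "nat \<Rightarrow> nat \<Rightarrow> bool" and V where E: "graph_rel E" "finite V" "card V = n" "arr E V 2 2"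
    "alpha_le E V (2 + 2 - 2)"
    using f(1) unfolding folk_def by blast
  have "clq_cover E V 3" using E f(2) by (intro triangle_free_cover) simp_all
  then show False using arr_no_cover[OF E(4), of 1] by simp
qed

lemma no_small_folk:
  assumes gr: "graph_rel E" and fin: "finite V" and p: "3 \<le> p" and r: "3 \<le> r"
    and cV: "card V \<le> r + 2 * p + 2" and ar: "arr E V r p" and al: "alpha_le E V (r + p - 2)"
    and remove_one: "\<And>C. clq E C \<Longrightarrow> has_ind E (V - C) (r + p - 2)"
  shows False
proof -
  consider "r = 3" | "r = 4" | "5 \<le> r" using r by linarith
  then show False
  proof cases
    case 1
    have ar3: "arr E V (Suc (Suc (Suc 0))) p" using ar 1 by (simp add: numeral_3_eq_3)
    have "has_ind E (V - C - D - F) p" if "clq E C" "clq E D" "clq E F" for C D F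
      using arr_remove[OF arr_remove[OF arr_remove[OF ar3 that(1)] that(2)] that(3)] unfolding arr_0 .
    then interpret three_twos E V p
      by unfold_locales (use assms 1 in \<open>simp_all add: add.commute\<close>)
    show False by (rule contradiction)
  next
    case 2
    have ar4: "arr E V (Suc (Suc (Suc (Suc 0)))) p" using ar 2 by (simp add: eval_nat_numeral)
    have "has_ind E (V - C - D - F - G) p" if "clq E C" "clq E D" "clq E F" "clq E G" for C D F G
      using arr_remove[OF arr_remove[OF arr_remove[OF arr_remove[OF ar4 that(1)] that(2)] that(3)] that(4)]
      unfolding arr_0 .
    then interpret four_twos E V p
      by unfold_locales (use assms 2 in \<open>simp_all add: add.commute\<close>)
    show False by (rule contradiction)
  next
    case 3
    obtain I where I: "I \<subseteq> V" "card I = p" using has_indE[OF arr_has_ind[OF ar]] by metis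
    then obtain v where v: "v \<in> V" using p by fastforce
    have "clq E {x, y}" if "x = y \<or> E x y" for x y
      using that graph_rel_sym[OF gr] unfolding clq_def by blast
    then have cr: "crit E V (r + p - 2)" unfolding crit_def using gr fin v al remove_one by blast
    \<comment> \<open>Against \<open>r + 2 * p + 2\<close> this leaves only r = 5 with equality.
      Adding \<open>{v}\<close> to the cover of the rest gives \<open>r + (p - 1)\<close> cliques,
      one too few for \<open>arr\<close>.\<close>
    have "2 * (r + p - 2) + 1 \<le> card V" by (rule crit_card[OF cr])
    then have r5: "r = 5" and cV': "card V \<le> 2 * (r + p - 2) + 1" using cV 3 by arith+
    have "clq_cover E (V - {v}) (r + p - 2)" by (rule crit_cover[OF cr cV' v])
    then have "clq_cover E V (Suc (r + p - 2))" by (rule clq_cover_insert) (simp add: clq_def)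
    moreover have "Suc (r + p - 2) = r + (p - 1)" using r5 p by arith
    ultimately show False using arr_no_cover[OF ar, of "p - 1"] p by simp
  qed
qed

lemma folk_least:
  assumes p: "2 \<le> p" and small: "(LEAST n. folk n 2 p) \<le> 2 * p + 5" and r: "2 \<le> r"
  shows "(LEAST n. folk n r p) = (LEAST n. folk n 2 p) + r - 2"
proof -
  define N where "N r = (LEAST n. folk n r p)" for r
  have ex2: "folk (N 2) 2 p" unfolding N_def using folk_exists[OF p] by (rule LeastI_ex)
  have p3: "3 \<le> p"
  proof (rule ccontr)
    assume "\<not> 3 \<le> p"
    then have "p = 2" using p by simp
    then show False using folk_2_2_ge ex2 small unfolding N_def by fastforce
  qed
  have up: "folk (N 2 + j) (2 + j) p" for j
  proof (induction j)
    case 0 then show ?case using ex2 by simp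
  next
    case (Suc j)
    then show ?case using folk_Suc[OF Suc.IH] by simp
  qed
  have up': "folk (N 2 + (r - 2)) r p" if "2 \<le> r" for r
    using up[of "r - 2"] unfolding le_add_diff_inverse[OF that] .
  have ex: "folk (N r) r p" if "2 \<le> r" for r
    unfolding N_def[of r] by (rule LeastI) (rule up'[OF that])
  have upper: "N r \<le> N 2 + (r - 2)" if "2 \<le> r" for r
    unfolding N_def[of r] by (rule Least_le) (rule up'[OF that])
  have "N r = N 2 + (r - 2)" if "2 \<le> r" for r
    using that
  proof (induction r rule: less_induct)
    case (less r)
    show ?case
    proof (cases "r = 2")
      case False
      then have r3: "3 \<le> r" using less.prems by simp
      have IH: "N (r - 1) = N 2 + (r - 3)" using less.IH[of "r - 1"] r3 by simp
      show ?thesis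
      proof (rule ccontr)
        assume "N r \<noteq> N 2 + (r - 2)"
        then have lt: "N r < N 2 + (r - 2)" using upper[OF less.prems] by simp
        obtain E :: "nat \<Rightarrow> nat \<Rightarrow> bool" and V where E: "graph_rel E" "finite V" "card V = N r"
          "arr E V r p" "alpha_le E V (r + p - 2)"
          using ex[OF less.prems] unfolding folk_def by blast
        obtain s where s: "r = Suc s" using r3 by (cases r) auto
        \<comment> \<open>If the independence number dropped, \<open>V - C\<close> would be a graph
          for \<open>s = r - 1\<close>, with at least \<open>N s = N 2 + (r - 3)\<close> vertices.
          But \<open>V\<close> itself has at most that many, and \<open>C\<close> removes at least
          one.\<close>
        have remove: "has_ind E (V - C) (r + p - 2)" if C: "clq E C" "C \<inter> V \<noteq> {}" for C
        proof (rule ccontr)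
          assume "\<not> has_ind E (V - C) (r + p - 2)"
          moreover have "r + p - 2 = Suc (s + p - 2)" using s r3 by simp
          ultimately have "alpha_le E (V - C) (s + p - 2)"
            using not_alpha_le[of "V - C" E "s + p - 2"] E(2) by simp
          moreover have "arr E (V - C) s p" using E(4) C(1) unfolding s by (rule arr_remove)
          ultimately have "folk (card (V - C)) s p" using E(2) by (intro folk_intro[OF E(1)]) simp_all
          then have "N s \<le> card (V - C)" unfolding N_def by (rule Least_le)
          moreover have "card (V - C) < card V" using C(2) E(2) by (intro psubset_card_mono) auto
          ultimately show False using lt E(3) IH s r3 by simp
        qed
        obtain I where I: "I \<subseteq> V" "card I = p" using has_indE[OF arr_has_ind[OF E(4)]] by metis
        then obtain v where v: "v \<in> V" using p by fastforce
        have "has_ind E (V - C) (r + p - 2)" if C: "clq E C" for C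
        proof (cases "C \<inter> V = {}")
          case True
          have "has_ind E (V - {v}) (r + p - 2)" using v by (intro remove) (auto simp: clq_def)
          then show ?thesis by (rule has_ind_mono) (use True in blast)
        next
          case False then show ?thesis by (rule remove[OF C])
        qed
        \<comment> \<open>\<open>card V \<le> N 2 + (r - 3)\<close>, and
          \<open>(2 * p + 5) + (r - 3)\<close> is \<open>r + 2 * p + 2\<close>.\<close>
        moreover have "card V \<le> r + 2 * p + 2" using E(3) lt small r3 unfolding N_def[of 2, symmetric] by simp
        ultimately show False using no_small_folk[OF E(1,2) p3 r3 _ E(4,5)] by blast
      qed
    qed simp
  qed
  from this[OF r] have "N r = N 2 + r - 2" using r by simp
  then show ?thesis unfolding N_def .
qed

theorem theorem3p12:
  fixes p :: nat
  assumes "p \<ge> 2"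
    and "Fv [2, 2, p] (p + 1) \<le> 2 * p + 5"
  shows "r_prime p = 2 \<and>
         (\<forall>r\<ge>2. Fv (replicate r 2 @ [p]) (r + p - 1) = Fv [2, 2, p] (p + 1) + r - 2)"
proof -
  have two: "Fv [2, 2, p] (p + 1) = (LEAST n. folk n 2 p)"
    using Fv_folk[OF assms(1), of 2] by (simp add: numeral_2_eq_2)
  have eq: "Fv (replicate r 2 @ [p]) (r + p - 1) = Fv [2, 2, p] (p + 1) + r - 2" if "2 \<le> r" for r
    using folk_least[OF assms(1) _ that] assms(2) unfolding two Fv_folk[OF assms(1)] by blast
  \<comment> \<open>The shifted numbers are constant, so every \<open>r\<close> from 2 on attains
    the minimum, and the least such \<open>r\<close> is 2.\<close>
  have shift: "Fshift p r = int (Fv [2, 2, p] (p + 1)) - 2" if "2 \<le> r" for r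
    unfolding Fshift_def eq[OF that] using that by simp
  have "r_prime p = 2"
    unfolding r_prime_def by (rule Least_equality) (use shift in auto)
  then show ?thesis using eq by blast
qed

end
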